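(* Let $\Omega$ be a bounded domain in $\mathbb{R}^n$, $n\ge 3$, with smooth and disconnected boundary $\partial\Omega$. There exists no positive function $u\in C^1(\bar\Omega)$ such that $\lambda(-A^u)\in\bar\Gamma_2$ in $\Omega$ in the viscosity sense and $\partial\Omega$ has non-negative mean curvature $H_{\partial\Omega}\ge 0$ with respect to the metric $g=g_u=u^{\frac{4}{n-2}}\mathring{g}$ and the normal pointing towards $\Omega$.
   Context: $\mathring g$ is the Euclidean metric. For a positive $C^2$ function $u$ on an open subset of $\mathbb{R}^n$, $$A^{u}=-\frac{2}{n-2}u^{-\frac{n+2}{n-2}}\nabla^2u+\frac{2n}{(n-2)^2}u^{-\frac{2n}{n-2}}\nabla u\otimes\nabla u-\frac{2}{(n-2)^2}u^{-\frac{2n}{n-2}}|\nabla u|^2 I ,$$ and $\lambda(M)$ denotes the eigenvalues of a symmetric matrix $M$. $\Gamma_2=\{\lambda\in\mathbb{R}^n:\sigma_1(\lambda)>0,\ \sigma_2(\lambda)>0\}$, where $\sigma_j$ is the $j$-th elementary symmetric function, and $\bar\Gamma_2$ is its closure. A positive continuous function $u$ on $\Omega$ satisfies $\lambda(-A^u)\in\bar\Gamma_2$ in the viscosity sense if for every $x_0\in\Omega$ and every positive $C^2$ function $\varphi$ near $x_0$ with $\varphi(x_0)=u(x_0)$ and $u\le\varphi$ near $x_0$, one has $\lambda(-A^\varphi(x_0))\in\bar\Gamma_2$. Mean curvature is the trace of the second fundamental form. For $u$ of class $C^1$, the mean curvature of a hypersurface $\Sigma$ with respect to $g_u$ and a specified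 normal direction is $$H_\Sigma=u^{-\frac{2}{n-2}}\Big(-\frac{2(n-1)}{n-2}\,\partial_\nu\ln u+\mathring{H}_\Sigma\Big),$$ where $\nu$ is the Euclidean unit normal in the specified direction and $\mathring H_\Sigma$ is the Euclidean mean curvature of $\Sigma$ with respect to $\nu$, with the sign convention that a round sphere of radius $r$ with normal pointing to its center has mean curvature $\frac{n-1}{r}>0$. *)

theory Defs
  imports "HOL-Analysis.Analysis"
begin

section \<open>Differentiability classes\<close>

text \<open>Intended for open \<open>S\<close>.\<close>

primrec Ck_on :: "nat \<Rightarrow> ('a::euclidean_space \<Rightarrow> real) \<Rightarrow> 'a set \<Rightarrow> bool" where
  "Ck_on 0 f S \<longleftrightarrow> continuous_on S f"
| "Ck_on (Suc k) f S \<longleftrightarrow>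
     (\<forall>x\<in>S. f differentiable (at x)) \<and>
     (\<forall>v. Ck_on k (\<lambda>x. frechet_derivative f (at x) v) S)"

definition smooth_fun_on :: "('a::euclidean_space \<Rightarrow> real) \<Rightarrow> 'a set \<Rightarrow> bool" where
  "smooth_fun_on f S \<longleftrightarrow> (\<forall>k. Ck_on k f S)"

definition gradient :: "(real^'n \<Rightarrow> real) \<Rightarrow> real^'n \<Rightarrow> real^'n" where
  "gradient f x = (\<chi> i. frechet_derivative f (at x) (axis i 1))"

definition hessian :: "(real^'n \<Rightarrow> real) \<Rightarrow> real^'n \<Rightarrow> real^'n^'n" where
  "hessian f x = (\<chi> i j. frechet_derivative (\<lambda>y. gradient f y $ j) (at x) (axis i 1))"

text \<open>The class $C^1(\bar\Omega)$: the function and its gradient on \<open>\<Omega>\<close> extend continuously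
  up to the boundary.\<close>

definition C1_closure :: "(real^'n) set \<Rightarrow> (real^'n \<Rightarrow> real) \<Rightarrow> bool" where
  "C1_closure \<Omega> u \<longleftrightarrow>
     Ck_on 1 u \<Omega> \<and> continuous_on (closure \<Omega>) u \<and>
     (\<exists>G. continuous_on (closure \<Omega>) G \<and> (\<forall>x\<in>\<Omega>. G x = gradient u x))"


section \<open>The conformal matrix, eigenvalues and the cone\<close>

definition outer :: "real^'n \<Rightarrow> real^'n \<Rightarrow> real^'n^'n" where
  "outer v w = (\<chi> i j. v $ i * w $ j)"

definition conf_mat :: "(real^'n \<Rightarrow> real) \<Rightarrow> real^'n \<Rightarrow> real^'n^'n" where
  "conf_mat u x =
     (let n = real CARD('n) in
        (- (2 / (n - 2)) * u x powr (- ((n + 2) / (n - 2)))) *\<^sub>R hessian u x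
      + (2 * n / (n - 2)^2 * u x powr (- (2 * n / (n - 2)))) *\<^sub>R outer (gradient u x) (gradient u x)
      - (2 / (n - 2)^2 * u x powr (- (2 * n / (n - 2))) * (norm (gradient u x))^2) *\<^sub>R mat 1)"

text \<open>\<open>l\<close> lists the eigenvalues of \<open>M\<close> with multiplicity. For symmetric \<open>M\<close> such an \<open>l\<close>
  exists and is unique up to permutation of the entries.\<close>

definition eigenvalues_of :: "real^'n^'n \<Rightarrow> real^'n \<Rightarrow> bool" where
  "eigenvalues_of M l \<longleftrightarrow> (\<forall>t. det (mat t - M) = (\<Prod>i\<in>UNIV. (t - l $ i)))"

definition elem_sym :: "nat \<Rightarrow> real^'n \<Rightarrow> real" where
  "elem_sym k l = (\<Sum>S\<in>{S. card S = k}. \<Prod>i\<in>S. l $ i)"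

definition Gamma2 :: "(real^'n) set" where
  "Gamma2 = {l. elem_sym 1 l > 0 \<and> elem_sym 2 l > 0}"

text \<open>Since \<open>closure Gamma2\<close> is invariant under permutations of the coordinates, membership
  does not depend on the ordering of the eigenvalues.\<close>

definition lambda_in_closure_Gamma2 :: "real^'n^'n \<Rightarrow> bool" where
  "lambda_in_closure_Gamma2 M \<longleftrightarrow> (\<exists>l. eigenvalues_of M l \<and> l \<in> closure Gamma2)"

definition viscosity_subsol :: "(real^'n) set \<Rightarrow> (real^'n \<Rightarrow> real) \<Rightarrow> bool" where
  "viscosity_subsol \<Omega> u \<longleftrightarrow>
     (\<forall>x0\<in>\<Omega>. \<forall>U \<phi>.
        open U \<longrightarrow> x0 \<in> U \<longrightarrow> U \<subseteq> \<Omega> \<longrightarrow>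
        Ck_on 2 \<phi> U \<longrightarrow> (\<forall>x\<in>U. \<phi> x > 0) \<longrightarrow>
        \<phi> x0 = u x0 \<longrightarrow> (\<forall>x\<in>U. u x \<le> \<phi> x) \<longrightarrow>
        lambda_in_closure_Gamma2 (- conf_mat \<phi> x0))"


section \<open>Smooth boundaries and mean curvature\<close>

definition local_defining_fun ::
    "(real^'n) set \<Rightarrow> real^'n \<Rightarrow> (real^'n) set \<Rightarrow> (real^'n \<Rightarrow> real) \<Rightarrow> bool" where
  "local_defining_fun \<Omega> p U \<rho> \<longleftrightarrow>
     open U \<and> p \<in> U \<and> smooth_fun_on \<rho> U \<and> (\<forall>x\<in>U. gradient \<rho> x \<noteq> 0) \<and>
     \<Omega> \<inter> U = {x\<in>U. \<rho> x > 0} \<and> frontier \<Omega> \<inter> U = {x\<in>U. \<rho> x = 0}"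

definition smooth_boundary :: "(real^'n) set \<Rightarrow> bool" where
  "smooth_boundary \<Omega> \<longleftrightarrow> (\<forall>p\<in>frontier \<Omega>. \<exists>U \<rho>. local_defining_fun \<Omega> p U \<rho>)"

text \<open>The unit normal pointing towards \<open>\<Omega>\<close>; it does not depend on the defining function.\<close>

definition inner_normal :: "(real^'n) set \<Rightarrow> real^'n \<Rightarrow> real^'n" where
  "inner_normal \<Omega> p =
     (THE \<nu>. \<exists>U \<rho>. local_defining_fun \<Omega> p U \<rho> \<and> \<nu> = gradient \<rho> p /\<^sub>R norm (gradient \<rho> p))"

text \<open>The second fundamental form at \<open>p\<close> of a hypersurface \<open>\<Sigma>\<close> with unit normal field \<open>\<nu>\<close> on
  \<open>\<Sigma>\<close>, to be used for tangent vectors \<open>X\<close>, \<open>Y\<close> only: the derivative within \<open>\<Sigma>\<close> is uniquely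
  determined on tangent vectors, but its value on other vectors is arbitrary.
  The sign makes the second fundamental form of a round sphere positive
  for the normal pointing to the center.\<close>

definition second_fundamental_form ::
    "(real^'n) set \<Rightarrow> (real^'n \<Rightarrow> real^'n) \<Rightarrow> real^'n \<Rightarrow> real^'n \<Rightarrow> real^'n \<Rightarrow> real" where
  "second_fundamental_form \<Sigma> \<nu> p X Y = - (frechet_derivative \<nu> (at p within \<Sigma>) X \<bullet> Y)"

definition trace_on :: "(real^'n) set \<Rightarrow> (real^'n \<Rightarrow> real^'n \<Rightarrow> real) \<Rightarrow> real" where
  "trace_on T \<beta> =
     (\<Sum>b\<in>(SOME B. B \<subseteq> T \<and> pairwise orthogonal B \<and> (\<forall>b\<in>B. norm b = 1) \<and> span B = T). \<beta> b b)"

definition euclidean_mean_curvature ::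
    "(real^'n) set \<Rightarrow> (real^'n \<Rightarrow> real^'n) \<Rightarrow> real^'n \<Rightarrow> real" where
  "euclidean_mean_curvature \<Sigma> \<nu> p =
     trace_on {X. X \<bullet> \<nu> p = 0} (second_fundamental_form \<Sigma> \<nu> p)"

text \<open>Derivative along the inner normal at a boundary point, computed from the continuous extension
  to the closure of the gradient on \<open>\<Omega>\<close>.\<close>

definition boundary_normal_deriv :: "(real^'n) set \<Rightarrow> (real^'n \<Rightarrow> real) \<Rightarrow> real^'n \<Rightarrow> real" where
  "boundary_normal_deriv \<Omega> w p = Lim (at p within \<Omega>) (gradient w) \<bullet> inner_normal \<Omega> p"

text \<open>Mean curvature of the boundary with respect to the conformal metric
  \<open>u\<close>$^{4/(n-2)}$ times the Euclidean metric and the normal pointing towards \<open>\<Omega>\<close>.\<close>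

definition boundary_mean_curvature :: "(real^'n) set \<Rightarrow> (real^'n \<Rightarrow> real) \<Rightarrow> real^'n \<Rightarrow> real" where
  "boundary_mean_curvature \<Omega> u p =
     (let n = real CARD('n) in
        u p powr (- (2 / (n - 2))) *
          (- (2 * (n - 1) / (n - 2)) * boundary_normal_deriv \<Omega> (\<lambda>x. ln (u x)) p
           + euclidean_mean_curvature (frontier \<Omega>) (inner_normal \<Omega>) p))"

end

theory Submission
  imports Defs
begin

text \<open>Put $f = \frac{2}{n-2}\ln u$ and let $T$ be the hyperplane orthogonal to a unit vector $\nu$.
  Since $\lambda(-A^u)\in\bar\Gamma_2$ makes the sum of any $n-1$ eigenvalues of $-A^u$ nonnegative,
  $\mathrm{tr}_T\nabla^2 f \ge \frac{3-n}{2}|\nabla f|^2 - (\partial_\nu f)^2$ in the viscosity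
  sense. Hence $\psi = f + \frac{\varepsilon}{2}|x|^2$ with small $\varepsilon$ is strictly
  subharmonic on every hyperplane wherever its gradient is small. Now look at the mountain pass
  of $\psi$ between two parts of the disconnected boundary, found by maximising the minimal value of
  $\psi$ along chains of steps shorter than a small $d$: just at the optimal level, two
  separated pieces of the superlevel set (the boundary included) have distance exactly $d$. If the
  closest points are both interior, the gradients there are small and opposite; the two pieces
  have boundaries with superharmonic graphs over the hyperplane orthogonal to the connecting
  segment, and their gap has a minimum, which is impossible. If one of them lies on $\partial\Omega$,
  a translate of $\partial\Omega$ touches the superlevel set, which contradicts $H_{\partial\Omega}\ge 0$.\<close>

section \<open>Eigenvalues and tangential traces\<close>

text \<open>The obstacle is regularity. As \<open>u\<close> is only C^1 and the inequality holds
  only in the viscosity sense, level sets of \<psi> have no second fundamental form, and the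
  inequalities for two pieces of a level set cannot be added pointwise. Two tools compensate.
  \<open>touching_sublevel_set\<close> transfers the inequality to a smooth hypersurface touching a
  superlevel set from outside. \<open>subsolutions_sum_no_local_max\<close> adds two strict
  subsolutions: each is compared with the resolvent of the Laplacian applied to a trigonometric
  approximation of it, and the resolvent is linear and obeys the maximum principle. Chains replace
  paths because a critical point of a genuine mountain pass offers no direction to graph over,
  whereas a closest pair at positive distance supplies the direction and gradients along it. The
  constant \<epsilon> satisfies \<epsilon> R^2 = 1/4, where R bounds |x| on the closure: then (2
  \<epsilon> R)^2 = \<epsilon>, and the quadratic gradient terms stay below the gain (n-1)
  \<epsilon>.\<close>

definition tangential_trace :: "real^'n \<Rightarrow> real^'n^'n \<Rightarrow> real" where
  "tangential_trace \<nu> M = trace M - \<nu> \<bullet> (M *v \<nu>)"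

text \<open>Eigenvalues are given only through the characteristic polynomial. The derivative at
  \<open>s = 0\<close> of its reversal det (1 - s M) is computed twice: from the factors
  \<open>1 - s * l $ i\<close> and from the Leibniz formula.\<close>

lemma trace_eq_sum_eigenvalues:
  fixes M :: "real^'n^'n"
  assumes "eigenvalues_of M l"
  shows "trace M = (\<Sum>i\<in>UNIV. l $ i)"
proof -
  define F where "F = (\<lambda>s::real. det (mat 1 - s *\<^sub>R M))"
  have Feq: "F s = (\<Prod>i\<in>UNIV. 1 - s * l $ i)" for s
  proof (cases "s = 0")
    case True
    then show ?thesis by (simp add: F_def)
  next
    case False
    have "mat 1 - s *\<^sub>R M = s *\<^sub>R (mat (1/s) - M)"
      using False by (simp add: vec_eq_iff mat_def algebra_simps)
    then have "F s = det (\<chi> i. s *s (mat (1/s) - M) $ i)"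
      unfolding F_def by (intro arg_cong[where f = det]) (simp add: vec_eq_iff right_diff_distrib)
    also have "\<dots> = (\<Prod>i\<in>(UNIV::'n set). s) * (\<Prod>i\<in>UNIV. (1/s - l $ i))"
      unfolding det_rows_mul vec_lambda_eta using assms by (simp add: eigenvalues_of_def)
    also have "\<dots> = (\<Prod>i\<in>UNIV. 1 - s * l $ i)"
      unfolding prod.distrib[symmetric] using False by (intro prod.cong) (auto simp: field_simps)
    finally show ?thesis .
  qed
  have "(F has_real_derivative (- (\<Sum>i\<in>UNIV. l $ i))) (at 0)"
    unfolding Feq[abs_def]
    by (rule DERIV_cong, rule has_field_derivative_prod, (rule derivative_eq_intros refl)+)
      (simp add: sum_negf)
  moreover have "(F has_real_derivative (- trace M)) (at 0)"
  proof -
    have *: "((\<lambda>s. \<Prod>i\<in>UNIV. (mat 1 - s *\<^sub>R M) $ i $ p i) has_real_derivative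
        (if p = id then - trace M else 0)) (at 0)"
      if p: "p permutes (UNIV :: 'n set)" for p
    proof -
      have "((\<lambda>s. \<Prod>i\<in>UNIV. (mat 1 - s *\<^sub>R M) $ i $ p i) has_real_derivative
          (\<Sum>i\<in>UNIV. - M $ i $ p i * (\<Prod>j\<in>UNIV - {i}. (mat 1 :: real^'n^'n) $ j $ p j))) (at 0)"
        by (rule DERIV_cong, rule has_field_derivative_prod)
          (auto intro!: derivative_eq_intros)
      moreover have "(\<Sum>i\<in>UNIV. - M $ i $ p i * (\<Prod>j\<in>UNIV - {i}. (mat 1 :: real^'n^'n) $ j $ p j))
          = (if p = id then - trace M else 0)"
      proof (cases "p = id")
        case True
        then show ?thesis by (simp add: mat_def trace_def sum_negf)
      next
        case False
        \<comment> \<open>A permutation other than the identity moves at least two indices, so a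
          zero entry of the unit matrix remains after factor \<open>i\<close> is removed.\<close>
        have zero: "(\<Prod>j\<in>UNIV - {i}. (mat 1 :: real^'n^'n) $ j $ p j) = 0" for i
        proof -
          obtain a where a: "p a \<noteq> a" using False by (auto simp: fun_eq_iff)
          have "\<exists>j. j \<noteq> i \<and> p j \<noteq> j"
          proof (cases "a = i")
            case True
            then show ?thesis using a p by (metis permutes_inj injD)
          qed (use a in auto)
          then show ?thesis by (intro prod_zero) (force simp: mat_def)+
        qed
        show ?thesis using False by (simp only: zero mult_zero_right sum.neutral_const if_False)
      qed
      ultimately show ?thesis by simp
    qed
    have "(F has_real_derivative
       (\<Sum>p | p permutes (UNIV :: 'n set). of_int (sign p) * (if p = id then - trace M else 0))) (at 0)"
      unfolding F_def det_def by (intro DERIV_sum DERIV_cmult *) auto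
    also have "(\<Sum>p | p permutes (UNIV :: 'n set). of_int (sign p) * (if p = id then - trace M else 0))
       = (\<Sum>p | p permutes (UNIV :: 'n set). if p = id then - trace M else 0)"
      by (intro sum.cong) auto
    also have "\<dots> = - trace M"
      by (subst sum.delta) (auto simp: permutes_id)
    finally show ?thesis .
  qed
  ultimately show ?thesis using DERIV_unique by fastforce
qed

lemma symmetric_matrix_inner:
  fixes M :: "real^'n^'n"
  assumes "transpose M = M"
  shows "x \<bullet> (M *v y) = (M *v x) \<bullet> y"
  by (metis assms dot_lmul_matrix transpose_matrix_vector vector_transpose_matrix)

text \<open>A maximiser \<open>w\<close> of the quadratic form on the unit sphere is an eigenvector;
  its eigenvalue, the maximal value, is a root of the characteristic polynomial and hence an entry
  of \<open>l\<close>.\<close>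

lemma rayleigh_quotient_le_eigenvalue:
  fixes M :: "real^'n^'n"
  assumes M: "transpose M = M" and l: "eigenvalues_of M l" and \<nu>: "norm \<nu> = 1"
  shows "\<exists>i. \<nu> \<bullet> (M *v \<nu>) \<le> l $ i"
proof -
  have ne: "sphere (0::real^'n) 1 \<noteq> {}" using \<nu> by (metis dist_0_norm empty_iff mem_sphere)
  obtain w where w: "w \<in> sphere 0 1" and wmax: "\<And>v. v \<in> sphere 0 1 \<Longrightarrow> v \<bullet> (M *v v) \<le> w \<bullet> (M *v w)"
    using continuous_attains_sup[OF compact_sphere ne, of "\<lambda>v. v \<bullet> (M *v v)"]
    by (force intro!: continuous_intros matrix_vector_mult_linear_continuous_on)
  define \<mu> where "\<mu> = w \<bullet> (M *v w)"
  have bound: "v \<bullet> (M *v v) \<le> \<mu> * (v \<bullet> v)" for v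
  proof (cases "v = 0")
    case False
    have "(v /\<^sub>R norm v) \<bullet> (M *v (v /\<^sub>R norm v)) \<le> \<mu>"
      unfolding \<mu>_def using False by (intro wmax) auto
    moreover have "(v /\<^sub>R norm v) \<bullet> (M *v (v /\<^sub>R norm v)) = (v \<bullet> (M *v v)) / (v \<bullet> v)"
      by (simp add: matrix_vector_mult_scaleR inverse_eq_divide divide_divide_eq_left
          power2_norm_eq_inner[symmetric] power2_eq_square)
    ultimately show ?thesis using False by (simp add: divide_le_eq)
  qed simp
  define r where "r = M *v w - \<mu> *\<^sub>R w"
  have ww: "w \<bullet> w = 1" using w by (simp add: norm_eq_1)
  have wr: "w \<bullet> r = 0" by (simp add: r_def inner_diff_right ww \<mu>_def)
  have rr: "r \<bullet> (M *v w) = r \<bullet> r"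
    using wr by (simp add: r_def inner_diff_right inner_diff_left inner_commute)
  \<comment> \<open>Moving from \<open>w\<close> along the residual \<open>r\<close> gains 2 s |r|^2
    to first order, against an error of order s^2; maximality therefore forces r = 0.\<close>
  have key: "2 * s * (r \<bullet> r) \<le> s^2 * (\<mu> * (r \<bullet> r) - r \<bullet> (M *v r))" for s
  proof -
    have "(w + s *\<^sub>R r) \<bullet> (M *v (w + s *\<^sub>R r)) = \<mu> + 2 * s * (r \<bullet> r) + s^2 * (r \<bullet> (M *v r))"
      using symmetric_matrix_inner[OF M, of w r] rr
      by (simp add: matrix_vector_right_distrib matrix_vector_mult_scaleR inner_add_left inner_add_right
          \<mu>_def power2_eq_square algebra_simps inner_commute)
    moreover have "(w + s *\<^sub>R r) \<bullet> (w + s *\<^sub>R r) = 1 + s^2 * (r \<bullet> r)"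
      using wr by (simp add: inner_add_left inner_add_right ww power2_eq_square algebra_simps inner_commute)
    ultimately show ?thesis using bound[of "w + s *\<^sub>R r"] by (simp add: algebra_simps)
  qed
  have "r \<bullet> r \<le> 0"
  proof (rule ccontr)
    assume "\<not> r \<bullet> r \<le> 0"
    then have pos: "r \<bullet> r > 0" by linarith
    define C where "C = \<bar>\<mu> * (r \<bullet> r) - r \<bullet> (M *v r)\<bar> + 1"
    define s where "s = (r \<bullet> r) / C"
    have C: "C > 0" by (simp add: C_def)
    then have s: "s > 0" using pos by (simp add: s_def)
    have "s^2 * (\<mu> * (r \<bullet> r) - r \<bullet> (M *v r)) \<le> s^2 * C"
      by (intro mult_left_mono) (auto simp: C_def)
    also have "\<dots> = s * (r \<bullet> r)" using C by (simp add: s_def power2_eq_square)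
    finally have "2 * s * (r \<bullet> r) \<le> s * (r \<bullet> r)" using key[of s] by linarith
    then show False using s pos by (simp add: mult_le_cancel_right)
  qed
  then have "r = 0" by (metis inner_gt_zero_iff linorder_not_le)
  then have Mw: "M *v w = \<mu> *\<^sub>R w" by (simp add: r_def)
  have "(mat \<mu> - M) *v w = 0"
    by (simp add: matrix_vector_mult_diff_rdistrib Mw)
      (simp add: vec_eq_iff matrix_vector_mult_def mat_def if_distrib if_distribR cong: if_cong)
  moreover have "w \<noteq> 0" using w by auto
  ultimately have "det (mat \<mu> - M) = 0"
    by (metis invertible_det_nz invertible_left_inverse matrix_left_invertible_ker)
  then have "(\<Prod>i\<in>UNIV. (\<mu> - l $ i)) = 0" using l by (simp add: eigenvalues_of_def)
  then obtain i where "\<mu> = l $ i" by auto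
  then show ?thesis using wmax[of \<nu>] \<nu> unfolding \<mu>_def by (intro exI[of _ i]) auto
qed

lemma sum_prod_pairs:
  fixes f :: "'a \<Rightarrow> real"
  assumes "finite A"
  shows "2 * (\<Sum>S | S \<subseteq> A \<and> card S = 2. \<Prod>i\<in>S. f i) = (\<Sum>i\<in>A. f i)^2 - (\<Sum>i\<in>A. (f i)^2)"
  using assms
proof (induction A)
  case empty
  have "{S. S = ({}::'a set) \<and> card S = 2} = {}" by auto
  then show ?case by simp
next
  case (insert a A)
  have eq: "{S. S \<subseteq> insert a A \<and> card S = 2} = {S. S \<subseteq> A \<and> card S = 2} \<union> (\<lambda>b. {a,b}) ` A"
    (is "?L = ?R")
  proof (intro equalityI subsetI)
    fix S assume "S \<in> ?L"
    then obtain x y where "S = {x,y}" "x \<noteq> y" "S \<subseteq> insert a A" by (auto simp: card_2_iff)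
    then show "S \<in> ?R" using insert.hyps by (auto simp: insert_commute)
  next
    fix S assume "S \<in> ?R" then show "S \<in> ?L" using insert.hyps by (auto simp: card_insert_if)
  qed
  have inj: "inj_on (\<lambda>b. {a,b}) A" using insert.hyps by (auto simp: inj_on_def doubleton_eq_iff)
  have "(\<Sum>S | S \<subseteq> insert a A \<and> card S = 2. \<Prod>i\<in>S. f i)
      = (\<Sum>S | S \<subseteq> A \<and> card S = 2. \<Prod>i\<in>S. f i) + (\<Sum>S\<in>(\<lambda>b. {a,b}) ` A. \<Prod>i\<in>S. f i)"
    unfolding eq using insert.hyps by (intro sum.union_disjoint) auto
  also have "(\<Sum>S\<in>(\<lambda>b. {a,b}) ` A. \<Prod>i\<in>S. f i) = (\<Sum>b\<in>A. f a * f b)"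
    using insert.hyps by (subst sum.reindex[OF inj]) (rule sum.cong[OF refl], unfold o_def, subst prod.insert, auto)
  finally show ?case using insert
    by (simp add: sum_distrib_left sum_distrib_right power2_eq_square algebra_simps)
qed

text \<open>Twice the second symmetric function is the square of the sum minus the sum of squares.
  Its positivity bounds each |entry| by the positive sum, and the weak inequality is a closed
  condition.\<close>

lemma closure_Gamma2_bound:
  fixes l :: "real^'n"
  assumes "l \<in> closure Gamma2"
  shows "l $ i \<le> (\<Sum>j\<in>UNIV. l $ j)"
proof -
  have "Gamma2 \<subseteq> {l :: real^'n. l $ i \<le> (\<Sum>j\<in>UNIV. l $ j)}"
  proof
    fix l :: "real^'n" assume "l \<in> Gamma2"
    moreover have "{S :: 'n set. card S = 1} = (\<lambda>i. {i}) ` UNIV"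
      by (auto simp: card_1_singleton_iff)
    ultimately have s1: "(\<Sum>j\<in>UNIV. l $ j) > 0" and s2: "(\<Sum>S | card S = 2. \<Prod>i\<in>S. l $ i) > 0"
      by (auto simp: Gamma2_def elem_sym_def sum.reindex)
    have "(\<Sum>i\<in>UNIV. (l $ i)^2) \<le> (\<Sum>j\<in>UNIV. l $ j)^2"
      using s2 sum_prod_pairs[of "UNIV :: 'n set" "\<lambda>i. l $ i"] by simp
    moreover have "(l $ i)^2 \<le> (\<Sum>i\<in>UNIV. (l $ i)^2)"
      by (intro member_le_sum) auto
    ultimately have "(l $ i)^2 \<le> (\<Sum>j\<in>UNIV. l $ j)^2" by linarith
    then show "l \<in> {l. l $ i \<le> (\<Sum>j\<in>UNIV. l $ j)}" using s1 by (auto intro: power2_le_imp_le)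
  qed
  moreover have "closed {l :: real^'n. l $ i \<le> (\<Sum>j\<in>UNIV. l $ j)}"
    by (intro closed_Collect_le continuous_intros)
  ultimately show ?thesis using assms closure_minimal by blast
qed

lemma tangential_trace_nonneg:
  assumes "lambda_in_closure_Gamma2 M" and "transpose M = M" and "norm \<nu> = 1"
  shows "tangential_trace \<nu> M \<ge> 0"
proof -
  obtain l where l: "eigenvalues_of M l" "l \<in> closure Gamma2"
    using assms(1) by (auto simp: lambda_in_closure_Gamma2_def)
  obtain i where "\<nu> \<bullet> (M *v \<nu>) \<le> l $ i"
    using rayleigh_quotient_le_eigenvalue[OF assms(2) l(1) assms(3)] by blast
  also have "\<dots> \<le> trace M"
    using closure_Gamma2_bound[OF l(2)] trace_eq_sum_eigenvalues[OF l(1)] by simp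
  finally show ?thesis by (simp add: tangential_trace_def)
qed

section \<open>Viscosity inequalities on hyperplanes\<close>

lemma tangential_trace_add: "tangential_trace \<nu> (M + N) = tangential_trace \<nu> M + tangential_trace \<nu> N"
  by (simp add: tangential_trace_def trace_add matrix_vector_mult_add_rdistrib inner_add_right)

lemma tangential_trace_scaleR: "tangential_trace \<nu> (c *\<^sub>R M) = c * tangential_trace \<nu> M"
  by (simp add: tangential_trace_def trace_def sum_distrib_left right_diff_distrib
      scaleR_matrix_vector_assoc[symmetric])

lemma tangential_trace_minus: "tangential_trace \<nu> (- M) = - tangential_trace \<nu> M"
  using tangential_trace_scaleR[of \<nu> "-1" M] by simp

lemma tangential_trace_diff: "tangential_trace \<nu> (M - N) = tangential_trace \<nu> M - tangential_trace \<nu> N"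
  using tangential_trace_add[of \<nu> M "- N"] by (simp add: tangential_trace_minus)

lemma outer_mult_vector: "outer v w *v x = (w \<bullet> x) *\<^sub>R v"
  by (simp add: outer_def vec_eq_iff matrix_vector_mult_def inner_vec_def sum_distrib_left sum_distrib_right mult_ac)

lemma tangential_trace_outer: "tangential_trace \<nu> (outer v w) = v \<bullet> w - (\<nu> \<bullet> v) * (w \<bullet> \<nu>)"
  by (simp add: tangential_trace_def outer_mult_vector) (simp add: trace_def outer_def inner_vec_def mult.commute)

lemma tangential_trace_mat_1: "tangential_trace \<nu> (mat 1 :: real^'n^'n) = real CARD('n) - \<nu> \<bullet> \<nu>"
  by (simp add: tangential_trace_def trace_I)

lemma tangential_trace_zero: "tangential_trace \<nu> 0 = 0"
  by (simp add: tangential_trace_def trace_def)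

lemmas tangential_trace_simps = tangential_trace_add tangential_trace_scaleR tangential_trace_minus
  tangential_trace_diff tangential_trace_outer tangential_trace_mat_1 tangential_trace_zero

lemma transpose_add: "transpose (A + B) = transpose A + transpose (B :: real^'n^'m)"
  by (simp add: transpose_def vec_eq_iff)

lemma transpose_scaleR: "transpose (c *\<^sub>R A) = c *\<^sub>R transpose (A :: real^'n^'m)"
  by (simp add: transpose_def vec_eq_iff)

lemma transpose_outer: "transpose (outer v w) = outer w v"
  by (simp add: transpose_def outer_def vec_eq_iff mult.commute)

lemma continuous_on_outer:
  assumes "continuous_on U f" "continuous_on U g"
  shows "continuous_on U (\<lambda>x. outer (f x) (g x))"
  unfolding outer_def using assms by (intro continuous_intros continuous_on_vec_lambda)

text \<open>Gradient and Hessian are carried as explicit fields, so that test functions can be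
  assembled by sums, multiples and compositions. Symmetry of \<open>H\<close> belongs to the data
  and is preserved by these operations; it takes the place of Schwarz's theorem.\<close>

definition C2_jet :: "(real^'n \<Rightarrow> real) \<Rightarrow> (real^'n \<Rightarrow> real^'n) \<Rightarrow> (real^'n \<Rightarrow> real^'n^'n) \<Rightarrow> (real^'n) set \<Rightarrow> bool" where
  "C2_jet \<phi> g H U \<longleftrightarrow> open U \<and>
     (\<forall>x\<in>U. (\<phi> has_derivative (\<lambda>h. g x \<bullet> h)) (at x)) \<and>
     (\<forall>x\<in>U. (g has_derivative (\<lambda>h. H x *v h)) (at x)) \<and>
     continuous_on U H \<and> (\<forall>x\<in>U. transpose (H x) = H x)"

lemma C2_jetI:
  assumes "open U" "\<And>x. x \<in> U \<Longrightarrow> (\<phi> has_derivative (\<lambda>h. g x \<bullet> h)) (at x)"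
    "\<And>x. x \<in> U \<Longrightarrow> (g has_derivative (\<lambda>h. H x *v h)) (at x)"
    "continuous_on U H" "\<And>x. x \<in> U \<Longrightarrow> transpose (H x) = H x"
  shows "C2_jet \<phi> g H U"
  using assms by (auto simp: C2_jet_def)

lemma C2_jet_subset: "C2_jet \<phi> g H U \<Longrightarrow> open V \<Longrightarrow> V \<subseteq> U \<Longrightarrow> C2_jet \<phi> g H V"
  unfolding C2_jet_def by (blast intro: continuous_on_subset)

lemma C2_jet_continuous_gradient: "C2_jet \<phi> g H U \<Longrightarrow> continuous_on U g"
  unfolding C2_jet_def by (meson continuous_at_imp_continuous_on has_derivative_continuous)

lemma C2_jet_const: "open U \<Longrightarrow> C2_jet (\<lambda>x. c) (\<lambda>x. 0) (\<lambda>x. 0) U"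
  by (auto simp: C2_jet_def transpose_def vec_eq_iff)

lemma C2_jet_add:
  assumes "C2_jet \<phi> g H U" "C2_jet \<phi>' g' H' U"
  shows "C2_jet (\<lambda>x. \<phi> x + \<phi>' x) (\<lambda>x. g x + g' x) (\<lambda>x. H x + H' x) U"
  using assms unfolding C2_jet_def
  by (auto intro!: derivative_eq_intros continuous_intros simp: inner_add_left matrix_vector_mult_add_rdistrib transpose_add)

lemma C2_jet_cmult:
  assumes "C2_jet \<phi> g H U"
  shows "C2_jet (\<lambda>x. c * \<phi> x) (\<lambda>x. c *\<^sub>R g x) (\<lambda>x. c *\<^sub>R H x) U"
  using assms unfolding C2_jet_def
  by (auto intro!: derivative_eq_intros continuous_intros simp: scaleR_matrix_vector_assoc transpose_scaleR)

lemma C2_jet_sqdist: "open U \<Longrightarrow> C2_jet (\<lambda>x. (norm (x - a))^2) (\<lambda>x. 2 *\<^sub>R (x - a)) (\<lambda>x. 2 *\<^sub>R mat 1) U"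
  unfolding power2_norm_eq_inner
  by (rule C2_jetI)
     (auto intro!: derivative_eq_intros continuous_intros simp: inner_commute scaleR_matrix_vector_assoc[symmetric] transpose_scaleR transpose_mat)

lemma C2_jet_compose:
  assumes "C2_jet \<phi> g H U"
    and F: "\<And>t. (F has_real_derivative F' t) (at t)" and F': "\<And>t. (F' has_real_derivative F'' t) (at t)"
    and F'': "continuous_on UNIV F''"
  shows "C2_jet (\<lambda>x. F (\<phi> x)) (\<lambda>x. F' (\<phi> x) *\<^sub>R g x)
            (\<lambda>x. F' (\<phi> x) *\<^sub>R H x + F'' (\<phi> x) *\<^sub>R outer (g x) (g x)) U"
proof -
  note J = assms(1)[unfolded C2_jet_def]
  have c\<phi>: "continuous_on U \<phi>" using J by (meson continuous_at_imp_continuous_on has_derivative_continuous)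
  have cg: "continuous_on U g" using J by (meson continuous_at_imp_continuous_on has_derivative_continuous)
  have cF': "continuous_on UNIV F'" using F' by (meson DERIV_continuous_on DERIV_subset UNIV_I subset_UNIV)
  note [derivative_intros] = DERIV_compose_FDERIV[OF F] DERIV_compose_FDERIV[OF F']
  show ?thesis
  proof (rule C2_jetI)
    fix x assume x: "x \<in> U"
    have d1: "(\<phi> has_derivative (\<lambda>h. g x \<bullet> h)) (at x)" and d2: "(g has_derivative (\<lambda>h. H x *v h)) (at x)"
      using J x by auto
    show "((\<lambda>x. F (\<phi> x)) has_derivative (\<lambda>h. (F' (\<phi> x) *\<^sub>R g x) \<bullet> h)) (at x)"
      using d1 by (auto intro!: derivative_eq_intros)
    show "((\<lambda>x. F' (\<phi> x) *\<^sub>R g x) has_derivative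
       (\<lambda>h. (F' (\<phi> x) *\<^sub>R H x + F'' (\<phi> x) *\<^sub>R outer (g x) (g x)) *v h)) (at x)"
      using d1 d2 by (auto intro!: derivative_eq_intros
          simp: matrix_vector_mult_add_rdistrib scaleR_matrix_vector_assoc[symmetric] outer_mult_vector mult_ac)
    show "transpose (F' (\<phi> x) *\<^sub>R H x + F'' (\<phi> x) *\<^sub>R outer (g x) (g x)) =
         F' (\<phi> x) *\<^sub>R H x + F'' (\<phi> x) *\<^sub>R outer (g x) (g x)"
      using J x by (simp add: transpose_add transpose_scaleR transpose_outer)
  next
    show "continuous_on U (\<lambda>x. F' (\<phi> x) *\<^sub>R H x + F'' (\<phi> x) *\<^sub>R outer (g x) (g x))"
      using J c\<phi> cg by (intro continuous_intros continuous_on_outer continuous_on_compose2[OF cF']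
          continuous_on_compose2[OF F'']) auto
  qed (use J in auto)
qed

lemma gradient_eqI:
  assumes "(\<phi> has_derivative (\<lambda>h. p \<bullet> h)) (at x)"
  shows "gradient \<phi> x = p"
  using frechet_derivative_at[OF assms] by (simp add: gradient_def vec_eq_iff inner_axis fun_eq_iff) (metis inner_axis inner_real_def mult.right_neutral)

lemma C2_jet_hessian:
  assumes J: "C2_jet \<phi> g H U" and x: "x \<in> U"
  shows "hessian \<phi> x = H x"
proof -
  have op: "open U" using J by (simp add: C2_jet_def)
  have "((\<lambda>y. gradient \<phi> y $ j) has_derivative (\<lambda>h. (H x *v h) $ j)) (at x)" for j
  proof (rule has_derivative_transform_within_open[OF _ op x])
    show "((\<lambda>y. g y $ j) has_derivative (\<lambda>h. (H x *v h) $ j)) (at x)"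
      using J x by (auto simp: C2_jet_def intro!: derivative_eq_intros bounded_linear.has_derivative[OF bounded_linear_vec_nth])
  qed (use J in \<open>auto simp: C2_jet_def dest!: bspec intro!: gradient_eqI[symmetric]\<close>, metis gradient_eqI)
  then have "frechet_derivative (\<lambda>y. gradient \<phi> y $ j) (at x) = (\<lambda>h. (H x *v h) $ j)" for j
    by (metis frechet_derivative_at)
  \<comment> \<open>Entry (i, j) of \<open>hessian\<close> differentiates component j of the
    gradient in direction i, hence the transpose; symmetry of \<open>H\<close> removes it.\<close>
  then have "hessian \<phi> x = transpose (H x)"
    by (simp add: hessian_def transpose_def vec_eq_iff matrix_vector_mult_basis column_def)
  then show ?thesis using J x by (simp add: C2_jet_def)
qed

lemma C2_jet_Ck_on:
  assumes J: "C2_jet \<phi> g H U"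
  shows "Ck_on 2 \<phi> U"
proof -
  have op: "open U" using J by (simp add: C2_jet_def)
  have fd: "frechet_derivative \<phi> (at x) v = g x \<bullet> v" if "x \<in> U" for x v
    using J that by (metis C2_jet_def frechet_derivative_at)
  have d: "((\<lambda>x. frechet_derivative \<phi> (at x) v) has_derivative (\<lambda>h. (H x *v h) \<bullet> v)) (at x)" if "x \<in> U" for x v
  proof (rule has_derivative_transform_within_open[OF _ op that])
    show "((\<lambda>x. g x \<bullet> v) has_derivative (\<lambda>h. (H x *v h) \<bullet> v)) (at x)"
      using J that by (auto simp: C2_jet_def intro!: derivative_eq_intros)
  qed (simp add: fd)
  have "continuous_on U (\<lambda>x. frechet_derivative (\<lambda>x. frechet_derivative \<phi> (at x) v) (at x) w)" for v w
  proof -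
    have "continuous_on U (\<lambda>x. (H x *v w) \<bullet> v)"
      using J by (auto simp: C2_jet_def matrix_vector_mult_def
          intro!: continuous_intros continuous_on_vec_lambda)
    then show ?thesis
      by (rule continuous_on_eq) (metis d frechet_derivative_at)
  qed
  moreover have "\<phi> differentiable (at x)" if "x \<in> U" for x
    using J that by (auto simp: C2_jet_def intro: differentiableI)
  ultimately show ?thesis
    using d by (auto simp: numeral_2_eq_2) (blast intro: differentiableI)
qed

text \<open>The third argument of \<open>F\<close> runs over all unit vectors, independently of the
  gradient \<open>g x\<close>. Contact is a maximum of the difference over \<open>U\<close>, so
  adding a constant to a test function changes nothing.\<close>

definition viscosity_bound ::
    "(real^'n) set \<Rightarrow> (real^'n \<Rightarrow> real^'n \<Rightarrow> real^'n \<Rightarrow> real) \<Rightarrow> (real^'n \<Rightarrow> real) \<Rightarrow> bool" where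
  "viscosity_bound \<Omega> F \<psi> \<longleftrightarrow>
     (\<forall>U \<phi> g H. U \<subseteq> \<Omega> \<longrightarrow> C2_jet \<phi> g H U \<longrightarrow>
        (\<forall>x\<in>U. \<forall>\<nu>. (\<forall>z\<in>U. \<psi> z - \<phi> z \<le> \<psi> x - \<phi> x) \<longrightarrow> norm \<nu> = 1 \<longrightarrow>
           F x (g x) \<nu> \<le> tangential_trace \<nu> (H x)))"

lemma viscosity_boundD:
  assumes "viscosity_bound \<Omega> F \<psi>" "U \<subseteq> \<Omega>" "C2_jet \<phi> g H U" "x \<in> U"
    "\<And>z. z \<in> U \<Longrightarrow> \<psi> z - \<phi> z \<le> \<psi> x - \<phi> x" "norm \<nu> = 1"
  shows "F x (g x) \<nu> \<le> tangential_trace \<nu> (H x)"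
  using assms unfolding viscosity_bound_def by blast

text \<open>For u = exp ((n-2)/2 \<phi>) the conformal metric is exp (2 \<phi>) times the Euclidean
  one. All powers of u then combine to the single factor exp (-2 \<phi>), whose sign is all that
  matters for the cone.\<close>

lemma conf_mat_exp:
  fixes \<phi> :: "real^'n \<Rightarrow> real"
  assumes n: "CARD('n) \<ge> 3" and J: "C2_jet \<phi> g H U" and x: "x \<in> U"
  shows "conf_mat (\<lambda>z. exp ((real CARD('n) - 2) / 2 * \<phi> z)) x =
      (- exp (- 2 * \<phi> x)) *\<^sub>R (H x - outer (g x) (g x) + ((norm (g x))^2 / 2) *\<^sub>R mat 1)"
proof -
  define n where "n = real CARD('n)"
  define a where "a = (n - 2) / 2"
  have n3: "n \<ge> 3" using n by (simp add: n_def)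
  then have a0: "a > 0" and n2: "n - 2 = 2 * a" by (auto simp: a_def diff_divide_distrib)
  then have nn: "n = 2 + 2 * a" by linarith
  define u where "u = (\<lambda>z. exp (a * \<phi> z))"
  have J': "C2_jet u (\<lambda>z. (a * exp (a * \<phi> z)) *\<^sub>R g z)
     (\<lambda>z. (a * exp (a * \<phi> z)) *\<^sub>R H z + (a^2 * exp (a * \<phi> z)) *\<^sub>R outer (g z) (g z)) U"
    unfolding u_def
    by (rule C2_jet_compose[OF J]) (auto intro!: derivative_eq_intros continuous_intros simp: power2_eq_square)
  have gr: "gradient u x = (a * u x) *\<^sub>R g x"
    using J' x unfolding u_def by (intro gradient_eqI) (auto simp: C2_jet_def)
  have he: "hessian u x = (a * u x) *\<^sub>R H x + (a^2 * u x) *\<^sub>R outer (g x) (g x)"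
    using C2_jet_hessian[OF J' x] by (simp add: u_def)
  have pw: "u x powr p = exp (p * a * \<phi> x)" for p
    by (simp add: u_def powr_def mult_ac)
  have upos: "u x > 0" by (simp add: u_def)
  have out: "outer (gradient u x) (gradient u x) = (a * u x)^2 *\<^sub>R outer (g x) (g x)"
    by (simp add: gr outer_def vec_eq_iff power2_eq_square)
  have nrm: "(norm (gradient u x))^2 = (a * u x)^2 * (norm (g x))^2"
    using a0 upos by (simp add: gr power_mult_distrib)
  define E where "E = exp (- 2 * \<phi> x)"
  have uE: "u x = exp (a * \<phi> x)" by (simp add: u_def)
  \<comment> \<open>Since n = 2 + 2 a, both exponents become -2 \<phi> once the factors of u from
    the Hessian, respectively from the squared gradient, are absorbed.\<close>
  have p1: "u x powr (- ((n + 2) / (n - 2))) * u x = E"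
    unfolding pw unfolding E_def uE exp_add[symmetric] n2
    using a0 n2 by (intro arg_cong[where f = exp]) (simp add: field_simps)
  have p2: "u x powr (- (2 * n / (n - 2))) * (u x)^2 = E"
    unfolding pw unfolding E_def uE power2_eq_square exp_add[symmetric] n2
    using a0 n2 by (intro arg_cong[where f = exp]) (simp add: field_simps)
  have c1: "- (2 / (n - 2)) * u x powr (- ((n + 2) / (n - 2))) * (a * u x) = - E"
    using p1 a0 by (simp add: n2)
  have c2: "- (2 / (n - 2)) * u x powr (- ((n + 2) / (n - 2))) * (a^2 * u x) = - E * a"
    using p1 a0 by (simp add: n2 power2_eq_square)
  have c3: "2 * n / (n - 2)^2 * u x powr (- (2 * n / (n - 2))) * (a * u x)^2 = E * (a + 1)"
  proof -
    have "2 * n / (n - 2)^2 * u x powr (- (2 * n / (n - 2))) * (a * u x)^2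
       = (2 * n / (n - 2)^2 * a^2) * (u x powr (- (2 * n / (n - 2))) * (u x)^2)"
      by (simp add: power_mult_distrib)
    also have "2 * n / (n - 2)^2 * a^2 = a + 1" using a0 nn by (simp add: nn field_simps power2_eq_square)
    finally show ?thesis using p2 by simp
  qed
  have c4: "2 / (n - 2)^2 * u x powr (- (2 * n / (n - 2))) * (norm (gradient u x))^2 = E * ((norm (g x))^2 / 2)"
  proof -
    have "2 / (n - 2)^2 * u x powr (- (2 * n / (n - 2))) * (norm (gradient u x))^2
       = (2 / (n - 2)^2 * a^2) * (u x powr (- (2 * n / (n - 2))) * (u x)^2) * (norm (g x))^2"
      by (simp add: nrm power_mult_distrib)
    also have "2 / (n - 2)^2 * a^2 = 1 / 2" using a0 nn by (simp add: nn field_simps power2_eq_square)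
    finally show ?thesis using p2 by simp
  qed
  \<comment> \<open>The outer product receives -E a from the Hessian of the exponential and E (a +
    1) from the gradient term, together E.\<close>
  have "conf_mat u x = (- E) *\<^sub>R H x + (- E * a) *\<^sub>R outer (g x) (g x)
     + (E * (a + 1)) *\<^sub>R outer (g x) (g x) - (E * ((norm (g x))^2 / 2)) *\<^sub>R mat 1"
    unfolding conf_mat_def n_def[symmetric] Let_def c4 out he scaleR_add_right scaleR_scaleR c1 c2 c3 ..
  also have "\<dots> = (- E) *\<^sub>R (H x - outer (g x) (g x) + ((norm (g x))^2 / 2) *\<^sub>R mat 1)"
    by (simp add: algebra_simps)
  finally show ?thesis by (simp add: u_def a_def n_def E_def)
qed

text \<open>For Hessian M and gradient p of a test function of 2/(n-2) ln u, the tangential trace of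
  M - p \<otimes> p + |p|^2/2 I is that of M plus (n-3)/2 |p|^2 + (p . \<nu>)^2. The added quadratic
  shifts the gradient by \<epsilon> x and raises the tangential trace by (n-1) \<epsilon>.\<close>

lemma viscosity_bound_of_subsol:
  fixes u :: "real^'n \<Rightarrow> real"
  assumes n: "CARD('n) \<ge> 3" and sub: "viscosity_subsol \<Omega> u" and pos: "\<And>x. x \<in> \<Omega> \<Longrightarrow> u x > 0"
  shows "viscosity_bound \<Omega>
     (\<lambda>x p \<nu>. (real CARD('n) - 1) * \<epsilon> - (real CARD('n) - 3) / 2 * (norm (p - \<epsilon> *\<^sub>R x))^2 - ((p - \<epsilon> *\<^sub>R x) \<bullet> \<nu>)^2)
     (\<lambda>x. 2 / (real CARD('n) - 2) * ln (u x) + \<epsilon> / 2 * (norm x)^2)"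
    (is "viscosity_bound \<Omega> ?F ?\<psi>")
  unfolding viscosity_bound_def
proof (intro allI impI ballI)
  fix U \<phi> g H x and \<nu> :: "real^'n"
  assume U: "U \<subseteq> \<Omega>" and J: "C2_jet \<phi> g H U" and x: "x \<in> U" and nu: "norm \<nu> = 1"
    and max: "\<forall>z\<in>U. ?\<psi> z - \<phi> z \<le> ?\<psi> x - \<phi> x"
  define a where "a = (real CARD('n) - 2) / 2"
  have a0: "a > 0" and an: "2 / (real CARD('n) - 2) = 1 / a" using n by (auto simp: a_def)
  have op: "open U" using J by (simp add: C2_jet_def)
  \<comment> \<open>The quadratic is removed again, and the constant makes the value at
    \<open>x\<close> equal to that of 2/(n-2) ln u, so that exp (a \<phi>') touches u from above at
    \<open>x\<close>.\<close>
  define \<phi>' where "\<phi>' = (\<lambda>z. \<phi> z + ((- \<epsilon> / 2) * (norm (z - 0))^2 + (?\<psi> x - \<phi> x)))"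
  have J': "C2_jet \<phi>' (\<lambda>z. g z + ((- \<epsilon> / 2) *\<^sub>R 2 *\<^sub>R (z - 0) + 0)) (\<lambda>z. H z + ((- \<epsilon> / 2) *\<^sub>R 2 *\<^sub>R mat 1 + 0)) U"
    unfolding \<phi>'_def by (intro C2_jet_add J C2_jet_const C2_jet_cmult C2_jet_sqdist op)
  define \<Phi> where "\<Phi> = (\<lambda>z. exp (a * \<phi>' z))"
  have "C2_jet \<Phi> (\<lambda>z. (a * exp (a * \<phi>' z)) *\<^sub>R (g z + ((- \<epsilon> / 2) *\<^sub>R 2 *\<^sub>R (z - 0) + 0)))
     (\<lambda>z. (a * exp (a * \<phi>' z)) *\<^sub>R (H z + ((- \<epsilon> / 2) *\<^sub>R 2 *\<^sub>R mat 1 + 0))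
        + (a^2 * exp (a * \<phi>' z)) *\<^sub>R outer (g z + ((- \<epsilon> / 2) *\<^sub>R 2 *\<^sub>R (z - 0) + 0)) (g z + ((- \<epsilon> / 2) *\<^sub>R 2 *\<^sub>R (z - 0) + 0))) U"
    unfolding \<Phi>_def
    by (rule C2_jet_compose[OF J']) (auto intro!: derivative_eq_intros continuous_intros simp: power2_eq_square)
  then have ck: "Ck_on 2 \<Phi> U" by (rule C2_jet_Ck_on)
  have ueq: "u z = exp (a * (1 / a * ln (u z)))" if "z \<in> \<Omega>" for z
    using pos[OF that] a0 by simp
  have "\<phi>' x = 1 / a * ln (u x)" by (simp add: \<phi>'_def an)
  then have eq: "\<Phi> x = u x" using ueq[of x] pos[of x] x U by (auto simp: \<Phi>_def)
  have le: "u z \<le> \<Phi> z" if "z \<in> U" for z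
  proof -
    have "1 / a * ln (u z) \<le> \<phi>' z" using max[rule_format, OF that] by (simp add: \<phi>'_def an)
    then have "ln (u z) \<le> a * \<phi>' z" using a0 by (simp add: field_simps)
    then show ?thesis using pos[of z] that U unfolding \<Phi>_def by (metis exp_le_cancel_iff exp_ln subsetD)
  qed
  have lam: "lambda_in_closure_Gamma2 (- conf_mat \<Phi> x)"
    using sub[unfolded viscosity_subsol_def, rule_format, OF _ op x U ck] eq le x U
    by (auto simp: \<Phi>_def)
  define p where "p = g x - \<epsilon> *\<^sub>R x"
  define M where "M = H x - \<epsilon> *\<^sub>R mat 1"
  have cm: "- conf_mat \<Phi> x = exp (- 2 * \<phi>' x) *\<^sub>R (M - outer p p + ((norm p)^2 / 2) *\<^sub>R mat 1)"
    using conf_mat_exp[OF n J' x] by (simp add: \<Phi>_def a_def p_def M_def)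
  have sym: "transpose (- conf_mat \<Phi> x) = - conf_mat \<Phi> x"
  proof -
    have "transpose (M - outer p p + ((norm p)^2 / 2) *\<^sub>R mat 1) = M - outer p p + ((norm p)^2 / 2) *\<^sub>R mat 1"
      using J x by (simp add: M_def C2_jet_def transpose_def outer_def mat_def vec_eq_iff mult.commute)
    then show ?thesis unfolding cm by (simp add: transpose_scaleR)
  qed
  have nn: "\<nu> \<bullet> \<nu> = 1" using nu by (simp add: norm_eq_1)
  have "0 \<le> tangential_trace \<nu> (M - outer p p + ((norm p)^2 / 2) *\<^sub>R mat 1)"
    using tangential_trace_nonneg[OF lam sym nu] unfolding cm tangential_trace_scaleR
    by (simp add: zero_le_mult_iff)
  also have "\<dots> = tangential_trace \<nu> (H x) - ?F x (g x) \<nu>"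
    unfolding p_def[symmetric] M_def
    by (simp add: tangential_trace_simps nn power2_norm_eq_inner power2_eq_square inner_commute algebra_simps)
      (simp add: field_simps dot_square_norm power2_eq_square)
  finally show "?F x (g x) \<nu> \<le> tangential_trace \<nu> (H x)" by simp
qed

section \<open>Touching a sublevel set\<close>

text \<open>The component \<open>w\<close> of \<open>p\<close> orthogonal to \<open>e\<close> is
  exposed by testing with t e - w, which lies in the half space for every t > 0; small t leaves
  |w|^2 \<le> 0.\<close>

lemma half_space_inner_nonneg:
  fixes e p :: "'a::real_inner"
  assumes e: "norm e = 1" and H: "\<And>v. e \<bullet> v > 0 \<Longrightarrow> p \<bullet> v \<ge> 0"
  shows "p = (p \<bullet> e) *\<^sub>R e" "p \<bullet> e \<ge> 0"
proof -
  have ee: "e \<bullet> e = 1" using e by (simp add: norm_eq_1)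
  show pe: "p \<bullet> e \<ge> 0" using H[of e] ee by simp
  define w where "w = p - (p \<bullet> e) *\<^sub>R e"
  have we: "e \<bullet> w = 0" by (simp add: w_def inner_diff_right ee inner_commute)
  have pw: "p \<bullet> w = w \<bullet> w"
    using we by (simp add: w_def inner_diff_left inner_diff_right inner_commute ee)
  have "w \<bullet> w \<le> 0"
  proof (rule field_le_epsilon)
    fix s :: real assume s: "s > 0"
    define t where "t = s / (p \<bullet> e + 1)"
    have "t > 0" using s pe by (simp add: t_def)
    then have "p \<bullet> (t *\<^sub>R e - w) \<ge> 0" by (intro H) (simp add: inner_diff_right ee we)
    then have "w \<bullet> w \<le> t * (p \<bullet> e)" by (simp add: inner_diff_right pw)
    also have "\<dots> \<le> s" using s pe by (simp add: t_def field_simps)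
    finally show "w \<bullet> w \<le> 0 + s" by simp
  qed
  then have "w = 0" by (metis inner_gt_zero_iff linorder_not_le)
  then show "p = (p \<bullet> e) *\<^sub>R e" by (simp add: w_def)
qed

lemma gradient_eq_at_max:
  fixes D :: "'a::euclidean_space \<Rightarrow> 'a"
  assumes "open U" "x \<in> U" "(\<psi> has_derivative (\<lambda>h. p \<bullet> h)) (at x)"
    "(\<phi> has_derivative (\<lambda>h. q \<bullet> h)) (at x)" "\<And>z. z \<in> U \<Longrightarrow> \<psi> z - \<phi> z \<le> \<psi> x - \<phi> x"
  shows "p = q"
proof -
  have "((\<lambda>z. \<psi> z - \<phi> z) has_derivative (\<lambda>h. p \<bullet> h - q \<bullet> h)) (at x)"
    using assms by (auto intro!: derivative_eq_intros)
  then have "(\<lambda>h. p \<bullet> h - q \<bullet> h) = (\<lambda>h. 0)"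
    using differential_zero_maxmin[OF assms(2,1)] assms(5) by blast
  then have "(p - q) \<bullet> (p - q) = 0" by (metis inner_diff_left)
  then show ?thesis by simp
qed

lemma directional_derivative_nonpos:
  assumes der: "(\<psi> has_derivative (\<lambda>h. p \<bullet> h)) (at (y::'a::real_inner))"
    and le: "eventually (\<lambda>s. \<psi> (y + s *\<^sub>R v) \<le> \<psi> y) (at_right 0)"
  shows "p \<bullet> v \<le> 0"
proof -
  have "((\<lambda>s. \<psi> (y + s *\<^sub>R v)) has_derivative (\<lambda>h. p \<bullet> (h *\<^sub>R v))) (at 0)"
    by (rule has_derivative_compose[of "\<lambda>s. y + s *\<^sub>R v" "\<lambda>h. h *\<^sub>R v" 0 UNIV \<psi>])
      (auto intro!: derivative_eq_intros simp: der)
  then have "((\<lambda>s. \<psi> (y + s *\<^sub>R v)) has_real_derivative p \<bullet> v) (at 0)"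
    by (simp add: has_field_derivative_def mult_commute_abs)
  then have "((\<lambda>s. (\<psi> (y + s *\<^sub>R v) - \<psi> y) / s) \<longlongrightarrow> p \<bullet> v) (at 0)"
    by (simp add: has_field_derivative_iff)
  then have "((\<lambda>s. (\<psi> (y + s *\<^sub>R v) - \<psi> y) / s) \<longlongrightarrow> p \<bullet> v) (at_right 0)"
    by (rule filterlim_at_split[THEN iffD1, THEN conjunct2])
  moreover have "eventually (\<lambda>s. (\<psi> (y + s *\<^sub>R v) - \<psi> y) / s \<le> 0) (at_right 0)"
    using le eventually_at_right_less[of 0]
    by eventually_elim (simp add: divide_nonpos_pos)
  ultimately show ?thesis using tendsto_upperbound trivial_limit_at_right_real by blast
qed

lemma C2_jet_quadratic:
  assumes "open U" "transpose Q = Q"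
  shows "C2_jet (\<lambda>z. k * (e \<bullet> (z - y)) + ((z - y) \<bullet> (Q *v (z - y))) / 2) (\<lambda>z. k *\<^sub>R e + Q *v (z - y)) (\<lambda>z. Q) U"
proof (rule C2_jetI)
  fix x
  have d: "((\<lambda>z. Q *v (z - y)) has_derivative (\<lambda>h. Q *v h)) (at x)"
    by (rule bounded_linear.has_derivative[OF matrix_vector_mul_bounded_linear])
      (auto intro!: derivative_eq_intros)
  show "((\<lambda>z. k *\<^sub>R e + Q *v (z - y)) has_derivative (\<lambda>h. Q *v h)) (at x)"
    using d by (auto intro!: derivative_eq_intros)
  show "((\<lambda>z. k * (e \<bullet> (z - y)) + ((z - y) \<bullet> (Q *v (z - y))) / 2) has_derivative (\<lambda>h. (k *\<^sub>R e + Q *v (x - y)) \<bullet> h)) (at x)"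
    by (auto intro!: derivative_eq_intros d)
      (simp add: inner_add_left symmetric_matrix_inner[OF assms(2), of "x - y"] inner_commute[of _ "Q *v (x - y)"])
qed (use assms in auto)

lemma abs_add_half_le: "\<bar>a\<bar> \<le> c \<Longrightarrow> \<bar>b\<bar> \<le> c \<Longrightarrow> 0 < c \<Longrightarrow> \<bar>a + b / 2\<bar> \<le> 2 * c" for a b c :: real
  by linarith

text \<open>At \<open>y\<close> the gradient of \<sigma> is k e. With b = \<beta> / k, the function
  \<psi> - b \<sigma> is maximal at \<open>y\<close> on {\<sigma> = 0} and has zero gradient there,
  which for C^2 functions would bound the tangential Hessian of \<psi> by b Q. In the viscosity
  setting, perturbations of b \<sigma> are made to touch \<psi> near \<open>y\<close> in the full
  space, and the resulting inequalities are passed to the limit.\<close>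

lemma touching_sublevel_set:
  fixes \<psi> :: "real^'n \<Rightarrow> real"
  assumes op: "open \<Omega>" and vb: "viscosity_bound \<Omega> F \<psi>"
    and der: "\<And>x. x \<in> \<Omega> \<Longrightarrow> (\<psi> has_derivative (\<lambda>h. D x \<bullet> h)) (at x)" and cD: "continuous_on \<Omega> D"
    and y: "y \<in> \<Omega>" and F: "isCont (\<lambda>t. F (fst t) (fst (snd t)) (snd (snd t))) (y, D y, e)"
    and e: "norm e = 1" and k: "k > 0" and Q: "transpose Q = Q"
    and \<sigma>: "\<sigma> = (\<lambda>z. k * (e \<bullet> (z - y)) + ((z - y) \<bullet> (Q *v (z - y))) / 2)"
    and r0: "r0 > 0" and neg: "\<And>z. z \<in> ball y r0 \<Longrightarrow> \<sigma> z < 0 \<Longrightarrow> \<psi> z \<le> \<psi> y"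
  obtains \<beta> where "\<beta> \<ge> 0" "D y = \<beta> *\<^sub>R e" "F y (D y) e \<le> \<beta> / k * tangential_trace e Q"
proof -
  have ee: "e \<bullet> e = 1" using e by (simp add: norm_eq_1)
  obtain r1 where r1: "r1 > 0" "ball y r1 \<subseteq> \<Omega>" using op y openE by blast
  define r2 where "r2 = min r0 r1"
  have r2: "r2 > 0" "ball y r2 \<subseteq> \<Omega>" "ball y r2 \<subseteq> ball y r0"
    using r0 r1 by (auto simp: r2_def)
  have Qs: "x \<bullet> (Q *v z) = (Q *v x) \<bullet> z" for x z by (rule symmetric_matrix_inner[OF Q])
  obtain L where L: "L > 0" "\<And>v. norm (Q *v v) \<le> L * norm v"
    using bounded_linear.pos_bounded[OF matrix_vector_mul_bounded_linear[of Q]] by (auto simp: mult.commute)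
  have L': "\<bar>e \<bullet> (Q *v v)\<bar> \<le> L * norm v" for v
    using Cauchy_Schwarz_ineq2[of e "Q *v v"] L(2)[of v] e by simp
  have line: "\<sigma> (z + t *\<^sub>R e) = \<sigma> z + t * (k + e \<bullet> (Q *v (z - y)) + t / 2 * (e \<bullet> (Q *v e)))" for z t
  proof -
    have *: "z + t *\<^sub>R e - y = (z - y) + t *\<^sub>R e" by simp
    have "(w + t *\<^sub>R e) \<bullet> (Q *v (w + t *\<^sub>R e)) = w \<bullet> (Q *v w) + 2 * t * (e \<bullet> (Q *v w)) + t^2 * (e \<bullet> (Q *v e))" for w
      using Qs[of w e] by (simp add: matrix_vector_right_distrib matrix_vector_mult_scaleR inner_add_left
          inner_add_right inner_commute power2_eq_square algebra_simps)
    note expand = this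
    define w where "w = z - y"
    have 1: "\<sigma> (z + t *\<^sub>R e) = k * (e \<bullet> (w + t *\<^sub>R e)) + ((w + t *\<^sub>R e) \<bullet> (Q *v (w + t *\<^sub>R e))) / 2"
      unfolding \<sigma> * w_def ..
    have 2: "\<sigma> z = k * (e \<bullet> w) + (w \<bullet> (Q *v w)) / 2" unfolding \<sigma> w_def ..
    show ?thesis unfolding 1 2 w_def[symmetric] expand inner_add_right[of e]
      by (simp add: ee power2_eq_square field_simps)
  qed
  define \<beta> where "\<beta> = D y \<bullet> e"
  \<comment> \<open>Since \<sigma> has gradient k e at \<open>y\<close>, short steps along -v enter
    {\<sigma> < 0}.\<close>
  have half: "D y \<bullet> v \<ge> 0" if v: "e \<bullet> v > 0" for v
  proof -
    have "D y \<bullet> (- v) \<le> 0"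
    proof (rule directional_derivative_nonpos[OF der[OF y]])
      have "((\<lambda>s. y + s *\<^sub>R (- v)) \<longlongrightarrow> y + 0 *\<^sub>R (- v)) (at_right 0)"
        by (intro tendsto_intros)
      then have "eventually (\<lambda>s. y + s *\<^sub>R (- v) \<in> ball y r2) (at_right 0)"
        using r2(1) by (intro topological_tendstoD) auto
      moreover have "((\<lambda>s. - k * (e \<bullet> v) + s / 2 * (v \<bullet> (Q *v v))) \<longlongrightarrow> - k * (e \<bullet> v) + 0 / 2 * (v \<bullet> (Q *v v))) (at_right 0)"
        by (intro tendsto_intros) auto
      then have "eventually (\<lambda>s. - k * (e \<bullet> v) + s / 2 * (v \<bullet> (Q *v v)) < 0) (at_right 0)"
        using k v by (intro order_tendstoD(2)) auto
      ultimately show "eventually (\<lambda>s. \<psi> (y + s *\<^sub>R (- v)) \<le> \<psi> y) (at_right 0)"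
        using eventually_at_right_less[of 0]
      proof eventually_elim
        case (elim s)
        have "\<sigma> (y + s *\<^sub>R (- v)) = s * (- k * (e \<bullet> v) + s / 2 * (v \<bullet> (Q *v v)))"
          by (simp add: \<sigma> algebra_simps matrix_vector_mult_scaleR matrix_vector_mult_def[of Q "- v"] )
        moreover have "s * (- k * (e \<bullet> v) + s / 2 * (v \<bullet> (Q *v v))) < 0"
          using elim by (intro mult_pos_neg) auto
        ultimately show ?case by (intro neg subsetD[OF r2(3)] elim) simp
      qed
    qed
    then show ?thesis by simp
  qed
  have Dy: "D y = \<beta> *\<^sub>R e" and b0: "\<beta> \<ge> 0"
    using half_space_inner_nonneg[OF e half] by (auto simp: \<beta>_def)
  define b where "b = \<beta> / k"
  \<comment> \<open>The third condition gives \<sigma> slope at least k/2 along \<open>e\<close> at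
    \<open>z\<close>, so \<open>z\<close> is a limit of points with \<sigma> < 0.\<close>
  have zero_le: "\<psi> z \<le> \<psi> y" if z: "z \<in> ball y r2" "\<sigma> z = 0" "L * norm (z - y) \<le> k / 2" for z
  proof -
    have "((\<lambda>s. z + s *\<^sub>R (- e)) \<longlongrightarrow> z + 0 *\<^sub>R (- e)) (at_right 0)" by (intro tendsto_intros)
    then have lim: "((\<lambda>s. z + s *\<^sub>R (- e)) \<longlongrightarrow> z) (at_right 0)" by simp
    have "isCont \<psi> z" using der[of z] z r2 has_derivative_continuous by blast
    then have "((\<lambda>s. \<psi> (z + s *\<^sub>R (- e))) \<longlongrightarrow> \<psi> z) (at_right 0)"
      using lim by (rule isCont_tendsto_compose)
    moreover have "eventually (\<lambda>s. \<psi> (z + s *\<^sub>R (- e)) \<le> \<psi> y) (at_right 0)"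
    proof -
      have "eventually (\<lambda>s. z + s *\<^sub>R (- e) \<in> ball y r2) (at_right 0)"
        using z by (intro topological_tendstoD[OF lim]) auto
      moreover have "((\<lambda>s. k + e \<bullet> (Q *v (z - y)) - s / 2 * (e \<bullet> (Q *v e))) \<longlongrightarrow>
          k + e \<bullet> (Q *v (z - y)) - 0 / 2 * (e \<bullet> (Q *v e))) (at_right 0)"
        by (intro tendsto_intros) auto
      then have "eventually (\<lambda>s. k + e \<bullet> (Q *v (z - y)) - s / 2 * (e \<bullet> (Q *v e)) > 0) (at_right 0)"
        by (rule order_tendstoD(1)) (use L'[of "z - y"] z k in auto)
      ultimately show ?thesis
        using eventually_at_right_less[of 0]
      proof eventually_elim
        case (elim s)
        have "\<sigma> (z + s *\<^sub>R (- e)) = - s * (k + e \<bullet> (Q *v (z - y)) - s / 2 * (e \<bullet> (Q *v e)))"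
          using line[of z "- s"] z by simp
        moreover have "- s * (k + e \<bullet> (Q *v (z - y)) - s / 2 * (e \<bullet> (Q *v e))) < 0"
          using elim by (intro mult_neg_pos) auto
        ultimately show ?case by (intro neg subsetD[OF r2(3)] elim) simp
      qed
    qed
    ultimately show ?thesis using tendsto_upperbound trivial_limit_at_right_real by blast
  qed
  txt \<open>The term \<open>N * (\<sigma> z)\<^sup>2\<close> of the test function forces contact near \<open>y\<close>; its large
    second derivative is invisible to the tangential trace because \<open>\<nu>\<close> is normal to the level
    sets of \<open>\<sigma>\<close>.\<close>
  have step: "\<exists>z \<mu> \<nu>. z \<in> \<Omega> \<and> dist z y < \<tau> \<and> \<bar>\<mu> - b\<bar> < \<tau> \<and> k *\<^sub>R e + Q *v (z - y) \<noteq> 0 \<and>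
      \<nu> = (k *\<^sub>R e + Q *v (z - y)) /\<^sub>R norm (k *\<^sub>R e + Q *v (z - y)) \<and>
      F z (D z) \<nu> \<le> \<mu> * tangential_trace \<nu> Q + 2 * \<tau> * (real CARD('n) - 1)" if \<tau>: "\<tau> > 0" for \<tau>
  proof -
    define S where "S = (\<lambda>z. k *\<^sub>R e + Q *v (z - y))"
    define \<theta> where "\<theta> = (\<lambda>z. \<psi> z - b * \<sigma> z)"
    have jet\<sigma>: "C2_jet \<sigma> S (\<lambda>_. Q) V" if "open V" for V
      unfolding \<sigma> S_def using that by (rule C2_jet_quadratic[OF _ Q])
    have der\<sigma>: "(\<sigma> has_derivative (\<lambda>h. S x \<bullet> h)) (at x)" for x
      using jet\<sigma>[OF open_UNIV] by (auto simp: C2_jet_def)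
    have cS: "continuous_on UNIV S" using C2_jet_continuous_gradient[OF jet\<sigma>[OF open_UNIV]] .
    \<comment> \<open>Small enough to give |\<mu> - b| \<le> \<tau>/2 at the contact point, where
      the gradient of \<sigma> has norm at least k/2.\<close>
    define \<omega> where "\<omega> = k * \<tau> / 8"
    have \<omega>: "\<omega> > 0" using k \<tau> by (simp add: \<omega>_def)
    have "continuous_on \<Omega> (\<lambda>z. D z - b *\<^sub>R S z)"
      using cD cS by (intro continuous_intros) (auto intro: continuous_on_subset)
    then have "isCont (\<lambda>z. D z - b *\<^sub>R S z) y" using op y by (simp add: continuous_on_eq_continuous_at)
    then obtain r3 where r3: "r3 > 0" "\<And>z. dist z y < r3 \<Longrightarrow> dist (D z - b *\<^sub>R S z) (D y - b *\<^sub>R S y) < \<omega>"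
      using \<omega> unfolding continuous_at_eps_delta by blast
    have "D y - b *\<^sub>R S y = 0" using Dy k by (simp add: S_def b_def)
    then have small: "norm (D z - b *\<^sub>R S z) < \<omega>" if "dist z y < r3" for z using r3(2)[OF that] by simp
    \<comment> \<open>The bound k / (20 L) keeps the slope of \<sigma> along \<open>e\<close> above
      k/2 over moves of length up to 4 r, the tenths keep these moves inside the balls, and k/16
      enters the estimate of \<mu>.\<close>
    define r where "r = min (min (r2 / 10) (r3 / 10)) (min (min \<tau> (k / 16)) (k / (20 * L)))"
    have "r \<le> k / (20 * L)" "r \<le> r2 / 10" "r \<le> r3 / 10" "r \<le> \<tau>" "r \<le> k / 16"
      unfolding r_def by linarith+
    then have r: "10 * r \<le> r2" "10 * r \<le> r3" "r \<le> \<tau>" "r \<le> k / 16" "20 * L * r \<le> k"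
      using L by (auto simp: pos_le_divide_eq mult.commute mult.left_commute)
    have r_pos: "r > 0" using r2 r3 \<tau> k L by (simp add: r_def)
    note r = r_pos r
    have S_low: "norm (S z) \<ge> k / 2" if "dist z y \<le> r" for z
    proof -
      have "L * norm (z - y) \<le> L * r" using that L by (simp add: dist_norm)
      moreover have "L * r \<le> k / 2" using r k by linarith
      moreover have "norm (Q *v (z - y)) \<le> L * norm (z - y)" by (rule L)
      moreover have "norm (k *\<^sub>R e) = k" using e k by simp
      moreover have "norm (k *\<^sub>R e) \<le> norm (S z) + norm (Q *v (z - y))"
        by (metis S_def add_diff_cancel_right' norm_triangle_ineq4)
      ultimately show ?thesis by linarith
    qed
    \<comment> \<open>A move from \<open>z\<close> along \<open>e\<close> of length at most T = 2
      |\<sigma> z| / k reaches {\<sigma> = 0}, where \<theta> = \<psi> \<le> \<psi> y; on the way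
      the gradient of \<theta> is at most \<omega>.\<close>
    have \<theta>_le: "\<theta> z \<le> \<psi> y + 2 * \<omega> / k * \<bar>\<sigma> z\<bar>" if z: "dist z y \<le> r" for z
    proof -
      define T where "T = 2 * \<bar>\<sigma> z\<bar> / k"
      have nz: "norm (z - y) \<le> r" using z by (simp add: dist_norm)
      have Lz: "L * norm (z - y) \<le> k / 20"
        using mult_left_mono[OF nz less_imp_le[OF L(1)]] r(6) by linarith
      have "\<bar>\<sigma> z\<bar> \<le> 2 * k * r"
      proof -
        have "\<bar>e \<bullet> (z - y)\<bar> \<le> r" using Cauchy_Schwarz_ineq2[of e "z - y"] e nz by simp
        then have "\<bar>k * (e \<bullet> (z - y))\<bar> \<le> k * r" using k by (simp add: abs_mult)
        moreover have "\<bar>(z - y) \<bullet> (Q *v (z - y))\<bar> \<le> k * r"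
        proof -
          have "\<bar>(z - y) \<bullet> (Q *v (z - y))\<bar> \<le> norm (z - y) * norm (Q *v (z - y))" by (rule Cauchy_Schwarz_ineq2)
          also have "\<dots> \<le> r * k" using nz L(2)[of "z - y"] Lz k r by (intro mult_mono) auto
          finally show ?thesis unfolding mult.commute[of r k] .
        qed
        moreover have "k * r > 0" using k r by simp
        ultimately have "\<bar>k * (e \<bullet> (z - y)) + ((z - y) \<bullet> (Q *v (z - y))) / 2\<bar> \<le> 2 * (k * r)"
          by (rule abs_add_half_le)
        then show ?thesis unfolding \<sigma> by (simp only: mult.assoc)
      qed
      then have T: "0 \<le> T" "T \<le> 4 * r" using k by (auto simp: T_def field_simps)
      have br: "k + e \<bullet> (Q *v (z - y)) + t / 2 * (e \<bullet> (Q *v e)) \<ge> k / 2" if t: "\<bar>t\<bar> \<le> T" for t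
      proof -
        have "\<bar>t / 2 * (e \<bullet> (Q *v e))\<bar> \<le> (4 * r) / 2 * L"
          using L'[of e] e t T unfolding abs_mult by (intro mult_mono) auto
        also have "(4 * r) / 2 * L = 2 * (L * r)" by simp
        finally have "\<bar>t / 2 * (e \<bullet> (Q *v e))\<bar> \<le> 2 * (L * r)" .
        moreover have "20 * (L * r) \<le> k" using r(6) by (simp only: mult.assoc)
        ultimately show ?thesis using L'[of "z - y"] Lz k by linarith
      qed
      have "\<exists>t. \<bar>t\<bar> \<le> T \<and> \<sigma> (z + t *\<^sub>R e) = 0"
      proof -
        have c: "continuous_on X (\<lambda>t. \<sigma> (z + t *\<^sub>R e))" for X
          unfolding line by (intro continuous_intros) auto
        consider "\<sigma> z \<le> 0" | "\<sigma> z \<ge> 0" by linarith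
        then show ?thesis
        proof cases
          case 1
          have "T * (k / 2) \<le> T * (k + e \<bullet> (Q *v (z - y)) + T / 2 * (e \<bullet> (Q *v e)))"
            using T by (intro mult_left_mono br) auto
          then have "\<sigma> (z + T *\<^sub>R e) \<ge> 0" unfolding line using 1 k by (simp add: T_def)
          then obtain t where "0 \<le> t" "t \<le> T" "\<sigma> (z + t *\<^sub>R e) = 0"
            using IVT'[of "\<lambda>t. \<sigma> (z + t *\<^sub>R e)" 0 0 T] 1 T c by auto
          then show ?thesis by (intro exI[of _ t]) auto
        next
          case 2
          have "T * (k / 2) \<le> T * (k + e \<bullet> (Q *v (z - y)) + (- T) / 2 * (e \<bullet> (Q *v e)))"
            using T by (intro mult_left_mono br) auto
          then have "\<sigma> (z + (- T) *\<^sub>R e) \<le> 0" unfolding line using 2 k by (simp add: T_def)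
          then obtain t where "- T \<le> t" "t \<le> 0" "\<sigma> (z + t *\<^sub>R e) = 0"
            using IVT'[of "\<lambda>t. \<sigma> (z + t *\<^sub>R e)" "- T" 0 0] 2 T c by auto
          then show ?thesis by (intro exI[of _ t]) auto
        qed
      qed
      then obtain t where t: "\<bar>t\<bar> \<le> T" "\<sigma> (z + t *\<^sub>R e) = 0" by blast
      define z' where "z' = z + t *\<^sub>R e"
      have zz: "norm (z' - z) = \<bar>t\<bar>" using e by (simp add: z'_def)
      have "norm (z' - y) \<le> norm (z' - z) + norm (z - y)" by (metis norm_triangle_ineq diff_add_cancel add_diff_eq)
      then have z'y: "norm (z' - y) \<le> 5 * r" using zz t T nz by linarith
      have "\<psi> z' \<le> \<psi> y"
      proof (rule zero_le)
        show "z' \<in> ball y r2" using z'y r by (simp add: dist_norm norm_minus_commute)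
        show "\<sigma> z' = 0" using t by (simp add: z'_def)
        show "L * norm (z' - y) \<le> k / 2" using mult_left_mono[OF z'y less_imp_le[OF L(1)]] r(1,6) k by linarith
      qed
      then have "\<theta> z' \<le> \<psi> y" using t by (simp add: \<theta>_def z'_def)
      moreover have "norm (\<theta> z - \<theta> z') \<le> \<omega> * norm (z - z')"
      proof (rule differentiable_bound[of "ball y (6 * r)" \<theta> "\<lambda>x h. (D x - b *\<^sub>R S x) \<bullet> h"])
        fix x assume x: "x \<in> ball y (6 * r)"
        then have xO: "x \<in> \<Omega>" using r r2 by (auto intro: subsetD[of "ball y r2"])
        show "(\<theta> has_derivative (\<lambda>h. (D x - b *\<^sub>R S x) \<bullet> h)) (at x within ball y (6 * r))"
          unfolding \<theta>_def inner_diff_left inner_scaleR_left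
          by (rule has_derivative_at_withinI[OF has_derivative_diff[OF der[OF xO] has_derivative_mult_right[OF der\<sigma>]]])
        have "norm (D x - b *\<^sub>R S x) < \<omega>" using x r by (intro small) (auto simp: dist_commute)
        then have "norm ((D x - b *\<^sub>R S x) \<bullet> h) \<le> \<omega> * norm h" for h
          using Cauchy_Schwarz_ineq2[of "D x - b *\<^sub>R S x" h]
            mult_right_mono[of "norm (D x - b *\<^sub>R S x)" \<omega> "norm h"] by simp
        then show "onorm (\<lambda>h. (D x - b *\<^sub>R S x) \<bullet> h) \<le> \<omega>"
          using \<omega> by (intro onorm_bound) auto
      qed (use z'y nz r in \<open>auto simp: dist_norm norm_minus_commute\<close>)
      moreover have "\<omega> * norm (z - z') \<le> \<omega> * T" using zz t \<omega> by (simp add: norm_minus_commute)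
      moreover have "\<omega> * T = 2 * \<omega> / k * \<bar>\<sigma> z\<bar>" by (simp add: T_def)
      ultimately show ?thesis by simp
    qed
    \<comment> \<open>Completing the square gives 2 \<omega>/k |\<sigma>| \<le> N \<sigma>^2 +
      \<omega>^2/(k^2 N). This N makes the last term smaller than \<tau> r^2, the penalty on the
      sphere, so the maximum is interior.\<close>
    define N where "N = \<omega>^2 / (k^2 * \<tau> * r^2) + 1"
    have N: "N > 0" using \<tau> r k by (simp add: N_def add_nonneg_pos)
    have "\<omega>^2 < N * (k^2 * \<tau> * r^2)" using \<tau> r k by (simp add: N_def field_simps)
    then have N': "\<omega>^2 / (k^2 * N) < \<tau> * r^2" using N k by (simp add: field_simps)
    define \<phi> where "\<phi> = (\<lambda>z. (b * \<sigma> z + N * (\<sigma> z)^2) + \<tau> * (norm (z - y))^2)"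
    have "continuous_on (cball y r) (\<lambda>z. \<psi> z - \<phi> z)"
    proof -
      have "continuous_on (cball y r) \<psi>"
      proof (rule continuous_on_subset)
        show "continuous_on \<Omega> \<psi>"
          by (intro continuous_at_imp_continuous_on ballI has_derivative_continuous[OF der])
        show "cball y r \<subseteq> \<Omega>" using r r2 by (auto intro!: subsetD[OF r2(2)])
      qed
      moreover have "continuous_on (cball y r) \<sigma>"
        by (intro continuous_at_imp_continuous_on ballI has_derivative_continuous[OF der\<sigma>])
      ultimately show ?thesis unfolding \<phi>_def by (intro continuous_intros)
    qed
    then obtain z where z: "z \<in> cball y r" and zmax: "\<And>x. x \<in> cball y r \<Longrightarrow> \<psi> x - \<phi> x \<le> \<psi> z - \<phi> z"
      using continuous_attains_sup[OF compact_cball, of y r] r by fastforce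
    have zr: "z \<in> ball y r"
    proof (rule ccontr)
      assume "z \<notin> ball y r"
      then have d: "norm (z - y) = r" using z by (simp add: dist_norm norm_minus_commute)
      have "\<psi> y - \<phi> y \<le> \<psi> z - \<phi> z" using r by (intro zmax) auto
      then have "\<psi> y \<le> \<theta> z - N * (\<sigma> z)^2 - \<tau> * r^2" by (simp add: \<phi>_def \<theta>_def d \<sigma>)
      moreover have "\<theta> z \<le> \<psi> y + 2 * \<omega> / k * \<bar>\<sigma> z\<bar>" using d by (intro \<theta>_le) (simp add: dist_norm)
      moreover have "2 * \<omega> / k * \<bar>\<sigma> z\<bar> \<le> N * (\<sigma> z)^2 + \<omega>^2 / (k^2 * N)"
      proof -
        have "0 \<le> N * (\<bar>\<sigma> z\<bar> - \<omega> / (k * N))^2" using N by simp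
        also have "\<dots> = N * (\<sigma> z)^2 + \<omega>^2 / (k^2 * N) - 2 * \<omega> / k * \<bar>\<sigma> z\<bar>"
          using N k by (simp add: power2_eq_square field_simps)
        finally show ?thesis by simp
      qed
      ultimately show False using N' by linarith
    qed
    have J: "C2_jet \<phi> (\<lambda>z. (b + 2 * N * \<sigma> z) *\<^sub>R S z + \<tau> *\<^sub>R 2 *\<^sub>R (z - y))
        (\<lambda>z. ((b + 2 * N * \<sigma> z) *\<^sub>R Q + (2 * N) *\<^sub>R outer (S z) (S z)) + \<tau> *\<^sub>R 2 *\<^sub>R mat 1) (ball y r)"
      unfolding \<phi>_def
      by (intro C2_jet_add C2_jet_cmult C2_jet_sqdist
          C2_jet_compose[OF jet\<sigma>, where F = "\<lambda>t. b * t + N * t^2" and F' = "\<lambda>t. b + 2 * N * t" and F'' = "\<lambda>t. 2 * N"])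
        (auto intro!: derivative_eq_intros continuous_intros)
    have zO: "z \<in> \<Omega>" "ball y r \<subseteq> \<Omega>" using zr r by (auto intro!: subsetD[OF r2(2)])
    define \<mu> where "\<mu> = b + 2 * N * \<sigma> z"
    have Dz: "D z = \<mu> *\<^sub>R S z + \<tau> *\<^sub>R 2 *\<^sub>R (z - y)"
      unfolding \<mu>_def
      by (rule gradient_eq_at_max[OF open_ball zr der[OF zO(1)], of \<phi>])
        (use J zr zmax in \<open>auto simp: C2_jet_def\<close>)
    define \<nu> where "\<nu> = S z /\<^sub>R norm (S z)"
    have Sz: "norm (S z) \<ge> k / 2" using zr by (intro S_low) (simp add: dist_commute)
    then have Sz0: "norm (S z) > 0" using k by linarith
    then have nu: "norm \<nu> = 1" by (simp add: \<nu>_def)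
    have "F z (D z) \<nu> \<le> tangential_trace \<nu> (((b + 2 * N * \<sigma> z) *\<^sub>R Q + (2 * N) *\<^sub>R outer (S z) (S z)) + \<tau> *\<^sub>R 2 *\<^sub>R mat 1)"
      using viscosity_boundD[OF vb zO(2) J zr _ nu] zmax Dz unfolding \<mu>_def by auto
    also have "\<dots> = \<mu> * tangential_trace \<nu> Q + 2 * \<tau> * (real CARD('n) - 1)"
    proof -
      have "S z \<bullet> S z - (\<nu> \<bullet> S z) * (S z \<bullet> \<nu>) = 0"
        using Sz0 by (simp add: \<nu>_def field_simps power2_norm_eq_inner[symmetric] power2_eq_square inner_commute)
      moreover have "\<nu> \<bullet> \<nu> = 1" using nu by (simp add: norm_eq_1)
      ultimately show ?thesis by (simp add: tangential_trace_simps \<mu>_def)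
    qed
    finally have main: "F z (D z) \<nu> \<le> \<mu> * tangential_trace \<nu> Q + 2 * \<tau> * (real CARD('n) - 1)" .
    have "\<bar>\<mu> - b\<bar> < \<tau>"
    proof -
      have zy: "norm (z - y) \<le> r" "dist z y < r3" using zr r by (auto simp: dist_norm norm_minus_commute)
      have "(\<mu> - b) *\<^sub>R S z = (D z - b *\<^sub>R S z) - \<tau> *\<^sub>R 2 *\<^sub>R (z - y)" by (simp add: Dz algebra_simps)
      then have "\<bar>\<mu> - b\<bar> * norm (S z) \<le> norm (D z - b *\<^sub>R S z) + norm (\<tau> *\<^sub>R 2 *\<^sub>R (z - y))"
        by (metis norm_scaleR norm_triangle_ineq4)
      also have "\<dots> \<le> \<omega> + (2 * \<tau>) * r"
      proof (intro add_mono)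
        have "norm (\<tau> *\<^sub>R 2 *\<^sub>R (z - y)) = (2 * \<tau>) * norm (z - y)" using \<tau> by simp
        also have "\<dots> \<le> (2 * \<tau>) * r" using zy(1) \<tau> by (intro mult_left_mono) auto
        finally show "norm (\<tau> *\<^sub>R 2 *\<^sub>R (z - y)) \<le> (2 * \<tau>) * r" .
      qed (use small[OF zy(2)] in simp)
      also have "\<dots> \<le> k * \<tau> / 4"
      proof -
        have "(2 * \<tau>) * r \<le> (2 * \<tau>) * (k / 16)" using r(5) \<tau> by (intro mult_left_mono) auto
        also have "\<dots> = k * \<tau> / 8" by simp
        finally show ?thesis by (simp add: \<omega>_def mult.commute[of \<tau> k])
      qed
      finally have up: "\<bar>\<mu> - b\<bar> * norm (S z) \<le> k * \<tau> / 4" .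
      have "\<bar>\<mu> - b\<bar> * (k / 2) \<le> \<bar>\<mu> - b\<bar> * norm (S z)" using Sz by (intro mult_left_mono) auto
      also note up
      also have "k * \<tau> / 4 = (\<tau> / 2) * (k / 2)" by simp
      finally have "\<bar>\<mu> - b\<bar> * (k / 2) \<le> (\<tau> / 2) * (k / 2)" .
      then have "\<bar>\<mu> - b\<bar> \<le> \<tau> / 2" using k by (metis half_gt_zero mult_le_cancel_right_pos)
      then show ?thesis using \<tau> by linarith
    qed
    then show ?thesis
      using main zO(1) zr r Sz0 by (intro exI[of _ z] exI[of _ \<mu>] exI[of _ \<nu>]) (auto simp: S_def \<nu>_def dist_commute)
  qed
  \<comment> \<open>With \<tau> = 1/(j+1) the contact points, multipliers and normals tend to y, b
    and e, and continuity of \<open>F\<close> carries the inequality over.\<close>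
  have "\<forall>j::nat. \<exists>z \<mu> \<nu>. z \<in> \<Omega> \<and> dist z y < inverse (real (Suc j)) \<and> \<bar>\<mu> - b\<bar> < inverse (real (Suc j)) \<and> k *\<^sub>R e + Q *v (z - y) \<noteq> 0 \<and>
      \<nu> = (k *\<^sub>R e + Q *v (z - y)) /\<^sub>R norm (k *\<^sub>R e + Q *v (z - y)) \<and>
      F z (D z) \<nu> \<le> \<mu> * tangential_trace \<nu> Q + 2 * inverse (real (Suc j)) * (real CARD('n) - 1)"
    using step by simp
  then obtain Z M V where ZMV: "\<And>j::nat. Z j \<in> \<Omega>" "\<And>j. dist (Z j) y < inverse (real (Suc j))" "\<And>j. \<bar>M j - b\<bar> < inverse (real (Suc j))"
      "\<And>j. V j = (k *\<^sub>R e + Q *v (Z j - y)) /\<^sub>R norm (k *\<^sub>R e + Q *v (Z j - y))"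
      "\<And>j. F (Z j) (D (Z j)) (V j) \<le> M j * tangential_trace (V j) Q + 2 * inverse (real (Suc j)) * (real CARD('n) - 1)"
    unfolding choice_iff by blast
  have limZ: "Z \<longlonglongrightarrow> y"
    by (rule metric_tendsto_imp_tendsto[OF LIMSEQ_inverse_real_of_nat]) (use ZMV(2) in \<open>auto intro!: always_eventually less_imp_le\<close>)
  have limM: "M \<longlonglongrightarrow> b"
    by (rule metric_tendsto_imp_tendsto[OF LIMSEQ_inverse_real_of_nat]) (use ZMV(3) in \<open>auto intro!: always_eventually less_imp_le simp: dist_real_def\<close>)
  have limQ: "(\<lambda>j. Q *v (f j)) \<longlonglongrightarrow> Q *v l" if "f \<longlonglongrightarrow> l" for f l
    using bounded_linear.tendsto[OF matrix_vector_mul_bounded_linear that] .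
  have "V \<longlonglongrightarrow> (k *\<^sub>R e + Q *v (y - y)) /\<^sub>R norm (k *\<^sub>R e + Q *v (y - y))"
    unfolding ZMV(4)[abs_def] using k e by (intro tendsto_intros limQ limZ) auto
  then have limV: "V \<longlonglongrightarrow> e" using k e by simp
  have "isCont D y" using cD op y by (simp add: continuous_on_eq_continuous_at)
  then have "(\<lambda>j. (Z j, D (Z j), V j)) \<longlonglongrightarrow> (y, D y, e)"
    by (intro tendsto_intros limZ limV isCont_tendsto_compose[of _ D])
  from isCont_tendsto_compose[OF F this]
  have limF: "(\<lambda>j. F (Z j) (D (Z j)) (V j)) \<longlonglongrightarrow> F y (D y) e" by simp
  have limT: "(\<lambda>j. M j * tangential_trace (V j) Q + 2 * inverse (real (Suc j)) * (real CARD('n) - 1))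
     \<longlonglongrightarrow> b * tangential_trace e Q + 2 * 0 * (real CARD('n) - 1)"
    unfolding tangential_trace_def by (intro tendsto_intros limM limV limQ LIMSEQ_inverse_real_of_nat)
  have "F y (D y) e \<le> b * tangential_trace e Q"
    using LIMSEQ_le[OF limF limT] ZMV(5) by simp
  then show ?thesis using that[OF b0 Dy] by (simp add: b_def)
qed

section \<open>Trigonometric polynomials and their resolvent\<close>

locale hyperplane_basis =
  fixes e :: "real^'n" and B :: "(real^'n) set"
  assumes norm_e: "norm e = 1" and orthogonal_B: "pairwise orthogonal B"
    and norm_B: "\<And>b. b \<in> B \<Longrightarrow> norm b = 1" and span_B: "span B = {x. x \<bullet> e = 0}"
begin

lemma finite_B: "finite B"
proof -
  have "0 \<notin> B" using norm_B norm_zero by force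
  then show ?thesis using pairwise_orthogonal_independent[OF orthogonal_B] independent_imp_finite by blast
qed

lemma B_perp: "b \<in> B \<Longrightarrow> b \<bullet> e = 0"
  using span_base span_B by blast

lemma e_e: "e \<bullet> e = 1"
  using norm_e by (simp add: norm_eq_1)

lemma B_B: "b \<in> B \<Longrightarrow> c \<in> B \<Longrightarrow> b \<bullet> c = (if b = c then 1 else 0)"
  using orthogonal_B norm_B by (auto simp: pairwise_def orthogonal_def norm_eq_1)

lemma expand: "x = (\<Sum>b\<in>B. (x \<bullet> b) *\<^sub>R b) + (x \<bullet> e) *\<^sub>R e"
proof -
  define w where "w = x - (x \<bullet> e) *\<^sub>R e"
  have "w \<in> span B" by (simp add: span_B w_def inner_diff_left e_e)
  then have "(\<Sum>b\<in>B. (w \<bullet> b) *\<^sub>R b) = w"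
    by (intro orthonormal_basis_expand orthogonal_B norm_B finite_B)
  moreover have "(\<Sum>b\<in>B. (w \<bullet> b) *\<^sub>R b) = (\<Sum>b\<in>B. (x \<bullet> b) *\<^sub>R b)"
  proof (rule sum.cong[OF refl])
    fix b assume "b \<in> B"
    then have "e \<bullet> b = 0" using B_perp by (simp add: inner_commute)
    then show "(w \<bullet> b) *\<^sub>R b = (x \<bullet> b) *\<^sub>R b" by (simp add: w_def inner_diff_left)
  qed
  ultimately have "x - (x \<bullet> e) *\<^sub>R e = (\<Sum>b\<in>B. (x \<bullet> b) *\<^sub>R b)" by (metis w_def)
  then show ?thesis by (metis diff_add_cancel)
qed

lemma inner_expand: "x \<bullet> y = (\<Sum>b\<in>B. (x \<bullet> b) * (y \<bullet> b)) + (x \<bullet> e) * (y \<bullet> e)"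
proof -
  have "x \<bullet> y = ((\<Sum>b\<in>B. (x \<bullet> b) *\<^sub>R b) + (x \<bullet> e) *\<^sub>R e) \<bullet> y" using expand[of x] by simp
  also have "\<dots> = (\<Sum>b\<in>B. (x \<bullet> b) * (y \<bullet> b)) + (x \<bullet> e) * (y \<bullet> e)"
    by (simp add: inner_add_left inner_sum_left inner_commute[of y])
  finally show ?thesis .
qed

text \<open>Adding e . Q e turns both sides into the full trace, computed in the basis B with e and
  in the standard basis; the identity \<open>inner_expand\<close> mediates between them.\<close>

lemma sum_basis_eq_tangential_trace: "(\<Sum>b\<in>B. b \<bullet> (Q *v b)) = tangential_trace e Q"
proof -
  have eq: "b \<bullet> (Q *v b) = (\<Sum>i\<in>UNIV. (axis i 1 \<bullet> b) * ((transpose Q *v axis i 1) \<bullet> b))" for b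
  proof -
    have "(transpose Q *v axis i 1) \<bullet> b = (Q *v b) $ i" for i
      by (simp add: transpose_matrix_vector dot_lmul_matrix inner_axis')
    then show ?thesis by (simp add: inner_vec_def[of b] inner_axis')
  qed
  have "(\<Sum>b\<in>B. b \<bullet> (Q *v b)) + e \<bullet> (Q *v e)
      = (\<Sum>i\<in>UNIV. (\<Sum>b\<in>B. (axis i 1 \<bullet> b) * ((transpose Q *v axis i 1) \<bullet> b))
          + (axis i 1 \<bullet> e) * ((transpose Q *v axis i 1) \<bullet> e))"
    unfolding eq sum.distrib by (subst sum.swap) simp
  also have "\<dots> = (\<Sum>i\<in>UNIV. axis i 1 \<bullet> (transpose Q *v axis i 1))"
    by (simp add: inner_expand[symmetric])
  also have "\<dots> = trace Q"
    by (simp add: trace_def inner_axis' matrix_vector_mult_basis column_def transpose_def)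
  finally show ?thesis by (simp add: tangential_trace_def)
qed

end

lemma hyperplane_basis_exists:
  assumes "norm e = 1"
  obtains B where "hyperplane_basis e B"
proof -
  obtain B where "B \<subseteq> {x. x \<bullet> e = 0}" "pairwise orthogonal B" "\<And>x. x \<in> B \<Longrightarrow> norm x = 1"
    "span B = {x. x \<bullet> e = 0}"
    using orthonormal_basis_subspace[OF subspace_hyperplane2[of e]] by metis
  then show ?thesis using assms by (intro that[of B]) (simp add: hyperplane_basis_def)
qed

section \<open>Second derivative tests at a maximum\<close>

lemma C2_jet_max_hessian:
  assumes J: "C2_jet \<phi> g H U" and x: "x \<in> U" and max: "\<And>z. z \<in> U \<Longrightarrow> \<phi> z \<le> \<phi> x"
  shows "v \<bullet> (H x *v v) \<le> 0"
proof (rule ccontr)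
  assume neg: "\<not> v \<bullet> (H x *v v) \<le> 0"
  have op: "open U" using J by (simp add: C2_jet_def)
  have d: "(\<phi> has_derivative (\<lambda>h. g z \<bullet> h)) (at z)" and dg: "(g has_derivative (\<lambda>h. H z *v h)) (at z)"
    if "z \<in> U" for z using J that by (auto simp: C2_jet_def)
  have gx: "g x = 0"
    by (rule gradient_eq_at_max[OF op x d[OF x], of "\<lambda>_. 0"]) (use max in auto)
  obtain r where r: "r > 0" "ball x r \<subseteq> U" using op x openE by blast
  define r' where "r' = r / (norm v + 1)"
  have nv: "norm v + 1 > 0" by (simp add: add_nonneg_pos)
  then have r': "r' > 0" using r by (simp add: r'_def)
  have inU: "x + s *\<^sub>R v \<in> U" if "0 \<le> s" "s < r'" for s
  proof -
    have "s * norm v \<le> s * (norm v + 1)" using that by (intro mult_left_mono) auto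
    also have "\<dots> < r' * (norm v + 1)" using that nv by simp
    also have "\<dots> = r" using nv by (simp add: r'_def)
    finally have "x + s *\<^sub>R v \<in> ball x r" using that by (simp add: dist_norm)
    then show ?thesis using r(2) by blast
  qed
  have line: "((\<lambda>s. x + s *\<^sub>R v) has_derivative (\<lambda>h. h *\<^sub>R v)) (at s)" for s
    by (auto intro!: derivative_eq_intros)
  have "((\<lambda>s. g (x + s *\<^sub>R v)) has_derivative (\<lambda>h. H x *v (h *\<^sub>R v))) (at 0)"
    by (rule has_derivative_compose[OF line[of 0]]) (simp add: dg[OF x])
  then have "((\<lambda>s. g (x + s *\<^sub>R v) \<bullet> v) has_derivative (\<lambda>h. (H x *v (h *\<^sub>R v)) \<bullet> v)) (at 0)"
    by (rule has_derivative_inner_left)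
  then have "((\<lambda>s. g (x + s *\<^sub>R v) \<bullet> v) has_real_derivative (v \<bullet> (H x *v v))) (at 0)"
    by (simp add: has_field_derivative_def matrix_vector_mult_scaleR inner_commute mult_commute_abs)
  from DERIV_pos_inc_right[OF this] neg gx
  obtain d0 where d0: "d0 > 0" "\<And>h. 0 < h \<Longrightarrow> h < d0 \<Longrightarrow> g (x + h *\<^sub>R v) \<bullet> v > 0" by auto
  define s where "s = min d0 r' / 2"
  have s: "0 < s" "s < d0" "s < r'" using d0 r' by (auto simp: s_def)
  have "((\<lambda>s. \<phi> (x + s *\<^sub>R v)) has_real_derivative (g (x + t *\<^sub>R v) \<bullet> v)) (at t)" if "0 \<le> t" "t \<le> s" for t
  proof -
    have "((\<lambda>s. \<phi> (x + s *\<^sub>R v)) has_derivative (\<lambda>h. g (x + t *\<^sub>R v) \<bullet> (h *\<^sub>R v))) (at t)"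
      by (rule has_derivative_compose[OF line d]) (use inU that s in auto)
    then show ?thesis by (simp add: has_field_derivative_def mult_commute_abs)
  qed
  from MVT2[OF s(1), of "\<lambda>s. \<phi> (x + s *\<^sub>R v)" "\<lambda>t. g (x + t *\<^sub>R v) \<bullet> v"] this
  obtain t where t: "0 < t" "t < s" "\<phi> (x + s *\<^sub>R v) - \<phi> (x + 0 *\<^sub>R v) = (s - 0) * (g (x + t *\<^sub>R v) \<bullet> v)"
    by blast
  have "g (x + t *\<^sub>R v) \<bullet> v > 0" using t s by (intro d0) auto
  then have "(s - 0) * (g (x + t *\<^sub>R v) \<bullet> v) > 0" using s by simp
  then have "\<phi> (x + s *\<^sub>R v) > \<phi> x" unfolding t(3)[symmetric] by simp
  moreover have "\<phi> (x + s *\<^sub>R v) \<le> \<phi> x" using inU s by (intro max) auto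
  ultimately show False by simp
qed

lemma C2_jet_max_tangential_trace:
  assumes "C2_jet \<phi> g H U" "x \<in> U" "\<And>z. z \<in> U \<Longrightarrow> \<phi> z \<le> \<phi> x" "norm e = 1"
  shows "tangential_trace e (H x) \<le> 0"
proof -
  obtain B where "hyperplane_basis e B" using hyperplane_basis_exists[OF assms(4)] .
  then interpret hyperplane_basis e B .
  show ?thesis unfolding sum_basis_eq_tangential_trace[symmetric]
    by (intro sum_nonpos C2_jet_max_hessian[OF assms(1,2,3)])
qed

section \<open>Finite sums of plane waves\<close>

definition trig_poly :: "(real \<times> (real^'n) \<times> real) list \<Rightarrow> real^'n \<Rightarrow> real" where
  "trig_poly L x = (\<Sum>(a, \<xi>, \<theta>)\<leftarrow>L. a * sin (\<xi> \<bullet> x + \<theta>))"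

definition trig_laplacian :: "(real \<times> (real^'n) \<times> real) list \<Rightarrow> (real \<times> (real^'n) \<times> real) list" where
  "trig_laplacian = map (\<lambda>(a, \<xi>, \<theta>). (- a * (\<xi> \<bullet> \<xi>), \<xi>, \<theta>))"

text \<open>The Fourier multiplier of the inverse of 1 - lam Laplacian, exact on each wave. When all
  frequencies are orthogonal to \<open>e\<close>, the Laplacian is the tangential trace of the
  Hessian (\<open>trig_poly_jet\<close>).\<close>

definition trig_resolvent :: "real \<Rightarrow> (real \<times> (real^'n) \<times> real) list \<Rightarrow> (real \<times> (real^'n) \<times> real) list" where
  "trig_resolvent lam = map (\<lambda>(a, \<xi>, \<theta>). (a / (1 + lam * (\<xi> \<bullet> \<xi>)), \<xi>, \<theta>))"

definition trig_scale :: "real \<Rightarrow> (real \<times> (real^'n) \<times> real) list \<Rightarrow> (real \<times> (real^'n) \<times> real) list" where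
  "trig_scale c = map (\<lambda>(a, \<xi>, \<theta>). (c * a, \<xi>, \<theta>))"

definition frequencies_perp :: "real^'n \<Rightarrow> (real \<times> (real^'n) \<times> real) list \<Rightarrow> bool" where
  "frequencies_perp e L \<longleftrightarrow> (\<forall>(a, \<xi>, \<theta>)\<in>set L. \<xi> \<bullet> e = 0)"

lemma trig_poly_simps [simp]:
  "trig_poly [] x = 0"
  "trig_poly ((a, \<xi>, \<theta>) # L) x = a * sin (\<xi> \<bullet> x + \<theta>) + trig_poly L x"
  "trig_poly (L @ L') x = trig_poly L x + trig_poly L' x"
  by (auto simp: trig_poly_def)

lemma trig_scale: "trig_poly (trig_scale c L) x = c * trig_poly L x"
  by (induction L) (auto simp: trig_scale_def distrib_left)

lemma frequencies_perp_simps [simp]: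
  "frequencies_perp e []"
  "frequencies_perp e ((a, \<xi>, \<theta>) # L) \<longleftrightarrow> \<xi> \<bullet> e = 0 \<and> frequencies_perp e L"
  "frequencies_perp e (L @ L') \<longleftrightarrow> frequencies_perp e L \<and> frequencies_perp e L'"
  "frequencies_perp e (trig_laplacian L) \<longleftrightarrow> frequencies_perp e L"
  "frequencies_perp e (trig_resolvent lam L) \<longleftrightarrow> frequencies_perp e L"
  "frequencies_perp e (trig_scale c L) \<longleftrightarrow> frequencies_perp e L"
  by (simp_all add: frequencies_perp_def trig_laplacian_def trig_resolvent_def trig_scale_def ball_Un split_beta)

lemma trig_resolvent_equation:
  assumes "lam \<ge> 0"
  shows "trig_poly (trig_resolvent lam L) x = trig_poly L x + lam * trig_poly (trig_laplacian (trig_resolvent lam L)) x"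
proof (induction L)
  case (Cons t L)
  obtain a \<xi> \<theta> where t: "t = (a, \<xi>, \<theta>)" by (cases t) auto
  have "1 + lam * (\<xi> \<bullet> \<xi>) > 0" using assms by (simp add: add_pos_nonneg)
  then have "a / (1 + lam * (\<xi> \<bullet> \<xi>)) = a + lam * (- (a / (1 + lam * (\<xi> \<bullet> \<xi>))) * (\<xi> \<bullet> \<xi>))"
    by (simp add: field_simps)
  then obtain c where c: "a / (1 + lam * (\<xi> \<bullet> \<xi>)) = c" "c = a + lam * (- c * (\<xi> \<bullet> \<xi>))" by metis
  have "c * S = a * S + lam * (- c * (\<xi> \<bullet> \<xi>) * S)" for S
    using c(2) by (metis distrib_right mult.assoc)
  from this[of "sin (\<xi> \<bullet> x + \<theta>)"] show ?case using Cons
    by (simp add: t trig_resolvent_def trig_laplacian_def algebra_simps c(1))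
qed (auto simp: trig_resolvent_def trig_laplacian_def)

lemma trig_laplacian_resolvent: "trig_laplacian (trig_resolvent lam L) = trig_resolvent lam (trig_laplacian L)"
  by (auto simp: trig_laplacian_def trig_resolvent_def)

lemma trig_resolvent_append: "trig_resolvent lam (L @ L') = trig_resolvent lam L @ trig_resolvent lam L'"
  by (simp add: trig_resolvent_def)

lemma trig_resolvent_scale: "trig_resolvent lam (trig_scale c L) = trig_scale c (trig_resolvent lam L)"
  by (auto simp: trig_resolvent_def trig_scale_def)

lemma trig_poly_bounded: "\<exists>M. \<forall>x. \<bar>trig_poly L x\<bar> \<le> M"
proof (induction L)
  case (Cons t L)
  obtain a \<xi> \<theta> where t: "t = (a, \<xi>, \<theta>)" by (cases t) auto
  obtain M where M: "\<And>x. \<bar>trig_poly L x\<bar> \<le> M" using Cons by blast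
  have "\<bar>trig_poly (t # L) x\<bar> \<le> \<bar>a\<bar> + M" for x
  proof -
    have "\<bar>a * sin (\<xi> \<bullet> x + \<theta>)\<bar> \<le> \<bar>a\<bar>" by (simp add: abs_mult mult_left_le)
    then show ?thesis using M[of x] by (simp add: t)
  qed
  then show ?case by blast
qed auto

lemma trig_poly_jet:
  assumes "frequencies_perp e L"
  shows "\<exists>g H. C2_jet (trig_poly L) g H UNIV \<and> (\<forall>x. tangential_trace e (H x) = trig_poly (trig_laplacian L) x)"
  using assms
proof (induction L)
  case Nil
  have "C2_jet (trig_poly []) (\<lambda>x. 0) (\<lambda>x. 0) UNIV"
    using C2_jet_const[OF open_UNIV, of 0] by (simp add: trig_poly_def[abs_def])
  then show ?case
    by (intro exI[of _ "\<lambda>x. 0"] conjI) (assumption, simp add: trig_laplacian_def tangential_trace_zero)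
next
  case (Cons t L)
  obtain a \<xi> \<theta> where t: "t = (a, \<xi>, \<theta>)" by (cases t) auto
  obtain g H where gH: "C2_jet (trig_poly L) g H UNIV" "\<And>x. tangential_trace e (H x) = trig_poly (trig_laplacian L) x"
    using Cons by (auto simp: t)
  have lin: "C2_jet (\<lambda>x. \<xi> \<bullet> x) (\<lambda>x. \<xi>) (\<lambda>x. 0) UNIV"
    by (rule C2_jetI) (auto intro!: derivative_eq_intros simp: transpose_def vec_eq_iff)
  have "C2_jet (\<lambda>x. a * sin (\<xi> \<bullet> x + \<theta>) + trig_poly L x) (\<lambda>x. (a * cos (\<xi> \<bullet> x + \<theta>)) *\<^sub>R \<xi> + g x)
     (\<lambda>x. ((a * cos (\<xi> \<bullet> x + \<theta>)) *\<^sub>R 0 + (- a * sin (\<xi> \<bullet> x + \<theta>)) *\<^sub>R outer \<xi> \<xi>) + H x) UNIV"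
    by (intro C2_jet_add gH C2_jet_compose[OF lin, where F = "\<lambda>s. a * sin (s + \<theta>)" and F' = "\<lambda>s. a * cos (s + \<theta>)" and F'' = "\<lambda>s. - a * sin (s + \<theta>)"])
      (auto intro!: derivative_eq_intros continuous_intros)
  moreover have "trig_poly (t # L) = (\<lambda>x. a * sin (\<xi> \<bullet> x + \<theta>) + trig_poly L x)" by (auto simp: t)
  moreover have "tangential_trace e (((a * cos (\<xi> \<bullet> x + \<theta>)) *\<^sub>R 0 + (- a * sin (\<xi> \<bullet> x + \<theta>)) *\<^sub>R outer \<xi> \<xi>) + H x)
      = trig_poly (trig_laplacian (t # L)) x" for x
    using Cons.prems by (simp add: t tangential_trace_simps gH(2) trig_laplacian_def inner_commute)
  ultimately show ?case by (intro exI conjI) auto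
qed

lemma trig_poly_continuous: "continuous_on X (trig_poly L)"
proof -
  have "frequencies_perp 0 L" by (auto simp: frequencies_perp_def)
  then show ?thesis using trig_poly_jet
    by (metis C2_jet_def UNIV_I continuous_at_imp_continuous_on has_derivative_continuous)
qed

text \<open>Maximum principle: at a maximum of the resolvent w its tangential Laplacian is
  nonpositive, and the resolvent equation gives w \<le> M. A maximum over the whole space need not
  exist, so d |z|^2 is subtracted and d is made small.\<close>

lemma trig_resolvent_le:
  fixes e :: "real^'n"
  assumes L: "frequencies_perp e L" and e: "norm e = 1" and lam: "lam \<ge> 0" and M: "\<And>x. trig_poly L x \<le> M"
  shows "trig_poly (trig_resolvent lam L) x \<le> M"
proof -
  define w where "w = trig_poly (trig_resolvent lam L)"
  obtain W where W: "\<And>x. \<bar>w x\<bar> \<le> W" unfolding w_def using trig_poly_bounded by blast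
  obtain g H where gH: "C2_jet w g H UNIV" "\<And>x. tangential_trace e (H x) = trig_poly (trig_laplacian (trig_resolvent lam L)) x"
    unfolding w_def using trig_poly_jet[of e "trig_resolvent lam L"] L by auto
  have ee: "e \<bullet> e = 1" using e by (simp add: norm_eq_1)
  define C where "C = 2 * lam * (real CARD('n) - 1) + (norm x)^2 + 1"
  have C: "C > 0" using lam by (simp add: C_def add_nonneg_pos)
  have key: "w x \<le> M + d * C" if d: "d > 0" for d
  proof -
    define \<Phi> where "\<Phi> = (\<lambda>z. w z + (- d) * (norm (z - 0))^2)"
    \<comment> \<open>At this radius the penalty is 2 W + 1, more than w can vary, so the maximum
      over the ball is global.\<close>
    define \<rho> where "\<rho> = sqrt ((2 * W + 1) / d)"
    have W0: "W \<ge> 0" using W[of 0] by linarith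
    have \<rho>: "\<rho> > 0" "d * \<rho>^2 = 2 * W + 1" using d W0 by (auto simp: \<rho>_def)
    have cont: "continuous_on X \<Phi>" for X
      unfolding \<Phi>_def w_def by (intro continuous_intros trig_poly_continuous)
    obtain x1 where x1: "x1 \<in> cball 0 \<rho>" "\<And>z. z \<in> cball 0 \<rho> \<Longrightarrow> \<Phi> z \<le> \<Phi> x1"
      using continuous_attains_sup[OF compact_cball _ cont, of 0 \<rho>] \<rho> by fastforce
    have mx: "\<Phi> z \<le> \<Phi> x1" for z
    proof (cases "z \<in> cball 0 \<rho>")
      case False
      then have "\<rho>^2 \<le> (norm z)^2" using \<rho> by (intro power_mono) auto
      then have "d * \<rho>^2 \<le> d * (norm z)^2" using d by simp
      then have "\<Phi> z \<le> \<Phi> 0" using W[of z] W[of 0] \<rho>(2) by (simp add: \<Phi>_def)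
      also have "\<dots> \<le> \<Phi> x1" using \<rho> by (intro x1) auto
      finally show ?thesis .
    qed (rule x1)
    have "C2_jet \<Phi> (\<lambda>z. g z + (- d) *\<^sub>R 2 *\<^sub>R (z - 0)) (\<lambda>z. H z + (- d) *\<^sub>R 2 *\<^sub>R mat 1) UNIV"
      unfolding \<Phi>_def by (intro C2_jet_add gH(1) C2_jet_cmult C2_jet_sqdist open_UNIV)
    from C2_jet_max_tangential_trace[OF this _ mx e]
    have "trig_poly (trig_laplacian (trig_resolvent lam L)) x1 \<le> 2 * d * (real CARD('n) - 1)"
      by (simp add: tangential_trace_simps gH(2) ee)
    then have "lam * trig_poly (trig_laplacian (trig_resolvent lam L)) x1 \<le> lam * (2 * d * (real CARD('n) - 1))"
      using lam by (rule mult_left_mono)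
    then have "w x1 \<le> M + lam * (2 * d * (real CARD('n) - 1))"
      using trig_resolvent_equation[OF lam, of L x1] M[of x1] by (simp add: w_def)
    moreover have "w x \<le> w x1 + d * (norm x)^2"
    proof -
      have "0 \<le> d * (norm x1)^2" using d by simp
      then show ?thesis using mx[of x] by (simp add: \<Phi>_def)
    qed
    ultimately show ?thesis using d by (simp add: C_def algebra_simps)
  qed
  have "w x \<le> M"
  proof (rule field_le_epsilon)
    fix s :: real assume "s > 0"
    then show "w x \<le> M + s" using key[of "s / C"] C by simp
  qed
  then show ?thesis by (simp add: w_def)
qed

lemma trig_resolvent_abs_le:
  assumes "frequencies_perp e L" "norm e = 1" "lam \<ge> 0" "\<And>x. \<bar>trig_poly L x\<bar> \<le> M"
  shows "\<bar>trig_poly (trig_resolvent lam L) x\<bar> \<le> M"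
proof -
  have "trig_poly (trig_resolvent lam L) x \<le> M"
    using assms(4) by (intro trig_resolvent_le[OF assms(1-3)]) (simp add: abs_le_iff)
  moreover have "trig_poly (trig_resolvent lam (trig_scale (-1) L)) x \<le> M"
    using assms by (intro trig_resolvent_le[of e]) (simp_all add: trig_scale abs_le_iff)
  ultimately show ?thesis by (simp add: trig_resolvent_scale trig_scale abs_le_iff)
qed

text \<open>The product-to-sum formula, with cosines as sines of phase shifted by pi/2. It makes
  these sums an algebra, as Stone-Weierstrass requires.\<close>

lemma trig_poly_mult:
  assumes "frequencies_perp e L" "frequencies_perp e L'"
  shows "\<exists>L''. frequencies_perp e L'' \<and> (\<forall>x. trig_poly L x * trig_poly L' x = trig_poly L'' x)"
  using assms(1)
proof (induction L)
  case Nil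
  then show ?case by (intro exI[of _ "[]"]) auto
next
  case (Cons t L)
  obtain a \<xi> \<theta> where t: "t = (a, \<xi>, \<theta>)" by (cases t) auto
  have one: "\<exists>M. frequencies_perp e M \<and> (\<forall>x. a * sin (\<xi> \<bullet> x + \<theta>) * trig_poly L' x = trig_poly M x)"
    using assms(2)
  proof (induction L')
    case Nil
    then show ?case by (intro exI[of _ "[]"]) auto
  next
    case (Cons t' L')
    obtain b \<eta> \<tau> where t': "t' = (b, \<eta>, \<tau>)" by (cases t') auto
    obtain M where M: "frequencies_perp e M" "\<And>x. a * sin (\<xi> \<bullet> x + \<theta>) * trig_poly L' x = trig_poly M x"
      using Cons by (auto simp: t')
    define M' where "M' = (a * b / 2, \<xi> - \<eta>, \<theta> - \<tau> + pi / 2) # (- (a * b / 2), \<xi> + \<eta>, \<theta> + \<tau> + pi / 2) # M"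
    have "frequencies_perp e M'"
      using M Cons.prems \<open>frequencies_perp e (t # L)\<close> by (simp add: M'_def t t' inner_diff_left inner_add_left)
    moreover have "a * sin (\<xi> \<bullet> x + \<theta>) * trig_poly (t' # L') x = trig_poly M' x" for x
    proof -
      define p q where "p = \<xi> \<bullet> x + \<theta>" and "q = \<eta> \<bullet> x + \<tau>"
      have "sin ((\<xi> - \<eta>) \<bullet> x + (\<theta> - \<tau> + pi / 2)) = cos (p - q)"
      proof -
        have "(\<xi> - \<eta>) \<bullet> x + (\<theta> - \<tau> + pi / 2) = (p - q) + pi / 2" by (simp add: p_def q_def inner_diff_left)
        then show ?thesis by (simp only: sin_add[of "p - q"]) simp
      qed
      moreover have "sin ((\<xi> + \<eta>) \<bullet> x + (\<theta> + \<tau> + pi / 2)) = cos (p + q)"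
      proof -
        have "(\<xi> + \<eta>) \<bullet> x + (\<theta> + \<tau> + pi / 2) = (p + q) + pi / 2" by (simp add: p_def q_def inner_add_left)
        then show ?thesis by (simp only: sin_add[of "p + q"]) simp
      qed
      moreover have "a * sin p * (b * sin q) = a * b / 2 * cos (p - q) + - (a * b / 2) * cos (p + q)"
      proof -
        have "a * sin p * (b * sin q) = a * b * (sin p * sin q)" by simp
        then show ?thesis unfolding sin_times_sin by (simp add: field_simps)
      qed
      ultimately show ?thesis using M(2)[of x]
        unfolding t' M'_def trig_poly_simps p_def[symmetric] q_def[symmetric] distrib_left by simp
    qed
    ultimately show ?case by blast
  qed
  obtain M where M: "frequencies_perp e M" "\<And>x. a * sin (\<xi> \<bullet> x + \<theta>) * trig_poly L' x = trig_poly M x"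
    using one by blast
  obtain L'' where L'': "frequencies_perp e L''" "\<And>x. trig_poly L x * trig_poly L' x = trig_poly L'' x"
    using Cons by (auto simp: t)
  have "trig_poly (t # L) x * trig_poly L' x = trig_poly (M @ L'') x" for x
    using M(2)[of x] L''(2)[of x] by (simp add: t distrib_right)
  then show ?case using M(1) L''(1) by (intro exI[of _ "M @ L''"]) auto
qed

section \<open>Sums of subsolutions on a hyperplane\<close>

lemma sin_inj_abs: "\<bar>x\<bar> \<le> pi / 2 \<Longrightarrow> \<bar>y\<bar> \<le> pi / 2 \<Longrightarrow> sin x = sin y \<Longrightarrow> x = y"
  by (rule sin_inj_pi) linarith+

locale hyperplane_cube = hyperplane_basis e B for e :: "real^'n" and B +
  fixes \<rho> :: real
  assumes \<rho>_pos: "\<rho> > 0"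
begin

text \<open>A cube in the hyperplane, thickened along \<open>e\<close>: the comparison takes place
  on the cube, but test functions must live on open subsets of the whole space.\<close>

definition box :: "real \<Rightarrow> (real^'n) set" where
  "box s = {z. \<bar>z \<bullet> e\<bar> \<le> s \<and> (\<forall>b\<in>B. \<bar>b \<bullet> z\<bar> \<le> \<rho>)}"

definition slice :: "(real^'n) set" where
  "slice = {z. z \<bullet> e = 0 \<and> (\<forall>b\<in>B. \<bar>b \<bullet> z\<bar> \<le> \<rho>)}"

text \<open>For |b . x| \<le> \<rho> the argument runs through [-pi/2, pi/2], where the sine is
  injective with range [-1, 1]. The waves thus serve as coordinates on the cube.\<close>

definition wave :: "real^'n \<Rightarrow> real^'n \<Rightarrow> real" where
  "wave b x = sin ((pi / (2 * \<rho>)) * (b \<bullet> x))"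

text \<open>Such functions are determined by the wave values, hence invariant under reflection in
  the faces of the cube. A bound on the cube is then global, and the maximum principle on the whole
  space applies without boundary conditions.\<close>

definition folded :: "(real^'n \<Rightarrow> real) \<Rightarrow> bool" where
  "folded q \<longleftrightarrow> (\<forall>x x'. (\<forall>b\<in>B. wave b x = wave b x') \<longrightarrow> q x = q x')"

lemma folded_combine:
  assumes f: "folded f" and g: "folded g"
  shows "folded (\<lambda>x. F (f x) (g x))"
  unfolding folded_def
proof (intro allI impI)
  fix x x' assume eq: "\<forall>b\<in>B. wave b x = wave b x'"
  have "f x = f x'" "g x = g x'" using f g eq unfolding folded_def by blast+
  then show "F (f x) (g x) = F (f x') (g x')" by simp
qed

lemma slice_subset_box: "s \<ge> 0 \<Longrightarrow> slice \<subseteq> box s"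
  by (auto simp: box_def slice_def)

lemma zero_in_slice: "0 \<in> slice"
  using \<rho>_pos by (simp add: slice_def)

lemma norm_box:
  assumes "z \<in> box s"
  shows "norm z \<le> real (card B) * \<rho> + s"
proof -
  have "norm z \<le> norm (\<Sum>b\<in>B. (z \<bullet> b) *\<^sub>R b) + norm ((z \<bullet> e) *\<^sub>R e)"
    using norm_triangle_ineq[of "\<Sum>b\<in>B. (z \<bullet> b) *\<^sub>R b" "(z \<bullet> e) *\<^sub>R e"]
    by (simp only: expand[of z, symmetric])
  also have "norm (\<Sum>b\<in>B. (z \<bullet> b) *\<^sub>R b) \<le> (\<Sum>b\<in>B. \<rho>)"
    using assms by (intro sum_norm_le) (auto simp: box_def norm_B inner_commute)
  also have "norm ((z \<bullet> e) *\<^sub>R e) \<le> s" using assms by (simp add: box_def norm_e)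
  finally show ?thesis by simp
qed

lemma compact_box: "compact (box s)"
proof -
  have "closed (box s)"
    unfolding box_def Collect_conj_eq Collect_ball_eq
    by (intro closed_Int closed_INT ballI closed_Collect_le continuous_intros)
  moreover have "bounded (box s)" using norm_box by (auto simp: bounded_iff)
  ultimately show ?thesis by (simp add: compact_eq_bounded_closed)
qed

lemma compact_slice: "compact slice"
proof -
  have "slice = box 0" by (auto simp: slice_def box_def)
  then show ?thesis using compact_box by simp
qed

text \<open>Arcsines of the wave values are the coordinates of the point into which repeated
  reflection in the faces carries \<open>x\<close>.\<close>

lemma fold_into_slice: "\<exists>x'\<in>slice. \<forall>b\<in>B. wave b x' = wave b x"
proof -
  define c where "c = pi / (2 * \<rho>)"
  have c: "c > 0" using \<rho>_pos by (simp add: c_def)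
  have c\<rho>: "\<rho> = (pi / 2) / c" using \<rho>_pos by (simp add: c_def)
  define x' where "x' = (\<Sum>b\<in>B. (arcsin (wave b x) / c) *\<^sub>R b)"
  have bx: "b \<bullet> x' = arcsin (wave b x) / c" if "b \<in> B" for b
  proof -
    have "b \<bullet> x' = (\<Sum>a\<in>B. if b = a then arcsin (wave b x) / c else 0)"
      unfolding x'_def inner_sum_right by (intro sum.cong) (auto simp: B_B that)
    then show ?thesis using finite_B that by simp
  qed
  have w: "- 1 \<le> wave b x" "wave b x \<le> 1" for b by (auto simp: wave_def)
  have "x' \<in> slice"
  proof -
    have "x' \<bullet> e = 0" unfolding x'_def inner_sum_left by (intro sum.neutral) (simp add: B_perp)
    moreover have "\<bar>b \<bullet> x'\<bar> \<le> \<rho>" if "b \<in> B" for b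
    proof -
      have "\<bar>arcsin (wave b x)\<bar> \<le> pi / 2" using arcsin_bounded[OF w(1)[of b] w(2)[of b]] by linarith
      then have "\<bar>arcsin (wave b x)\<bar> / c \<le> (pi / 2) / c" using c by (intro divide_right_mono) auto
      then show ?thesis unfolding bx[OF that] c\<rho> using c by (simp add: abs_divide)
    qed
    ultimately show ?thesis by (simp add: slice_def)
  qed
  moreover have "wave b x' = wave b x" if "b \<in> B" for b
  proof -
    have "wave b x' = sin (c * (arcsin (wave b x) / c))" using bx[OF that] by (simp add: wave_def[of b x'] c_def)
    also have "\<dots> = wave b x" using c w by simp
    finally show ?thesis .
  qed
  ultimately show ?thesis by blast
qed

lemma folded_le:
  assumes "folded q" "\<And>x. x \<in> slice \<Longrightarrow> q x \<le> M"
  shows "q x \<le> M"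
proof -
  obtain x' where "x' \<in> slice" "\<forall>b\<in>B. wave b x' = wave b x" using fold_into_slice by blast
  then show ?thesis using assms unfolding folded_def by metis
qed

lemma wave_trig: "wave b = trig_poly [(1, (pi / (2 * \<rho>)) *\<^sub>R b, 0)]"
  by (auto simp: wave_def)

text \<open>Stone-Weierstrass for the algebra of folded sums; the waves separate the points of the
  cube.\<close>

lemma trig_approximation:
  assumes cont: "continuous_on slice u" and d: "d > 0"
  obtains L where "frequencies_perp e L" "folded (trig_poly L)" "\<And>x. x \<in> slice \<Longrightarrow> \<bar>trig_poly L x - u x\<bar> < d"
proof -
  define R where "R = {q. (\<exists>L. frequencies_perp e L \<and> q = trig_poly L) \<and> folded q}"
  have "function_ring_on R slice"
  proof
    show "compact slice" by (rule compact_slice)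
    show "continuous_on slice f" if "f \<in> R" for f using that trig_poly_continuous by (auto simp: R_def)
    show "(\<lambda>x. f x + g x) \<in> R" if fg: "f \<in> R" "g \<in> R" for f g
    proof -
      obtain L L' where L: "frequencies_perp e L" "f = trig_poly L" "frequencies_perp e L'" "g = trig_poly L'"
        using fg unfolding R_def by blast
      have "(\<lambda>x. f x + g x) = trig_poly (L @ L')" by (simp add: L fun_eq_iff)
      moreover have "frequencies_perp e (L @ L')" using L by simp
      moreover have "folded (\<lambda>x. f x + g x)" using fg folded_combine[of f g "(+)"] by (simp add: R_def)
      ultimately show ?thesis unfolding R_def by blast
    qed
    show "(\<lambda>x. f x * g x) \<in> R" if fg: "f \<in> R" "g \<in> R" for f g
    proof -
      obtain L L' where L: "frequencies_perp e L" "f = trig_poly L" "frequencies_perp e L'" "g = trig_poly L'"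
        using fg unfolding R_def by blast
      obtain L'' where L'': "frequencies_perp e L''" "\<And>x. trig_poly L x * trig_poly L' x = trig_poly L'' x"
        using trig_poly_mult[OF L(1,3)] by blast
      have "(\<lambda>x. f x * g x) = trig_poly L''" by (simp add: L L''(2) fun_eq_iff)
      moreover note L''(1)
      moreover have "folded (\<lambda>x. f x * g x)" using fg folded_combine[of f g "\<lambda>a b. a * b"] by (simp add: R_def)
      ultimately show ?thesis unfolding R_def by blast
    qed
    show "(\<lambda>_. c) \<in> R" for c
    proof -
      have "(\<lambda>_. c) = trig_poly [(c, 0, pi / 2)]" by auto
      moreover have "frequencies_perp e [(c, 0, pi / 2)]" by simp
      ultimately show ?thesis unfolding R_def folded_def by blast
    qed
    show "\<exists>f\<in>R. f x \<noteq> f y" if "x \<in> slice" "y \<in> slice" "x \<noteq> y" for x y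
    proof (rule ccontr)
      assume no: "\<not> ?thesis"
      have "x \<bullet> b = y \<bullet> b" if b: "b \<in> B" for b
      proof -
        have "wave b \<in> R"
          using b B_perp[OF b] unfolding R_def by (auto simp: folded_def wave_trig intro!: exI[of _ "[(1, (pi / (2 * \<rho>)) *\<^sub>R b, 0)]"])
        then have "wave b x = wave b y" using no by blast
        then have s: "sin ((pi / (2 * \<rho>)) * (b \<bullet> x)) = sin ((pi / (2 * \<rho>)) * (b \<bullet> y))" by (simp add: wave_def)
        have rng: "\<bar>(pi / (2 * \<rho>)) * (b \<bullet> z)\<bar> \<le> pi / 2" if "z \<in> slice" for z
        proof -
          have "\<bar>(pi / (2 * \<rho>)) * (b \<bullet> z)\<bar> = (pi / (2 * \<rho>)) * \<bar>b \<bullet> z\<bar>" using \<rho>_pos by (simp add: abs_mult)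
          also have "\<dots> \<le> (pi / (2 * \<rho>)) * \<rho>" using that b \<rho>_pos by (intro mult_left_mono) (auto simp: slice_def)
          also have "\<dots> = pi / 2" using \<rho>_pos by simp
          finally show ?thesis .
        qed
        have "(pi / (2 * \<rho>)) * (b \<bullet> x) = (pi / (2 * \<rho>)) * (b \<bullet> y)"
          by (rule sin_inj_abs[OF rng[OF \<open>x \<in> slice\<close>] rng[OF \<open>y \<in> slice\<close>] s])
        moreover have "pi / (2 * \<rho>) \<noteq> 0" using \<rho>_pos by simp
        ultimately show ?thesis by (metis inner_commute mult_cancel_left)
      qed
      moreover have "x \<bullet> e = y \<bullet> e" using that by (simp add: slice_def)
      ultimately have "x = y" using expand[of x] expand[of y] by simp
      then show False using that by simp
    qed
  qed
  then interpret function_ring_on R slice .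
  obtain g where g: "g \<in> R" "\<forall>x\<in>slice. \<bar>u x - g x\<bar> < d" using Stone_Weierstrass_basic[OF cont d] by blast
  obtain L where L: "frequencies_perp e L" "g = trig_poly L" "folded g" using g(1) unfolding R_def by blast
  show ?thesis
  proof (rule that)
    show "\<bar>trig_poly L x - u x\<bar> < d" if "x \<in> slice" for x
      using g(2) that unfolding L(2) by (metis abs_minus_commute)
  qed (use L in simp_all)
qed

lemma folded_diff_abs_le:
  assumes "folded (trig_poly L)" "folded (trig_poly L')" "\<And>x. x \<in> slice \<Longrightarrow> \<bar>trig_poly L x - trig_poly L' x\<bar> \<le> M"
  shows "\<bar>trig_poly L x - trig_poly L' x\<bar> \<le> M"
proof -
  have "folded (\<lambda>x. \<bar>trig_poly L x - trig_poly L' x\<bar>)"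
    using folded_combine[OF assms(1,2), of "\<lambda>a b. \<bar>a - b\<bar>"] .
  then show ?thesis using assms(3) by (rule folded_le)
qed

text \<open>Compared from above with the resolvent of an approximation of its values on the slice, a
  strict viscosity subsolution gains \<open>lam * \<kappa>\<close> up to a constant, while the approximation error
  may be chosen much smaller. The resolvent satisfies the maximum principle and is linear, which
  is what makes subsolutions addable.\<close>

lemma subsolution_le_resolvent:
  assumes vb: "viscosity_bound (ball 0 r) (\<lambda>_ _ _. \<kappa>) u" and cont: "continuous_on (ball 0 r) u"
    and \<kappa>: "\<kappa> > 0" and r: "(real (card B) + 1) * \<rho> < r"
  shows "\<exists>lam0>0. \<exists>d0>0. \<forall>lam d L. 0 < lam \<longrightarrow> lam \<le> lam0 \<longrightarrow> 0 < d \<longrightarrow> d \<le> d0 \<longrightarrow> frequencies_perp e L \<longrightarrow>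
       folded (trig_poly L) \<longrightarrow> (\<forall>x\<in>slice. \<bar>trig_poly L x - u x\<bar> < d) \<longrightarrow>
       u 0 \<le> trig_poly (trig_resolvent lam L) 0 + d - 3 / 8 * lam * \<kappa>"
proof -
  define n where "n = real CARD('n)"
  have n: "n \<ge> 1" by (simp add: n_def Suc_leI)
  \<comment> \<open>The penalty \<eta> |z|^2 contributes 2 \<eta> (n-1) to the tangential trace, at
    most half of \<kappa>.\<close>
  define \<eta> where "\<eta> = \<kappa> / (4 * n)"
  have \<eta>: "\<eta> > 0" "2 * \<eta> * (n - 1) \<le> \<kappa> / 2" using \<kappa> n by (auto simp: \<eta>_def field_simps)
  \<comment> \<open>Then 14 d0 < \<eta> \<rho>^2, so that the penalty keeps the contact point within
    |z| < \<rho>.\<close>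
  define d0 where "d0 = \<eta> * \<rho>^2 / 20"
  have d0: "d0 > 0" using \<eta> \<rho>_pos by (simp add: d0_def)
  have box_ball: "box s \<subseteq> ball 0 r" if "s \<le> \<rho>" for s
  proof
    fix z assume "z \<in> box s"
    then show "z \<in> ball 0 r" using norm_box[of z s] that r by (simp add: distrib_right)
  qed
  have slice_ball: "slice \<subseteq> ball 0 r" using slice_subset_box[of \<rho>] box_ball[of \<rho>] \<rho>_pos by auto
  \<comment> \<open>One fixed approximation, whose Laplacian bound M determines \<open>lam0\<close>;
    therefore \<open>lam0\<close> does not depend on the later \<open>L\<close> and
    \<open>d\<close>.\<close>
  obtain L0 where L0: "frequencies_perp e L0" "folded (trig_poly L0)" "\<And>x. x \<in> slice \<Longrightarrow> \<bar>trig_poly L0 x - u x\<bar> < d0"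
    using trig_approximation[OF continuous_on_subset[OF cont slice_ball] d0] by blast
  obtain M where M: "\<And>x. \<bar>trig_poly (trig_laplacian L0) x\<bar> \<le> M" using trig_poly_bounded by blast
  have M0: "M \<ge> 0" using M[of 0] by linarith
  define lam0 where "lam0 = d0 / (M + 1)"
  have lam0: "lam0 > 0" using d0 M0 by (simp add: lam0_def)
  have main: "u 0 \<le> trig_poly (trig_resolvent lam L) 0 + d - 3 / 8 * lam * \<kappa>"
    if lam: "0 < lam" "lam \<le> lam0" and d: "0 < d" "d \<le> d0" and L: "frequencies_perp e L" "folded (trig_poly L)"
      and app: "\<And>x. x \<in> slice \<Longrightarrow> \<bar>trig_poly L x - u x\<bar> < d" for lam d L
  proof -
    define w where "w = trig_poly (trig_resolvent lam L)"
    define q where "q = trig_poly L"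
    \<comment> \<open>\<open>L\<close> enters only through its closeness to \<open>L0\<close>: the
      resolvent is a contraction in the supremum norm, so w and q differ by at most 2 d0 + d0 + 2
      d0.\<close>
    have diff: "\<bar>trig_poly L x - trig_poly L0 x\<bar> \<le> 2 * d0" for x
      by (rule folded_diff_abs_le[OF L(2) L0(2)]) (use app L0(3) d in force)
    have "\<bar>trig_poly (trig_resolvent lam (L @ trig_scale (-1) L0)) x\<bar> \<le> 2 * d0" for x
      using lam L L0 diff by (intro trig_resolvent_abs_le[OF _ norm_e]) (simp_all add: trig_scale)
    then have diff_w: "\<bar>w x - trig_poly (trig_resolvent lam L0) x\<bar> \<le> 2 * d0" for x
      by (simp add: trig_resolvent_append trig_resolvent_scale trig_scale w_def)
    have diff_0: "\<bar>trig_poly (trig_resolvent lam L0) x - trig_poly L0 x\<bar> \<le> d0" for x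
    proof -
      have "\<bar>trig_poly (trig_laplacian (trig_resolvent lam L0)) x\<bar> \<le> M"
        unfolding trig_laplacian_resolvent using lam L0 M by (intro trig_resolvent_abs_le[OF _ norm_e]) simp_all
      then have "lam * \<bar>trig_poly (trig_laplacian (trig_resolvent lam L0)) x\<bar> \<le> lam0 * (M + 1)"
        using lam by (intro mult_mono) auto
      also have "\<dots> = d0" using M0 by (simp add: lam0_def)
      finally show ?thesis using lam trig_resolvent_equation[of lam L0 x] by (simp add: abs_mult)
    qed
    have wq: "\<bar>w x - q x\<bar> \<le> 5 * d0" for x
      using diff_w[of x] diff_0[of x] diff[of x] by (simp add: q_def)
    \<comment> \<open>Tolerance for the variation of u across the thickness; its bound lam
      \<kappa>/8 is what reduces the gain lam \<kappa>/2 to 3/8 lam \<kappa>.\<close>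
    define \<mu> where "\<mu> = min d0 (lam * \<kappa> / 8)"
    have \<mu>: "\<mu> > 0" "\<mu> \<le> d0" "\<mu> \<le> lam * \<kappa> / 8" using d0 lam \<kappa> by (auto simp: \<mu>_def)
    have "uniformly_continuous_on (box \<rho>) u"
      by (intro compact_uniformly_continuous compact_box continuous_on_subset[OF cont] box_ball order_refl)
    then obtain t where t: "t > 0" "\<And>x y. x \<in> box \<rho> \<Longrightarrow> y \<in> box \<rho> \<Longrightarrow> dist y x < t \<Longrightarrow> dist (u y) (u x) < \<mu>"
      unfolding uniformly_continuous_on_def using \<mu>(1) by metis
    define s where "s = min \<rho> (t / 2)"
    have s: "s > 0" "s \<le> \<rho>" "s < t" using t \<rho>_pos by (auto simp: s_def)
    define proj where "proj = (\<lambda>z. z - (z \<bullet> e) *\<^sub>R e)"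
    have proj_b: "b \<bullet> proj z = b \<bullet> z" if "b \<in> B" for b z
      using B_perp[OF that] by (simp add: proj_def inner_diff_right)
    have proj_slice: "proj z \<in> slice" if "z \<in> box s" for z
      using that proj_b by (auto simp: slice_def box_def) (simp add: proj_def inner_diff_left e_e)
    have u_proj: "\<bar>u z - u (proj z)\<bar> < \<mu>" if z: "z \<in> box s" for z
    proof -
      have "z \<in> box \<rho>" using z s by (auto simp: box_def)
      moreover have "proj z \<in> box \<rho>" using proj_slice[OF z] slice_subset_box[of \<rho>] \<rho>_pos by auto
      moreover have "dist z (proj z) < t" using z s by (simp add: proj_def dist_norm norm_e box_def)
      ultimately show ?thesis using t(2) by (metis dist_real_def)
    qed
    have q_proj: "q (proj z) = q z" for z
      using L(2) proj_b unfolding q_def folded_def wave_def by (metis (no_types, lifting))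
    \<comment> \<open>All errors together stay below 14 d0, the value of N (e . z)^2 on the faces |z
      . e| = s, so contact avoids these faces. The Hessian of this penalty is a multiple of e
      \<otimes> e and has tangential trace 0 along \<open>e\<close>.\<close>
    define N where "N = 14 * d0 / s^2"
    have N: "N > 0" "N * s^2 = 14 * d0" using d0 s by (auto simp: N_def)
    define \<phi> where "\<phi> = (\<lambda>z. w z + (\<eta> * (norm (z - 0))^2 +
        (0 * (e \<bullet> (z - 0)) + ((z - 0) \<bullet> (((2 * N) *\<^sub>R outer e e) *v (z - 0))) / 2)))"
    have \<phi>_eq: "\<phi> z = w z + \<eta> * (norm z)^2 + N * (e \<bullet> z)^2" for z
      by (simp add: \<phi>_def scaleR_matrix_vector_assoc[symmetric] outer_mult_vector inner_commute power2_eq_square)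
    obtain g H where gH: "C2_jet w g H UNIV" "\<And>x. tangential_trace e (H x) = trig_poly (trig_laplacian (trig_resolvent lam L)) x"
      unfolding w_def using trig_poly_jet[of e "trig_resolvent lam L"] L by auto
    define V where "V = {z. \<bar>z \<bullet> e\<bar> < s \<and> (\<forall>b\<in>B. \<bar>b \<bullet> z\<bar> < \<rho>)}"
    have opV: "open V"
      unfolding V_def Collect_conj_eq Collect_ball_eq
      by (intro open_Int open_INT finite_B ballI open_Collect_less continuous_intros)
    have VB: "V \<subseteq> box s" by (auto simp: V_def box_def)
    have jet: "C2_jet \<phi> (\<lambda>z. g z + (\<eta> *\<^sub>R 2 *\<^sub>R (z - 0) + (0 *\<^sub>R e + ((2 * N) *\<^sub>R outer e e) *v (z - 0))))
        (\<lambda>z. H z + (\<eta> *\<^sub>R 2 *\<^sub>R mat 1 + (2 * N) *\<^sub>R outer e e)) V"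
      unfolding \<phi>_def
      by (intro C2_jet_add C2_jet_subset[OF gH(1)] C2_jet_cmult C2_jet_sqdist C2_jet_quadratic opV)
        (auto simp: transpose_scaleR transpose_outer)
    have zero_box: "0 \<in> box s" using zero_in_slice slice_subset_box[of s] s by auto
    have "continuous_on (box s) (\<lambda>z. u z - \<phi> z)"
      unfolding \<phi>_eq w_def
      by (intro continuous_intros continuous_on_subset[OF cont box_ball[OF s(2)]] trig_poly_continuous)
    from continuous_attains_sup[OF compact_box _ this] zero_box
    obtain z where z: "z \<in> box s" "\<And>x. x \<in> box s \<Longrightarrow> u x - \<phi> x \<le> u z - \<phi> z" by blast
    have z0: "u 0 - w 0 \<le> u z - w z - \<eta> * (norm z)^2 - N * (e \<bullet> z)^2"
      using z(2)[OF zero_box] by (simp add: \<phi>_eq)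
    have uq: "\<bar>q (proj z) - u (proj z)\<bar> < d" unfolding q_def by (intro app proj_slice z)
    have uq0: "\<bar>q 0 - u 0\<bar> < d" unfolding q_def by (intro app zero_in_slice)
    have sum13: "\<eta> * (norm z)^2 + N * (e \<bullet> z)^2 < 14 * d0"
      using z0 u_proj[OF z(1)] uq uq0 wq[of 0] wq[of z] q_proj[of z] \<mu>(2) d d0 by linarith
    have nn: "0 \<le> \<eta> * (norm z)^2" "0 \<le> N * (e \<bullet> z)^2" using \<eta>(1) N(1) by simp_all
    have e1: "N * (e \<bullet> z)^2 < N * s^2" using sum13 N(2) nn by linarith
    then have "(e \<bullet> z)^2 < s^2" using N(1) by simp
    then have ez: "\<bar>z \<bullet> e\<bar> < s" using s power2_less_imp_less[of "\<bar>e \<bullet> z\<bar>" s] by (simp add: inner_commute)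
    have "\<eta> * (norm z)^2 < \<eta> * \<rho>^2"
      using sum13 nn d0 unfolding d0_def by linarith
    then have "(norm z)^2 < \<rho>^2" using \<eta>(1) by simp
    then have nz: "norm z < \<rho>" using \<rho>_pos by (intro power2_less_imp_less[of "norm z" \<rho>]) auto
    have "\<bar>b \<bullet> z\<bar> < \<rho>" if "b \<in> B" for b
      using Cauchy_Schwarz_ineq2[of b z] norm_B[OF that] nz by simp
    then have zV: "z \<in> V" unfolding V_def using ez by simp
    have "\<kappa> \<le> tangential_trace e (H z + (\<eta> *\<^sub>R 2 *\<^sub>R mat 1 + (2 * N) *\<^sub>R outer e e))"
      using viscosity_boundD[OF vb _ jet zV _ norm_e] VB box_ball[OF s(2)] z(2) by blast
    then have "\<kappa> / 2 \<le> trig_poly (trig_laplacian (trig_resolvent lam L)) z"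
      using \<eta>(2) by (simp add: tangential_trace_simps gH(2) e_e n_def)
    then have "lam * (\<kappa> / 2) \<le> lam * trig_poly (trig_laplacian (trig_resolvent lam L)) z"
      using lam by (intro mult_left_mono) auto
    then have "w z \<ge> q z + lam * \<kappa> / 2"
      using trig_resolvent_equation[of lam L z] lam by (simp add: w_def q_def)
    moreover have "u 0 - w 0 \<le> u z - w z"
      using z0 nn by linarith
    moreover have "u z \<le> q z + d + \<mu>"
      using u_proj[OF z(1)] uq unfolding q_proj abs_less_iff by linarith
    ultimately have "u 0 - w 0 \<le> d + \<mu> - lam * \<kappa> / 2" by linarith
    then show ?thesis using \<mu>(3) by (simp add: w_def)
  qed
  show ?thesis
    by (intro exI[of _ lam0] exI[of _ d0] conjI lam0 d0 allI impI main) auto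
qed

end

text \<open>If u + v were maximal at 0 on the slice, the sum of the approximations would be at most
  u 0 + v 0 + 2 d everywhere, and so would its resolvent. By linearity the bounds of
  \<open>subsolution_le_resolvent\<close> for u and v add up and contradict this.\<close>

lemma subsolutions_sum_no_local_max:
  fixes e :: "real^'n"
  assumes e: "norm e = 1" and r: "r > 0" and \<kappa>: "\<kappa> > 0"
    and vb: "viscosity_bound (ball 0 r) (\<lambda>_ _ _. \<kappa>) u" "viscosity_bound (ball 0 r) (\<lambda>_ _ _. \<kappa>) v"
    and cont: "continuous_on (ball 0 r) u" "continuous_on (ball 0 r) v"
  shows "\<exists>z\<in>ball 0 r. z \<bullet> e = 0 \<and> u 0 + v 0 < u z + v z"
proof (rule ccontr)
  assume no: "\<not> ?thesis"
  obtain B where B: "hyperplane_basis e B" using hyperplane_basis_exists[OF e] .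
  define \<rho> where "\<rho> = r / (2 * (real (card B) + 1))"
  have \<rho>: "\<rho> > 0" using r by (simp add: \<rho>_def add_nonneg_pos)
  have "(real (card B) + 1) * \<rho> = r / 2" by (simp add: \<rho>_def field_simps)
  then have r': "(real (card B) + 1) * \<rho> < r" using r by simp
  interpret hyperplane_cube e B \<rho> using B \<rho> by (simp add: hyperplane_cube_def hyperplane_cube_axioms_def)
  have slice_ball: "slice \<subseteq> ball 0 r"
  proof
    fix z assume "z \<in> slice"
    then have "z \<in> box 0" by (simp add: slice_def box_def)
    then show "z \<in> ball 0 r" using norm_box[of z 0] r' \<rho> by (simp add: distrib_right)
  qed
  obtain l1 d1 where 1: "l1 > 0" "d1 > 0" "\<forall>lam d L. 0 < lam \<longrightarrow> lam \<le> l1 \<longrightarrow> 0 < d \<longrightarrow> d \<le> d1 \<longrightarrow> frequencies_perp e L \<longrightarrow>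
       folded (trig_poly L) \<longrightarrow> (\<forall>x\<in>slice. \<bar>trig_poly L x - u x\<bar> < d) \<longrightarrow>
       u 0 \<le> trig_poly (trig_resolvent lam L) 0 + d - 3 / 8 * lam * \<kappa>"
    using subsolution_le_resolvent[OF vb(1) cont(1) \<kappa> r'] by auto
  obtain l2 d2 where 2: "l2 > 0" "d2 > 0" "\<forall>lam d L. 0 < lam \<longrightarrow> lam \<le> l2 \<longrightarrow> 0 < d \<longrightarrow> d \<le> d2 \<longrightarrow> frequencies_perp e L \<longrightarrow>
       folded (trig_poly L) \<longrightarrow> (\<forall>x\<in>slice. \<bar>trig_poly L x - v x\<bar> < d) \<longrightarrow>
       v 0 \<le> trig_poly (trig_resolvent lam L) 0 + d - 3 / 8 * lam * \<kappa>"
    using subsolution_le_resolvent[OF vb(2) cont(2) \<kappa> r'] by auto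
  define lam where "lam = min l1 l2"
  have lam: "0 < lam" "lam \<le> l1" "lam \<le> l2" using 1(1) 2(1) by (auto simp: lam_def)
  \<comment> \<open>Chosen after \<open>lam\<close>: the total error 4 d is at most lam \<kappa>/4,
    below the combined gain 3/4 lam \<kappa>.\<close>
  define d where "d = min (min d1 d2) (lam * \<kappa> / 16)"
  have d: "0 < d" "d \<le> d1" "d \<le> d2" "d \<le> lam * \<kappa> / 16" using 1(2) 2(2) lam \<kappa> by (auto simp: d_def)
  obtain L where L: "frequencies_perp e L" "folded (trig_poly L)" "\<And>x. x \<in> slice \<Longrightarrow> \<bar>trig_poly L x - u x\<bar> < d"
    using trig_approximation[OF continuous_on_subset[OF cont(1) slice_ball] d(1)] by blast
  obtain L' where L': "frequencies_perp e L'" "folded (trig_poly L')" "\<And>x. x \<in> slice \<Longrightarrow> \<bar>trig_poly L' x - v x\<bar> < d"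
    using trig_approximation[OF continuous_on_subset[OF cont(2) slice_ball] d(1)] by blast
  have "trig_poly (L @ L') x \<le> u 0 + v 0 + 2 * d" for x
  proof (rule folded_le)
    show "folded (trig_poly (L @ L'))"
      using folded_combine[OF L(2) L'(2), of "(+)"] by (simp add: folded_def)
    fix x assume x: "x \<in> slice"
    then have "u x + v x \<le> u 0 + v 0" using no slice_ball by (force simp: slice_def)
    then show "trig_poly (L @ L') x \<le> u 0 + v 0 + 2 * d" using L(3)[OF x] L'(3)[OF x] by simp
  qed
  then have "trig_poly (trig_resolvent lam (L @ L')) 0 \<le> u 0 + v 0 + 2 * d"
    using lam L(1) L'(1) by (intro trig_resolvent_le[OF _ e]) auto
  moreover have "u 0 \<le> trig_poly (trig_resolvent lam L) 0 + d - 3 / 8 * lam * \<kappa>"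
    using lam d L by (intro 1(3)[rule_format]) auto
  moreover have "v 0 \<le> trig_poly (trig_resolvent lam L') 0 + d - 3 / 8 * lam * \<kappa>"
    using lam d L' by (intro 2(3)[rule_format]) auto
  moreover have "lam * \<kappa> > 0" using lam \<kappa> by simp
  ultimately show False using d(4) by (simp add: trig_resolvent_append)
qed

section \<open>Closest pairs in the interior\<close>

lemma C2_jet_translate:
  fixes a :: "real^'n"
  assumes "C2_jet \<phi> g H U"
  shows "C2_jet (\<lambda>z. \<phi> (z - a)) (\<lambda>z. g (z - a)) (\<lambda>z. H (z - a)) ((+) a ` U)"
proof (rule C2_jetI)
  show "open ((+) a ` U)" using assms by (simp add: C2_jet_def open_translation)
  have sh: "((\<lambda>z. z - a) has_derivative (\<lambda>h. h)) (at x)" for x :: "real^'n"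
    by (auto intro!: derivative_eq_intros)
  fix x assume x: "x \<in> (+) a ` U"
  then have U: "x - a \<in> U" by auto
  show "((\<lambda>z. \<phi> (z - a)) has_derivative (\<lambda>h. g (x - a) \<bullet> h)) (at x)"
    by (rule has_derivative_compose[OF sh]) (use assms U in \<open>auto simp: C2_jet_def\<close>)
  show "((\<lambda>z. g (z - a)) has_derivative (\<lambda>h. H (x - a) *v h)) (at x)"
    by (rule has_derivative_compose[OF sh]) (use assms U in \<open>auto simp: C2_jet_def\<close>)
  show "transpose (H (x - a)) = H (x - a)" using assms U by (simp add: C2_jet_def)
next
  show "continuous_on ((+) a ` U) (\<lambda>z. H (z - a))"
    by (rule continuous_on_compose2[of U H]) (use assms in \<open>auto simp: C2_jet_def intro!: continuous_intros\<close>)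
qed

lemma near_linear:
  fixes q :: "'a::euclidean_space"
  assumes der: "\<And>z. z \<in> ball q r \<Longrightarrow> (\<psi> has_derivative (\<lambda>h. D z \<bullet> h)) (at z)"
    and D: "\<And>z. z \<in> ball q r \<Longrightarrow> norm (D z - D q) \<le> \<omega>" and ab: "a \<in> ball q r" "b \<in> ball q r"
  shows "\<bar>\<psi> b - \<psi> a - D q \<bullet> (b - a)\<bar> \<le> \<omega> * norm (b - a)"
proof -
  have "norm ((\<psi> b - D q \<bullet> b) - (\<psi> a - D q \<bullet> a)) \<le> \<omega> * norm (b - a)"
  proof (rule differentiable_bound[of "ball q r" "\<lambda>z. \<psi> z - D q \<bullet> z" "\<lambda>z h. D z \<bullet> h - D q \<bullet> h"])
    fix z assume z: "z \<in> ball q r"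
    have "((\<lambda>z. D q \<bullet> z) has_derivative (\<lambda>h. D q \<bullet> h)) (at z)" by (auto intro!: derivative_eq_intros)
    then show "((\<lambda>z. \<psi> z - D q \<bullet> z) has_derivative (\<lambda>h. D z \<bullet> h - D q \<bullet> h)) (at z within ball q r)"
      by (rule has_derivative_at_withinI[OF has_derivative_diff[OF der[OF z]]])
    have w: "0 \<le> \<omega>" using D[OF z] norm_ge_zero order_trans by blast
    have "norm (D z \<bullet> h - D q \<bullet> h) \<le> \<omega> * norm h" for h
    proof -
      have "norm (D z \<bullet> h - D q \<bullet> h) \<le> norm (D z - D q) * norm h"
        using Cauchy_Schwarz_ineq2[of "D z - D q" h] by (simp add: inner_diff_left)
      also have "\<dots> \<le> \<omega> * norm h" by (intro mult_right_mono D z) simp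
      finally show ?thesis .
    qed
    then show "onorm (\<lambda>h. D z \<bullet> h - D q \<bullet> h) \<le> \<omega>" using w by (intro onorm_bound) auto
  qed (use ab in auto)
  moreover have "(\<psi> b - D q \<bullet> b) - (\<psi> a - D q \<bullet> a) = \<psi> b - \<psi> a - D q \<bullet> (b - a)"
    by (simp add: inner_diff_right)
  ultimately show ?thesis by simp
qed

text \<open>In the application \<beta> is the length of the gradient at \<open>q\<close>, and
  division by it turns values of \<psi> into heights of the level set to first order. Small
  gradients allow \<open>F\<close> to be replaced by the constant \<kappa>; the subtracted quadratic
  later makes the excess quantitative.\<close>

lemma viscosity_bound_rescale:
  fixes \<psi> :: "real^'n \<Rightarrow> real"
  assumes vb: "viscosity_bound \<Omega> F \<psi>"
    and der: "\<And>x. x \<in> \<Omega> \<Longrightarrow> (\<psi> has_derivative (\<lambda>h. D x \<bullet> h)) (at x)"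
    and crit: "\<And>x p \<nu>. x \<in> \<Omega> \<Longrightarrow> norm p \<le> \<gamma> \<Longrightarrow> norm \<nu> = 1 \<Longrightarrow> \<kappa> \<le> F x p \<nu>"
    and ball: "ball q r \<subseteq> \<Omega>" and D: "\<And>z. z \<in> ball q r \<Longrightarrow> norm (D z) \<le> \<gamma>" and \<beta>: "\<beta> > 0"
  shows "viscosity_bound (ball 0 r) (\<lambda>_ _ _. \<kappa> / \<beta> - 2 * \<eta> * (real CARD('n) - 1))
           (\<lambda>z. \<psi> (q + z) / \<beta> - \<eta> * (norm z)^2)"
  unfolding viscosity_bound_def
proof (intro allI impI ballI)
  fix U \<phi> g H x and \<nu> :: "real^'n"
  assume U: "U \<subseteq> ball 0 r" and J: "C2_jet \<phi> g H U" and x: "x \<in> U" and nu: "norm \<nu> = 1"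
    and max: "\<forall>z\<in>U. \<psi> (q + z) / \<beta> - \<eta> * (norm z)^2 - \<phi> z \<le> \<psi> (q + x) / \<beta> - \<eta> * (norm x)^2 - \<phi> x"
  define \<phi>' where "\<phi>' = (\<lambda>z. \<beta> * (\<phi> (z - q) + \<eta> * (norm (z - q))^2))"
  define V where "V = (+) q ` U"
  have "open V" using J by (simp add: V_def C2_jet_def open_translation)
  then have J': "C2_jet \<phi>' (\<lambda>z. \<beta> *\<^sub>R (g (z - q) + \<eta> *\<^sub>R 2 *\<^sub>R (z - q))) (\<lambda>z. \<beta> *\<^sub>R (H (z - q) + \<eta> *\<^sub>R 2 *\<^sub>R mat 1)) V"
    unfolding \<phi>'_def V_def by (intro C2_jet_cmult C2_jet_add C2_jet_translate J C2_jet_sqdist)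
  have VB: "V \<subseteq> ball q r" using U by (auto simp: V_def subset_iff dist_norm)
  have qx: "q + x \<in> V" using x by (simp add: V_def)
  have max': "\<psi> z - \<phi>' z \<le> \<psi> (q + x) - \<phi>' (q + x)" if z: "z \<in> V" for z
  proof -
    have "z - q \<in> U" using z by (auto simp: V_def)
    then have "\<psi> (q + (z - q)) / \<beta> - \<eta> * (norm (z - q))^2 - \<phi> (z - q) \<le> \<psi> (q + x) / \<beta> - \<eta> * (norm x)^2 - \<phi> x"
      using max by blast
    then have "\<beta> * (\<psi> z / \<beta> - \<eta> * (norm (z - q))^2 - \<phi> (z - q)) \<le> \<beta> * (\<psi> (q + x) / \<beta> - \<eta> * (norm x)^2 - \<phi> x)"
      using \<beta> by simp
    moreover have "\<beta> * (a / \<beta> - b - c) = a - \<beta> * (c + b)" for a b c using \<beta> by (simp add: field_simps)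
    ultimately show ?thesis by (simp add: \<phi>'_def)
  qed
  have qxO: "q + x \<in> ball q r" "q + x \<in> \<Omega>" using qx VB ball by auto
  have "D (q + x) = \<beta> *\<^sub>R (g (q + x - q) + \<eta> *\<^sub>R 2 *\<^sub>R (q + x - q))"
    by (rule gradient_eq_at_max[OF \<open>open V\<close> qx der[OF qxO(2)], of \<phi>'])
      (use J' qx max' in \<open>auto simp: C2_jet_def\<close>)
  then have "\<kappa> \<le> F (q + x) (\<beta> *\<^sub>R (g (q + x - q) + \<eta> *\<^sub>R 2 *\<^sub>R (q + x - q))) \<nu>"
    using crit[OF qxO(2) D[OF qxO(1)] nu] by simp
  also have "\<dots> \<le> tangential_trace \<nu> (\<beta> *\<^sub>R (H (q + x - q) + \<eta> *\<^sub>R 2 *\<^sub>R mat 1))"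
    by (rule viscosity_boundD[OF vb subset_trans[OF VB ball] J' qx max' nu])
  also have "\<dots> = \<beta> * (tangential_trace \<nu> (H x) + 2 * \<eta> * (real CARD('n) - 1))"
    using nu by (simp add: tangential_trace_simps norm_eq_1)
  finally have "\<kappa> / \<beta> \<le> tangential_trace \<nu> (H x) + 2 * \<eta> * (real CARD('n) - 1)"
    using \<beta> by (simp add: field_simps)
  then show "\<kappa> / \<beta> - 2 * \<eta> * (real CARD('n) - 1) \<le> tangential_trace \<nu> (H x)" by simp
qed

text \<open>The ball of radius d about x + d e touches the superlevel set at \<open>x\<close> from
  outside. The squared distance to its centre minus d^2 has the form required by
  \<open>touching_sublevel_set\<close>, with normal -e, k = 2 d and Q twice the identity. For
  \<beta> = 0 the result would read F \<le> 0, against \<kappa> \<le> F at small gradients.\<close>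

lemma closest_point_gradient:
  fixes \<psi> :: "real^'n \<Rightarrow> real"
  assumes op: "open \<Omega>" and vb: "viscosity_bound \<Omega> F \<psi>"
    and der: "\<And>x. x \<in> \<Omega> \<Longrightarrow> (\<psi> has_derivative (\<lambda>h. D x \<bullet> h)) (at x)" and cD: "continuous_on \<Omega> D"
    and F: "\<And>x p \<nu>. isCont (\<lambda>t. F (fst t) (fst (snd t)) (snd (snd t))) (x, p, \<nu>)"
    and \<kappa>: "\<kappa> > 0" and crit: "\<And>x p \<nu>. x \<in> \<Omega> \<Longrightarrow> norm p \<le> \<gamma> \<Longrightarrow> norm \<nu> = 1 \<Longrightarrow> \<kappa> \<le> F x p \<nu>"
    and x: "x \<in> \<Omega>" and d: "d > 0" and c: "c \<le> \<psi> x" and e: "norm e = 1"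
    and near: "\<And>z. z \<in> \<Omega> \<Longrightarrow> dist z x < d \<Longrightarrow> dist z (x + d *\<^sub>R e) < d \<Longrightarrow> \<psi> z < c"
  obtains \<beta> where "\<beta> \<ge> 0" "D x = (- \<beta>) *\<^sub>R e" "\<psi> x = c" "norm (D x) \<le> \<gamma> \<Longrightarrow> \<beta> > 0"
proof -
  have ee: "e \<bullet> e = 1" using e by (simp add: norm_eq_1)
  obtain r1 where r1: "r1 > 0" "ball x r1 \<subseteq> \<Omega>" using op x openE by blast
  have Q: "transpose (2 *\<^sub>R mat 1 :: real^'n^'n) = 2 *\<^sub>R mat 1" by (simp add: transpose_scaleR transpose_mat)
  have r0: "min r1 d > 0" using r1 d by simp
  have le: "\<psi> z \<le> \<psi> x" if z: "z \<in> ball x (min r1 d)"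
    and s: "2 * d * ((- e) \<bullet> (z - x)) + ((z - x) \<bullet> ((2 *\<^sub>R mat 1) *v (z - x))) / 2 < 0" for z
  proof -
    have eq: "z - (x + d *\<^sub>R e) = (z - x) - d *\<^sub>R e" by simp
    have "(norm (w - d *\<^sub>R e))^2 = w \<bullet> w - 2 * d * (e \<bullet> w) + d^2" for w
      unfolding power2_norm_eq_inner
      by (simp add: inner_diff_left inner_diff_right ee inner_commute power2_eq_square algebra_simps)
    then have "(norm (z - (x + d *\<^sub>R e)))^2 < d^2" using s unfolding eq by (simp add: scaleR_matrix_vector_assoc[symmetric])
    then have "dist z (x + d *\<^sub>R e) < d" using d by (simp add: dist_norm power2_less_imp_less)
    then have "\<psi> z < c" using z r1 by (intro near) (auto simp: dist_commute)
    then show ?thesis using c by simp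
  qed
  obtain \<beta> where \<beta>: "\<beta> \<ge> 0" "D x = \<beta> *\<^sub>R (- e)" "F x (D x) (- e) \<le> \<beta> / (2 * d) * tangential_trace (- e) (2 *\<^sub>R mat 1)"
    by (rule touching_sublevel_set[OF op vb der cD x F _ _ Q refl r0 le, of "- e" "2 * d"]) (use e d that in auto)
  have b_pos: "\<beta> > 0" if "norm (D x) \<le> \<gamma>"
  proof (rule ccontr)
    assume "\<not> \<beta> > 0"
    then have "\<beta> = 0" using \<beta>(1) by simp
    moreover have "\<kappa> \<le> F x (D x) (- e)" using that e by (intro crit x) auto
    ultimately show False using \<beta>(3) \<kappa> by simp
  qed
  have "\<psi> x \<le> c"
  proof (rule tendsto_upperbound)
    have "((\<lambda>s. x + s *\<^sub>R e) \<longlongrightarrow> x + 0 *\<^sub>R e) (at_right 0)" by (intro tendsto_intros)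
    then have l: "((\<lambda>s. x + s *\<^sub>R e) \<longlongrightarrow> x) (at_right 0)" by simp
    have "isCont \<psi> x" by (rule has_derivative_continuous[OF der[OF x]])
    from isCont_tendsto_compose[OF this l]
    show "((\<lambda>s. \<psi> (x + s *\<^sub>R e)) \<longlongrightarrow> \<psi> x) (at_right 0)" .
    have "eventually (\<lambda>s. s < min r1 d) (at_right 0)"
      using eventually_at_right_real[of 0 "min r1 d"] r1 d by (auto elim!: eventually_mono)
    then show "eventually (\<lambda>s. \<psi> (x + s *\<^sub>R e) \<le> c) (at_right 0)"
      using eventually_at_right_less[of 0]
    proof eventually_elim
      case (elim s)
      have "x + s *\<^sub>R e - (x + d *\<^sub>R e) = (s - d) *\<^sub>R e" by (simp add: scaleR_diff_left)
      then have "dist (x + s *\<^sub>R e) (x + d *\<^sub>R e) = \<bar>s - d\<bar>" using e by (simp add: dist_norm)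
      then have "\<psi> (x + s *\<^sub>R e) < c" using elim r1 e by (intro near subsetD[OF r1(2)]) (auto simp: dist_norm)
      then show ?case by simp
    qed
  qed simp
  then show ?thesis using that[OF \<beta>(1) _ _ b_pos] \<beta>(2) c by simp
qed

text \<open>The height \<open>\<alpha>\<close> of the level set over the tangent plane is only quadratically large, because
  a ball touches the superlevel set from outside.\<close>

lemma level_height:
  fixes \<psi> :: "'a::euclidean_space \<Rightarrow> real"
  assumes der: "\<And>z. z \<in> ball x R \<Longrightarrow> (\<psi> has_derivative (\<lambda>h. D z \<bullet> h)) (at z)"
    and D: "\<And>z. z \<in> ball x R \<Longrightarrow> norm (D z - D x) \<le> \<omega>" and Dx: "D x = (- \<beta>) *\<^sub>R e"
    and \<beta>: "\<beta> > 0" "\<omega> \<le> \<beta>" and e: "norm e = 1" and d: "d > 0" and R: "R > 0" "R \<le> d" "4 * r \<le> R"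
    and c: "\<psi> x = c" and near: "\<And>z. z \<in> ball x R \<Longrightarrow> dist z (x + d *\<^sub>R e) < d \<Longrightarrow> \<psi> z < c"
    and z: "e \<bullet> z = 0" "norm z < r" and \<alpha>: "\<alpha> = (\<psi> (x + z) - c) / \<beta>"
  shows "\<bar>t\<bar> \<le> r \<Longrightarrow> x + z + t *\<^sub>R e \<in> ball x R"
    and "\<bar>t\<bar> \<le> r \<Longrightarrow> c + \<beta> * \<alpha> - \<beta> * t - \<omega> * \<bar>t\<bar> \<le> \<psi> (x + z + t *\<^sub>R e)"
    and "\<alpha> \<le> 2 * (norm z)^2 / d"
proof -
  define \<rho> where "\<rho> = norm z"
  have \<rho>: "0 \<le> \<rho>" "\<rho> < r" using z by (auto simp: \<rho>_def)
  have ee: "e \<bullet> e = 1" using e by (simp add: norm_eq_1)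
  have \<psi>x: "\<psi> (x + z) = c + \<beta> * \<alpha>" using \<beta> by (simp add: \<alpha>)
  have xt: "x + z + t *\<^sub>R e \<in> ball x R" if "\<bar>t\<bar> \<le> r" for t
  proof -
    have "norm (z + t *\<^sub>R e) < R"
      using norm_triangle_ineq[of z "t *\<^sub>R e"] that \<rho> e R by (simp add: \<rho>_def)
    then show ?thesis unfolding mem_ball add.assoc by (metis add_diff_cancel_left' dist_commute dist_norm)
  qed
  then show "\<bar>t\<bar> \<le> r \<Longrightarrow> x + z + t *\<^sub>R e \<in> ball x R" .
  have xz: "x + z \<in> ball x R" using xt[of 0] \<rho> by simp
  have lin: "c + \<beta> * \<alpha> - \<beta> * t - \<omega> * \<bar>t\<bar> \<le> \<psi> (x + z + t *\<^sub>R e)" if "\<bar>t\<bar> \<le> r" for t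
  proof -
    have "\<bar>\<psi> (x + z + t *\<^sub>R e) - \<psi> (x + z) - D x \<bullet> (x + z + t *\<^sub>R e - (x + z))\<bar> \<le> \<omega> * norm (x + z + t *\<^sub>R e - (x + z))"
      by (rule near_linear[OF der D xz xt[OF that]])
    then have "\<bar>\<psi> (x + z + t *\<^sub>R e) - (c + \<beta> * \<alpha>) + \<beta> * t\<bar> \<le> \<omega> * \<bar>t\<bar>"
      using e by (simp add: Dx ee \<psi>x mult.commute[of t])
    then show ?thesis by linarith
  qed
  then show "\<bar>t\<bar> \<le> r \<Longrightarrow> c + \<beta> * \<alpha> - \<beta> * t - \<omega> * \<bar>t\<bar> \<le> \<psi> (x + z + t *\<^sub>R e)" .
  have small: "\<alpha> \<le> \<rho>"
  proof -
    have "\<bar>\<psi> (x + z) - \<psi> x - D x \<bullet> (x + z - x)\<bar> \<le> \<omega> * norm (x + z - x)"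
      by (rule near_linear[OF der D _ xz]) (use R in auto)
    then have "\<beta> * \<alpha> \<le> \<omega> * \<rho>" by (simp add: Dx z \<psi>x c \<rho>_def)
    also have "\<dots> \<le> \<beta> * \<rho>" using \<beta> \<rho> by (intro mult_right_mono) auto
    finally show ?thesis using \<beta> by simp
  qed
  show "\<alpha> \<le> 2 * (norm z)^2 / d"
  proof (cases "\<alpha> \<le> 0")
    case True
    moreover have "0 \<le> 2 * (norm z)^2 / d" using d by simp
    ultimately show ?thesis by linarith
  next
    case False
    \<comment> \<open>At half the height the linear estimate still gives \<psi> \<ge> c, because
      \<omega> \<le> \<beta>. The point therefore lies outside the touching ball, and Pythagoras
      yields t d \<le> |z|^2.\<close>
    define t where "t = \<alpha> / 2"
    have t: "0 \<le> t" "\<bar>t\<bar> \<le> r" "t \<le> d" using False small \<rho> R by (auto simp: t_def)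
    have "\<omega> * \<bar>t\<bar> \<le> \<beta> * t" using t \<beta> by (simp add: mult_right_mono)
    moreover have "\<beta> * \<alpha> - \<beta> * t = \<beta> * t" by (simp add: t_def)
    ultimately have "c \<le> \<psi> (x + z + t *\<^sub>R e)" using lin[OF t(2)] by linarith
    then have "d \<le> dist (x + z + t *\<^sub>R e) (x + d *\<^sub>R e)"
      using near[OF xt[OF t(2)]] by force
    moreover have "x + z + t *\<^sub>R e - (x + d *\<^sub>R e) = z + (t - d) *\<^sub>R e" by (simp add: scaleR_diff_left)
    ultimately have "d \<le> norm (z + (t - d) *\<^sub>R e)" by (metis dist_norm)
    then have "d^2 \<le> (norm (z + (t - d) *\<^sub>R e))^2" using d by (intro power_mono) auto
    also have "\<dots> = (norm z)^2 + (t - d)^2"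
      unfolding power2_norm_eq_inner
      by (simp add: inner_add_left inner_add_right z ee inner_commute[of z e] power2_eq_square)
    finally have "2 * (t * d) \<le> (norm z)^2 + t * t" by (simp add: power2_eq_square algebra_simps)
    moreover have "t * t \<le> t * d" using t by (intro mult_left_mono) auto
    ultimately have "t * d \<le> (norm z)^2" by linarith
    then show ?thesis using d by (simp add: t_def pos_le_divide_eq)
  qed
qed

text \<open>The heights at \<open>x\<close> along e and at \<open>y\<close> along -e are strict
  subsolutions on the same hyperplane, so their sum exceeds its value 0 at the origin by more than 2
  \<eta> |z|^2 at some z. Slightly below these heights lie points P and P' with \<psi> \<ge> c, at
  distance less than d: this violates \<open>sep\<close>.\<close>

lemma no_interior_closest_pair:
  fixes \<psi> :: "real^'n \<Rightarrow> real"
  assumes op: "open \<Omega>" and vb: "viscosity_bound \<Omega> F \<psi>"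
    and der: "\<And>x. x \<in> \<Omega> \<Longrightarrow> (\<psi> has_derivative (\<lambda>h. D x \<bullet> h)) (at x)" and cD: "continuous_on \<Omega> D"
    and F: "\<And>x p \<nu>. isCont (\<lambda>t. F (fst t) (fst (snd t)) (snd (snd t))) (x, p, \<nu>)"
    and \<kappa>: "\<kappa> > 0" and crit: "\<And>x p \<nu>. x \<in> \<Omega> \<Longrightarrow> norm p \<le> \<gamma> \<Longrightarrow> norm \<nu> = 1 \<Longrightarrow> \<kappa> \<le> F x p \<nu>"
    and x: "x \<in> \<Omega>" and y: "y \<in> \<Omega>" and d: "d > 0" "dist x y = d" and c: "c \<le> \<psi> x" "c \<le> \<psi> y"
    and sep: "\<And>z z'. z \<in> \<Omega> \<Longrightarrow> z' \<in> \<Omega> \<Longrightarrow> dist z x < d \<Longrightarrow> dist z' y < d \<Longrightarrow> c \<le> \<psi> z \<Longrightarrow> c \<le> \<psi> z' \<Longrightarrow> d \<le> dist z z'"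
    and small: "norm (D x - D y) < \<gamma>"
  shows False
proof -
  define n where "n = real CARD('n)"
  have n: "n \<ge> 1" by (simp add: n_def Suc_leI)
  define e where "e = (y - x) /\<^sub>R d"
  have e: "norm e = 1" using d by (simp add: e_def dist_norm norm_minus_commute)
  have ee: "e \<bullet> e = 1" using e by (simp add: norm_eq_1)
  have yx: "y = x + d *\<^sub>R e" using d by (simp add: e_def)
  have near_x: "\<psi> z < c" if "z \<in> \<Omega>" "dist z x < d" "dist z y < d" for z
    using sep[OF that(1) y that(2)] c d that(3) by (auto simp: not_le[symmetric])
  have near_y: "\<psi> z < c" if "z \<in> \<Omega>" "dist z x < d" "dist z y < d" for z
    using sep[OF x that(1) _ that(3)] c d that(2) by (auto simp: not_le[symmetric] dist_commute)
  obtain \<beta> where \<beta>: "\<beta> \<ge> 0" "D x = (- \<beta>) *\<^sub>R e" and cx: "\<psi> x = c" and b_pos': "norm (D x) \<le> \<gamma> \<Longrightarrow> \<beta> > 0"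
    by (rule closest_point_gradient[OF op vb _ cD F \<kappa> _ x d(1) c(1) e])
      (erule der, erule (2) crit, erule (1) near_x, simp only: yx, rule that)
  have xy: "x = y + d *\<^sub>R (- e)" by (simp add: yx)
  obtain \<beta>' where \<beta>': "\<beta>' \<ge> 0" "D y = (- \<beta>') *\<^sub>R (- e)" and cy: "\<psi> y = c" and b'_pos': "norm (D y) \<le> \<gamma> \<Longrightarrow> \<beta>' > 0"
  proof (rule closest_point_gradient[where e = "- e" and \<gamma> = \<gamma>, OF op vb _ cD F \<kappa> _ y d(1) c(2)])
    show "\<psi> z < c" if "z \<in> \<Omega>" "dist z y < d" "dist z (y + d *\<^sub>R (- e)) < d" for z
      using that near_y unfolding xy[symmetric] by blast
  qed (erule der, erule (2) crit, simp add: e, rule that)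
  have "D x - D y = - ((\<beta> + \<beta>') *\<^sub>R e)" by (simp add: \<beta>(2) \<beta>'(2) scaleR_add_left)
  then have sum_small: "\<beta> + \<beta>' < \<gamma>" using small \<beta>(1) \<beta>'(1) e by simp
  have b_pos: "\<beta> > 0" by (rule b_pos') (use \<beta> \<beta>' sum_small e in simp)
  have b'_pos: "\<beta>' > 0" by (rule b'_pos') (use \<beta> \<beta>' sum_small e in simp)
  define b where "b = min \<beta> \<beta>'"
  have b: "b > 0" "b \<le> \<beta>" "b \<le> \<beta>'" using b_pos b'_pos by (auto simp: b_def)
  \<comment> \<open>Half of the strictness \<kappa> / max \<beta> \<beta>' is spent on the penalty;
    the other half remains as \<kappa>1.\<close>
  define \<eta> where "\<eta> = \<kappa> / (4 * n * max \<beta> \<beta>')"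
  have mb: "max \<beta> \<beta>' > 0" using b_pos by simp
  have \<eta>: "\<eta> > 0" using \<kappa> n mb by (simp add: \<eta>_def)
  define \<kappa>1 where "\<kappa>1 = \<kappa> / (2 * max \<beta> \<beta>')"
  have \<kappa>1: "\<kappa>1 > 0" using \<kappa> mb by (simp add: \<kappa>1_def)
  have "2 * \<eta> * (n - 1) \<le> 2 * \<eta> * n" using \<eta> by simp
  also have "\<dots> = \<kappa>1" using n mb by (simp add: \<eta>_def \<kappa>1_def)
  finally have \<eta>\<kappa>: "2 * \<eta> * (n - 1) \<le> \<kappa>1" .
  have \<kappa>\<beta>: "\<kappa> / t - 2 * \<eta> * (n - 1) \<ge> \<kappa>1" if "0 < t" "t \<le> max \<beta> \<beta>'" for t
  proof -
    have "\<kappa> / max \<beta> \<beta>' \<le> \<kappa> / t" using that \<kappa> by (intro divide_left_mono) auto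
    moreover have "\<kappa> / max \<beta> \<beta>' = 2 * \<kappa>1" by (simp add: \<kappa>1_def)
    ultimately show ?thesis using \<eta>\<kappa> by simp
  qed
  \<comment> \<open>K |z|^2 bounds the vertical displacements used for P and P': 2/d comes from
    \<open>level_height\<close>, \<eta>/2 from the lowering \<iota>.\<close>
  define K where "K = 2 / d + \<eta> / 2"
  have K: "K > 0" "\<eta> / 2 \<le> K" using d \<eta> by (auto simp: K_def add_pos_pos)
  \<comment> \<open>The first entry keeps nearby gradients below \<gamma>; the second keeps the
    linearisation error \<omega> K |z|^2 below b \<iota>, the gain from lowering.\<close>
  define \<omega> where "\<omega> = min (\<gamma> - (\<beta> + \<beta>')) (b * (\<eta> / 2) / K)"
  have \<omega>: "\<omega> > 0" "\<omega> \<le> \<gamma> - (\<beta> + \<beta>')" "\<omega> * K \<le> b * (\<eta> / 2)"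
  proof -
    show "\<omega> > 0" using sum_small b \<eta> K by (simp add: \<omega>_def)
    show "\<omega> \<le> \<gamma> - (\<beta> + \<beta>')" by (simp add: \<omega>_def)
    have "\<omega> \<le> b * (\<eta> / 2) / K" by (simp add: \<omega>_def)
    then show "\<omega> * K \<le> b * (\<eta> / 2)" using K by (simp add: pos_le_divide_eq)
  qed
  have \<omega>b: "\<omega> \<le> b"
  proof -
    have "\<omega> * K \<le> b * K" using \<omega>(3) mult_left_mono[OF K(2), of b] b by linarith
    then show ?thesis using K by simp
  qed
  have contD: "isCont D q" if "q \<in> \<Omega>" for q using cD op that by (simp add: continuous_on_eq_continuous_at)
  obtain r1 where r1: "r1 > 0" "ball x r1 \<subseteq> \<Omega>" using op x openE by blast
  obtain r2 where r2: "r2 > 0" "ball y r2 \<subseteq> \<Omega>" using op y openE by blast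
  obtain s1 where s1: "s1 > 0" "\<And>z. dist z x < s1 \<Longrightarrow> dist (D z) (D x) < \<omega>"
    using contD[OF x] \<omega>(1) unfolding continuous_at_eps_delta by blast
  obtain s2 where s2: "s2 > 0" "\<And>z. dist z y < s2 \<Longrightarrow> dist (D z) (D y) < \<omega>"
    using contD[OF y] \<omega>(1) unfolding continuous_at_eps_delta by blast
  define R where "R = min (min (min r1 r2) (min s1 s2)) d"
  have R: "R > 0" "R \<le> r1" "R \<le> r2" "R \<le> s1" "R \<le> s2" "R \<le> d" using r1 r2 s1 s2 d by (auto simp: R_def)
  have RO: "ball x R \<subseteq> \<Omega>" "ball y R \<subseteq> \<Omega>"
    using subset_trans[OF subset_ball[OF R(2)] r1(2)] subset_trans[OF subset_ball[OF R(3)] r2(2)] by auto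
  have Dx: "norm (D z - D x) \<le> \<omega>" if "z \<in> ball x R" for z
    using s1(2)[of z] that R by (simp add: dist_norm norm_minus_commute)
  have Dy: "norm (D z - D y) \<le> \<omega>" if "z \<in> ball y R" for z
    using s2(2)[of z] that R by (simp add: dist_norm norm_minus_commute)
  \<comment> \<open>r \<le> 1/K gives K |z|^2 \<le> |z| < r, so the displaced points stay where the
    linear estimate holds.\<close>
  define r where "r = min (R / 4) (1 / K)"
  have r: "r > 0" "4 * r \<le> R" "r * K \<le> 1"
  proof -
    show "r > 0" "4 * r \<le> R" using R K by (auto simp: r_def)
    have "r \<le> 1 / K" by (simp add: r_def)
    then show "r * K \<le> 1" using K by (simp add: pos_le_divide_eq)
  qed
  have rB: "ball x r \<subseteq> ball x R" "ball y r \<subseteq> ball y R" using r by (auto intro!: subset_ball)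
  have nDx: "norm (D z) \<le> \<gamma>" if "z \<in> ball x r" for z
    using Dx[OF subsetD[OF rB(1) that]] norm_triangle_sub[of "D z" "D x"] \<omega>(2) \<beta> \<beta>' e by simp
  have nDy: "norm (D z) \<le> \<gamma>" if "z \<in> ball y r" for z
    using Dy[OF subsetD[OF rB(2) that]] norm_triangle_sub[of "D z" "D y"] \<omega>(2) \<beta> \<beta>' e by simp
  define u where "u = (\<lambda>z. \<psi> (x + z) / \<beta> - \<eta> * (norm z)^2)"
  define v where "v = (\<lambda>z. \<psi> (y + z) / \<beta>' - \<eta> * (norm z)^2)"
  have weaken: "viscosity_bound X (\<lambda>_ _ _. \<kappa>1) w" if "viscosity_bound X (\<lambda>_ _ _. k) w" "\<kappa>1 \<le> k" for X w k
    using that unfolding viscosity_bound_def by (meson order_trans)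
  have vbu: "viscosity_bound (ball 0 r) (\<lambda>_ _ _. \<kappa>1) u"
    unfolding u_def
    by (rule weaken[OF viscosity_bound_rescale[OF vb der crit subset_trans[OF rB(1) RO(1)] nDx b_pos]])
      (use \<kappa>\<beta>[of \<beta>] b_pos in \<open>auto simp: n_def\<close>)
  have vbv: "viscosity_bound (ball 0 r) (\<lambda>_ _ _. \<kappa>1) v"
    unfolding v_def
    by (rule weaken[OF viscosity_bound_rescale[OF vb der crit subset_trans[OF rB(2) RO(2)] nDy b'_pos]])
      (use \<kappa>\<beta>[of \<beta>'] b'_pos in \<open>auto simp: n_def\<close>)
  have cont\<psi>: "continuous_on \<Omega> \<psi>"
    by (intro continuous_at_imp_continuous_on ballI has_derivative_continuous[OF der])
  have shift: "continuous_on (ball 0 r) (\<lambda>z. \<psi> (q + z))" if "ball q r \<subseteq> \<Omega>" for q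
  proof (rule continuous_on_compose2[OF cont\<psi>])
    show "(+) q ` ball 0 r \<subseteq> \<Omega>" using that by (auto simp: subset_iff dist_norm)
  qed (intro continuous_intros)
  have contu: "continuous_on (ball 0 r) u" unfolding u_def
    using b_pos by (intro continuous_intros shift subset_trans[OF rB(1) RO(1)]) auto
  have contv: "continuous_on (ball 0 r) v" unfolding v_def
    using b'_pos by (intro continuous_intros shift subset_trans[OF rB(2) RO(2)]) auto
  obtain z where z: "z \<in> ball 0 r" "z \<bullet> e = 0" "u 0 + v 0 < u z + v z"
    using subsolutions_sum_no_local_max[OF e r(1) \<kappa>1 vbu vbv contu contv] by blast
  define \<rho> where "\<rho> = norm z"
  have \<rho>r: "\<rho> < r" using z by (simp add: \<rho>_def)
  have ez: "e \<bullet> z = 0" using z(2) by (simp add: inner_commute)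
  have "z \<noteq> 0" using z(3) by auto
  then have \<rho>: "\<rho> > 0" by (simp add: \<rho>_def)
  \<comment> \<open>First-order heights of {\<psi> = c} above x + z along e and above y + z along
    -e.\<close>
  define \<alpha> where "\<alpha> = (\<psi> (x + z) - c) / \<beta>"
  define \<alpha>' where "\<alpha>' = (\<psi> (y + z) - c) / \<beta>'"
  have sum_gt: "\<alpha> + \<alpha>' > 2 * \<eta> * \<rho>^2"
    using z(3) by (simp add: u_def v_def \<alpha>_def \<alpha>'_def \<rho>_def cx cy diff_divide_distrib)
  have near_xB: "\<psi> w < c" if "w \<in> ball x R" "dist w (x + d *\<^sub>R e) < d" for w
    using that RO R unfolding yx[symmetric] by (intro near_x) (auto simp: dist_commute)
  have near_yB: "\<psi> w < c" if "w \<in> ball y R" "dist w (y + d *\<^sub>R (- e)) < d" for w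
    using that RO R unfolding xy[symmetric] by (intro near_y) (auto simp: dist_commute)
  have \<omega>\<beta>: "\<omega> \<le> \<beta>" "\<omega> \<le> \<beta>'" and e': "norm (- e) = 1" and ez': "(- e) \<bullet> z = 0" using \<omega>b b e ez by auto
  have level_x: "x + z + t *\<^sub>R e \<in> ball x R"
    "c + \<beta> * \<alpha> - \<beta> * t - \<omega> * \<bar>t\<bar> \<le> \<psi> (x + z + t *\<^sub>R e)" if "\<bar>t\<bar> \<le> r" for t
    by (rule level_height(1,2)[OF der[OF subsetD[OF RO(1)]] Dx \<beta>(2) b_pos \<omega>\<beta>(1) e d(1) R(1,6) r(2) cx near_xB ez \<rho>r[unfolded \<rho>_def] \<alpha>_def]; use that in simp)+
  have level_y: "y + z + t *\<^sub>R (- e) \<in> ball y R"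
    "c + \<beta>' * \<alpha>' - \<beta>' * t - \<omega> * \<bar>t\<bar> \<le> \<psi> (y + z + t *\<^sub>R (- e))" if "\<bar>t\<bar> \<le> r" for t
    by (rule level_height(1,2)[OF der[OF subsetD[OF RO(2)]] Dy \<beta>'(2) b'_pos \<omega>\<beta>(2) e' d(1) R(1,6) r(2) cy near_yB ez' \<rho>r[unfolded \<rho>_def] \<alpha>'_def]; use that in simp)+
  have quad_a: "\<alpha> \<le> 2 * \<rho>^2 / d" "\<alpha>' \<le> 2 * \<rho>^2 / d"
    unfolding \<rho>_def
    by (rule level_height(3)[OF der[OF subsetD[OF RO(1)]] Dx \<beta>(2) b_pos \<omega>\<beta>(1) e d(1) R(1,6) r(2) cx near_xB ez \<rho>r[unfolded \<rho>_def] \<alpha>_def]; simp) (rule level_height(3)[OF der[OF subsetD[OF RO(2)]] Dy \<beta>'(2) b'_pos \<omega>\<beta>(2) e' d(1) R(1,6) r(2) cy near_yB ez' \<rho>r[unfolded \<rho>_def] \<alpha>'_def]; simp)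
  \<comment> \<open>Each height is lowered by this amount to pay for the linearisation error; 2
    \<iota> = \<eta> |z|^2 is only half of the excess in \<open>sum_gt\<close>.\<close>
  define \<iota> where "\<iota> = \<eta> / 2 * \<rho>^2"
  have \<eta>\<rho>: "\<eta> * \<rho>^2 > 0" using \<eta> \<rho> by simp
  have \<iota>0: "\<iota> > 0" using \<eta>\<rho> by (simp add: \<iota>_def)
  have K\<rho>: "K * \<rho>^2 = 2 * \<rho>^2 / d + \<iota>" by (simp add: K_def \<iota>_def distrib_right)
  have abs_t: "\<bar>s - \<iota>\<bar> \<le> K * \<rho>^2" if "s \<le> 2 * \<rho>^2 / d" "- (2 * \<rho>^2 / d) \<le> s" for s
    unfolding K\<rho> using that \<iota>0 by linarith
  have "K * \<rho>^2 \<le> r"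
  proof -
    have "K * \<rho>^2 = (K * \<rho>) * \<rho>" by (simp add: power2_eq_square)
    also have "\<dots> \<le> (r * K) * \<rho>" using \<rho>r \<rho> K by (intro mult_right_mono) (auto simp: mult.commute)
    also have "\<dots> \<le> 1 * \<rho>" using r \<rho> by (intro mult_right_mono) auto
    finally show ?thesis using \<rho>r by simp
  qed
  \<comment> \<open>The lower bound on each height follows from the upper bound on the other and the
    positive sum.\<close>
  moreover have "\<bar>\<alpha> - \<iota>\<bar> \<le> K * \<rho>^2" "\<bar>\<alpha>' - \<iota>\<bar> \<le> K * \<rho>^2"
    using quad_a sum_gt \<eta>\<rho> by (intro abs_t; linarith)+
  ultimately have ta: "\<bar>\<alpha> - \<iota>\<bar> \<le> r" "\<bar>\<alpha>' - \<iota>\<bar> \<le> r" "\<bar>\<alpha> - \<iota>\<bar> \<le> K * \<rho>^2" "\<bar>\<alpha>' - \<iota>\<bar> \<le> K * \<rho>^2"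
    by linarith+
  have \<omega>t: "\<omega> * \<bar>s\<bar> \<le> t * \<iota>" if "\<bar>s\<bar> \<le> K * \<rho>^2" "b \<le> t" for s t
  proof -
    have "\<omega> * \<bar>s\<bar> \<le> \<omega> * (K * \<rho>^2)" using that \<omega> by (intro mult_left_mono) auto
    also have "\<dots> = (\<omega> * K) * \<rho>^2" by simp
    also have "\<dots> \<le> (b * (\<eta> / 2)) * \<rho>^2" by (intro mult_right_mono \<omega>) simp
    also have "\<dots> = b * \<iota>" by (simp add: \<iota>_def)
    also have "\<dots> \<le> t * \<iota>" using that \<iota>0 by (intro mult_right_mono) auto
    finally show ?thesis .
  qed
  define P where "P = x + z + (\<alpha> - \<iota>) *\<^sub>R e"
  define P' where "P' = y + z + (\<alpha>' - \<iota>) *\<^sub>R (- e)"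
  have "\<psi> P \<ge> c"
    using level_x(2)[OF ta(1)] \<omega>t[OF ta(3) b(2)] by (simp add: P_def right_diff_distrib)
  moreover have "\<psi> P' \<ge> c"
    using level_y(2)[OF ta(2)] \<omega>t[OF ta(4) b(3)] by (simp add: P'_def right_diff_distrib)
  moreover have "P \<in> ball x R" unfolding P_def by (rule level_x(1)[OF ta(1)])
  moreover have "P' \<in> ball y R" unfolding P'_def by (rule level_y(1)[OF ta(2)])
  ultimately have "d \<le> dist P P'"
    using RO R by (intro sep) (auto simp: dist_commute)
  moreover have "P - P' = ((\<alpha> - \<iota>) + (\<alpha>' - \<iota>) - d) *\<^sub>R e"
    unfolding P_def P'_def yx by (simp only: scaleR_add_left scaleR_diff_left scaleR_minus_left) simp
  then have "dist P P' = \<bar>(\<alpha> - \<iota>) + (\<alpha>' - \<iota>) - d\<bar>" using e by (simp add: dist_norm)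
  moreover have "\<alpha> + \<alpha>' - 2 * \<iota> > 0" using sum_gt \<eta>\<rho> by (simp add: \<iota>_def)
  moreover have "\<alpha> + \<alpha>' - 2 * \<iota> < d" using ta(1,2) r R by linarith
  ultimately show False by linarith
qed

section \<open>Mean curvature and closest pairs at the boundary\<close>

lemma has_derivative_gradient:
  fixes f :: "real^'n \<Rightarrow> real"
  assumes "f differentiable (at x)"
  shows "(f has_derivative (\<lambda>h. gradient f x \<bullet> h)) (at x)"
proof -
  define f' where "f' = frechet_derivative f (at x)"
  have d: "(f has_derivative f') (at x)"
    using assms unfolding f'_def by (simp add: frechet_derivative_works)
  then have lin: "linear f'" by (rule has_derivative_linear)
  have "f' h = gradient f x \<bullet> h" for h
  proof -
    have "f' h = f' (\<Sum>i\<in>UNIV. h $ i *\<^sub>R axis i 1)"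
      using basis_expansion[of h] by (simp add: scalar_mult_eq_scaleR)
    also have "\<dots> = (\<Sum>i\<in>UNIV. h $ i * f' (axis i 1))"
      by (simp add: linear_sum[OF lin] linear_scale[OF lin])
    also have "\<dots> = gradient f x \<bullet> h"
      by (simp add: gradient_def inner_vec_def f'_def mult.commute)
    finally show ?thesis .
  qed
  then have "f' = (\<lambda>h. gradient f x \<bullet> h)" by auto
  with d show ?thesis by simp
qed

lemma Ck_on_2_gradient:
  fixes f :: "real^'n \<Rightarrow> real"
  assumes ck: "Ck_on 2 f U" and U: "open U" "x \<in> U"
  shows "(f has_derivative (\<lambda>h. gradient f x \<bullet> h)) (at x)"
    and "\<exists>A. (gradient f has_derivative (\<lambda>h. A *v h)) (at x)"
proof -
  have diff: "\<And>z. z \<in> U \<Longrightarrow> f differentiable (at z)"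
    and diff': "\<And>z v. z \<in> U \<Longrightarrow> (\<lambda>z. frechet_derivative f (at z) v) differentiable (at z)"
    using ck by (auto simp: numeral_2_eq_2)
  show "(f has_derivative (\<lambda>h. gradient f x \<bullet> h)) (at x)"
    using has_derivative_gradient diff U by blast
  have "(\<lambda>z. gradient f z \<bullet> v) differentiable (at x)" for v
  proof -
    obtain L where L: "((\<lambda>z. frechet_derivative f (at z) v) has_derivative L) (at x)"
      using diff'[OF U(2), of v] by (auto simp: differentiable_def)
    have "frechet_derivative f (at z) v = gradient f z \<bullet> v" if "z \<in> U" for z
      using has_derivative_gradient[OF diff[OF that]] by (metis frechet_derivative_at)
    then have "((\<lambda>z. gradient f z \<bullet> v) has_derivative L) (at x)"
      using has_derivative_transform_within_open[OF L U] by auto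
    then show ?thesis by (rule differentiableI)
  qed
  then have "gradient f differentiable (at x)"
    by (subst differentiable_componentwise_within) auto
  then obtain L where L: "(gradient f has_derivative L) (at x)" by (auto simp: differentiable_def)
  then have "linear L" by (rule has_derivative_linear)
  then have "L = (\<lambda>h. matrix L *v h)" by (simp add: matrix_works fun_eq_iff)
  with L show "\<exists>A. (gradient f has_derivative (\<lambda>h. A *v h)) (at x)" by metis
qed

lemma second_order_expansion:
  fixes f :: "real^'n \<Rightarrow> real"
  assumes U: "open U" "p \<in> U" and f: "\<And>z. z \<in> U \<Longrightarrow> (f has_derivative (\<lambda>h. g z \<bullet> h)) (at z)"
    and g: "(g has_derivative (\<lambda>h. A *v h)) (at p)" and d: "d > 0"
  shows "\<exists>r>0. \<forall>h. norm h < r \<longrightarrow> \<bar>f (p + h) - f p - g p \<bullet> h - (h \<bullet> (A *v h)) / 2\<bar> \<le> d * (norm h)^2"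
proof -
  obtain r0 where r0: "r0 > 0" "ball p r0 \<subseteq> U" using U openE by blast
  obtain r1 where r1: "r1 > 0" "\<And>z. norm (z - p) < r1 \<Longrightarrow> norm (g z - g p - A *v (z - p)) \<le> d * norm (z - p)"
    using g d unfolding has_derivative_at_alt by blast
  have "\<bar>f (p + h) - f p - g p \<bullet> h - (h \<bullet> (A *v h)) / 2\<bar> \<le> d * (norm h)^2"
    if h: "norm h < min r0 r1" for h
  proof -
    have small: "norm (s *\<^sub>R h) < min r0 r1" "norm (s *\<^sub>R h) \<le> norm h" if "0 \<le> s" "s \<le> 1" for s
    proof -
      have "norm (s *\<^sub>R h) \<le> 1 * norm h"
        using that mult_right_mono[OF that(2) norm_ge_zero[of h]] by simp
      then show "norm (s *\<^sub>R h) < min r0 r1" "norm (s *\<^sub>R h) \<le> norm h" using h by auto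
    qed
    have line: "((\<lambda>s. p + s *\<^sub>R h) has_derivative (\<lambda>t. t *\<^sub>R h)) (at s)" for s
      by (auto intro!: derivative_eq_intros)
    have "((\<lambda>s. f (p + s *\<^sub>R h) - s * (g p \<bullet> h) - s^2 * ((h \<bullet> (A *v h)) / 2)) has_real_derivative
        (g (p + s *\<^sub>R h) \<bullet> h - g p \<bullet> h - s * (h \<bullet> (A *v h)))) (at s)" if s: "0 \<le> s" "s \<le> 1" for s
    proof -
      have "p + s *\<^sub>R h \<in> U" using small(1)[OF s] by (intro subsetD[OF r0(2)]) (simp add: dist_norm)
      then have "((\<lambda>s. f (p + s *\<^sub>R h)) has_derivative (\<lambda>t. g (p + s *\<^sub>R h) \<bullet> (t *\<^sub>R h))) (at s)"
        by (rule has_derivative_compose[OF line f])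
      then have "((\<lambda>s. f (p + s *\<^sub>R h)) has_real_derivative (g (p + s *\<^sub>R h) \<bullet> h)) (at s)"
        by (simp add: has_field_derivative_def mult_commute_abs)
      then show ?thesis by (auto intro!: derivative_eq_intros)
    qed
    from MVT2[OF zero_less_one this]
    obtain s where s: "0 < s" "s < 1"
      "(f (p + 1 *\<^sub>R h) - 1 * (g p \<bullet> h) - 1^2 * ((h \<bullet> (A *v h)) / 2))
        - (f (p + 0 *\<^sub>R h) - 0 * (g p \<bullet> h) - 0^2 * ((h \<bullet> (A *v h)) / 2))
       = (1 - 0) * (g (p + s *\<^sub>R h) \<bullet> h - g p \<bullet> h - s * (h \<bullet> (A *v h)))" by blast
    have "f (p + h) - f p - g p \<bullet> h - (h \<bullet> (A *v h)) / 2 = (g (p + s *\<^sub>R h) - g p - A *v (s *\<^sub>R h)) \<bullet> h"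
    proof -
      have "(g (p + s *\<^sub>R h) - g p - A *v (s *\<^sub>R h)) \<bullet> h = g (p + s *\<^sub>R h) \<bullet> h - g p \<bullet> h - s * (h \<bullet> (A *v h))"
        by (simp add: inner_diff_left matrix_vector_mult_scaleR inner_commute[of "A *v h" h])
      then show ?thesis using s(3) by simp
    qed
    then have "\<bar>f (p + h) - f p - g p \<bullet> h - (h \<bullet> (A *v h)) / 2\<bar> \<le> norm (g (p + s *\<^sub>R h) - g p - A *v (s *\<^sub>R h)) * norm h"
      by (simp add: Cauchy_Schwarz_ineq2)
    also have "\<dots> \<le> (d * norm h) * norm h"
    proof (rule mult_right_mono)
      have "norm (g (p + s *\<^sub>R h) - g p - A *v (s *\<^sub>R h)) \<le> d * norm (s *\<^sub>R h)"
        using r1(2)[of "p + s *\<^sub>R h"] small(1)[of s] s by simp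
      also have "\<dots> \<le> d * norm h" using small(2)[of s] s d by (intro mult_left_mono) auto
      finally show "norm (g (p + s *\<^sub>R h) - g p - A *v (s *\<^sub>R h)) \<le> d * norm h" .
    qed simp
    finally show ?thesis by (simp add: power2_eq_square)
  qed
  then show ?thesis using r0 r1 by (intro exI[of _ "min r0 r1"]) auto
qed

lemma directional_sign:
  assumes f: "(f has_derivative (\<lambda>h. g \<bullet> h)) (at (p::'a::real_inner))" and p: "f p = (0::real)" and v: "g \<bullet> v > 0"
  shows "eventually (\<lambda>s. f (p + s *\<^sub>R v) > 0) (at_right 0)"
proof -
  have "((\<lambda>s. p + s *\<^sub>R v) has_derivative (\<lambda>t. t *\<^sub>R v)) (at 0)" by (auto intro!: derivative_eq_intros)
  then have "((\<lambda>s. f (p + s *\<^sub>R v)) has_derivative (\<lambda>t. g \<bullet> (t *\<^sub>R v))) (at 0)"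
    by (rule has_derivative_compose) (simp add: f)
  then have "((\<lambda>s. f (p + s *\<^sub>R v)) has_real_derivative (g \<bullet> v)) (at 0)"
    by (simp add: has_field_derivative_def mult_commute_abs)
  from DERIV_pos_inc_right[OF this v] obtain d where "d > 0" "\<And>h. 0 < h \<Longrightarrow> h < d \<Longrightarrow> f (p + h *\<^sub>R v) > 0"
    using p by auto
  then show ?thesis by (auto simp: eventually_at_right_field)
qed

section \<open>Defining functions, normals and curvature of the boundary\<close>

lemma local_defining_funD:
  assumes "local_defining_fun \<Omega> p U \<rho>"
  shows "open U" "p \<in> U" "\<And>x. x \<in> U \<Longrightarrow> gradient \<rho> x \<noteq> 0" "\<And>x. x \<in> U \<Longrightarrow> x \<in> \<Omega> \<longleftrightarrow> \<rho> x > 0"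
    "\<And>x. x \<in> U \<Longrightarrow> x \<in> frontier \<Omega> \<longleftrightarrow> \<rho> x = 0"
    "\<And>x. x \<in> U \<Longrightarrow> (\<rho> has_derivative (\<lambda>h. gradient \<rho> x \<bullet> h)) (at x)"
    "\<And>x. x \<in> U \<Longrightarrow> \<exists>A. (gradient \<rho> has_derivative (\<lambda>h. A *v h)) (at x)"
proof -
  show o: "open U" "p \<in> U" "\<And>x. x \<in> U \<Longrightarrow> gradient \<rho> x \<noteq> 0" using assms by (auto simp: local_defining_fun_def)
  show "\<And>x. x \<in> U \<Longrightarrow> x \<in> \<Omega> \<longleftrightarrow> \<rho> x > 0" "\<And>x. x \<in> U \<Longrightarrow> x \<in> frontier \<Omega> \<longleftrightarrow> \<rho> x = 0"
    using assms unfolding local_defining_fun_def by blast+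
  have "Ck_on 2 \<rho> U" using assms by (auto simp: local_defining_fun_def smooth_fun_on_def)
  from Ck_on_2_gradient[OF this o(1)]
  show "\<And>x. x \<in> U \<Longrightarrow> (\<rho> has_derivative (\<lambda>h. gradient \<rho> x \<bullet> h)) (at x)"
    "\<And>x. x \<in> U \<Longrightarrow> \<exists>A. (gradient \<rho> has_derivative (\<lambda>h. A *v h)) (at x)" by blast+
qed

text \<open>Along a direction of increase of \<rho> one enters \<Omega>, so no other defining
  function can decrease to first order there. Hence the gradients of two defining functions are
  positive multiples of each other, and the definite description is justified.\<close>

lemma inner_normal_eq:
  assumes p: "p \<in> frontier \<Omega>" and L: "local_defining_fun \<Omega> p U \<rho>"
  shows "inner_normal \<Omega> p = gradient \<rho> p /\<^sub>R norm (gradient \<rho> p)"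
  unfolding inner_normal_def
proof (rule the_equality)
  show "\<exists>U \<rho>'. local_defining_fun \<Omega> p U \<rho>' \<and> gradient \<rho> p /\<^sub>R norm (gradient \<rho> p) = gradient \<rho>' p /\<^sub>R norm (gradient \<rho>' p)"
    using L by blast
next
  fix \<nu> assume "\<exists>U \<rho>. local_defining_fun \<Omega> p U \<rho> \<and> \<nu> = gradient \<rho> p /\<^sub>R norm (gradient \<rho> p)"
  then obtain V \<tau> where M: "local_defining_fun \<Omega> p V \<tau>" and \<nu>: "\<nu> = gradient \<tau> p /\<^sub>R norm (gradient \<tau> p)" by blast
  note L = local_defining_funD[OF L] and M = local_defining_funD[OF M]
  define e where "e = gradient \<rho> p /\<^sub>R norm (gradient \<rho> p)"
  have g0: "norm (gradient \<rho> p) > 0" using L(3)[OF L(2)] by simp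
  have e: "norm e = 1" using g0 by (simp add: e_def)
  have half: "gradient \<tau> p \<bullet> v \<ge> 0" if v: "e \<bullet> v > 0" for v
  proof (rule ccontr)
    assume "\<not> gradient \<tau> p \<bullet> v \<ge> 0"
    then have neg: "(- gradient \<tau> p) \<bullet> v > 0" by simp
    have "gradient \<rho> p \<bullet> v > 0" using v g0 by (simp add: e_def zero_less_mult_iff)
    then have 1: "eventually (\<lambda>s. \<rho> (p + s *\<^sub>R v) > 0) (at_right 0)"
      using directional_sign[OF L(6)[OF L(2)]] L(5)[OF L(2)] p by blast
    have "((\<lambda>x. - \<tau> x) has_derivative (\<lambda>h. (- gradient \<tau> p) \<bullet> h)) (at p)"
      using has_derivative_minus[OF M(6)[OF M(2)]] by simp
    then have 2: "eventually (\<lambda>s. - \<tau> (p + s *\<^sub>R v) > 0) (at_right 0)"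
      by (rule directional_sign) (use neg M(5)[OF M(2)] p in simp_all)
    have "((\<lambda>s. p + s *\<^sub>R v) \<longlongrightarrow> p + 0 *\<^sub>R v) (at_right 0)" by (intro tendsto_intros)
    then have "eventually (\<lambda>s. p + s *\<^sub>R v \<in> U \<inter> V) (at_right 0)"
      using L(1,2) M(1,2) by (intro topological_tendstoD) auto
    with 1 2 have "eventually (\<lambda>s. False) (at_right (0::real))"
      by eventually_elim (use L(4) M(4) in force)
    then show False by simp
  qed
  have "gradient \<tau> p = (gradient \<tau> p \<bullet> e) *\<^sub>R e" and "gradient \<tau> p \<bullet> e \<ge> 0"
    using half_space_inner_nonneg[OF e half] by blast+
  moreover have "gradient \<tau> p \<noteq> 0" using M by blast
  ultimately obtain k where "gradient \<tau> p = k *\<^sub>R e" "k > 0" by (metis less_eq_real_def scaleR_zero_left)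
  then show "\<nu> = gradient \<rho> p /\<^sub>R norm (gradient \<rho> p)" using e by (simp add: \<nu> e_def[symmetric])
qed

lemma local_defining_fun_move:
  "local_defining_fun \<Omega> p U \<rho> \<Longrightarrow> q \<in> U \<Longrightarrow> local_defining_fun \<Omega> q U \<rho>"
  by (simp add: local_defining_fun_def)

text \<open>A derivative within the boundary determines its values on tangent vectors, because every
  tangent vector is approximated to first order by secants of the boundary.\<close>

lemma boundary_secants:
  assumes p: "p \<in> frontier \<Omega>" and L: "local_defining_fun \<Omega> p U \<rho>" and X: "gradient \<rho> p \<bullet> X = 0" and d: "d > 0"
  shows "eventually (\<lambda>s. \<exists>z\<in>frontier \<Omega>. norm (z - p - s *\<^sub>R X) \<le> d * s) (at_right 0)"
proof -
  note L = local_defining_funD[OF L]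
  define N where "N = gradient \<rho> p"
  \<comment> \<open>A normal vector of length d: for small s, \<rho> has opposite signs at p + s (X
    + e) and p + s (X - e), so it vanishes in between, within d s of p + s X.\<close>
  define e where "e = (d / norm N) *\<^sub>R N"
  have N0: "norm N > 0" using L(3)[OF L(2)] by (simp add: N_def)
  have ne: "norm e = d" using N0 d by (simp add: e_def)
  have \<rho>p: "\<rho> p = 0" using L(5)[OF L(2)] p by simp
  have NN: "N \<bullet> e > 0" using N0 d by (simp add: e_def)
  have pos: "eventually (\<lambda>s. \<rho> (p + s *\<^sub>R (X + e)) > 0) (at_right 0)"
    by (rule directional_sign[OF L(6)[OF L(2)] \<rho>p]) (use X NN in \<open>simp add: inner_add_right N_def\<close>)
  have "((\<lambda>x. - \<rho> x) has_derivative (\<lambda>h. (- gradient \<rho> p) \<bullet> h)) (at p)"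
    using has_derivative_minus[OF L(6)[OF L(2)]] by simp
  then have neg: "eventually (\<lambda>s. - \<rho> (p + s *\<^sub>R (X - e)) > 0) (at_right 0)"
    by (rule directional_sign) (use X NN \<rho>p in \<open>simp_all add: inner_diff_right N_def\<close>)
  obtain r where r: "r > 0" "ball p r \<subseteq> U" using L(1,2) openE by blast
  define s0 where "s0 = r / (norm X + d + 1)"
  have s0: "s0 > 0" using r d by (simp add: s0_def add_pos_pos add_nonneg_pos)
  have "eventually (\<lambda>s. s < s0) (at_right 0)"
    using eventually_at_right_real[OF s0] by (auto elim!: eventually_mono)
  with pos neg show ?thesis
    using eventually_at_right_less[of 0]
  proof eventually_elim
    case (elim s)
    have inU: "p + s *\<^sub>R (X + t *\<^sub>R e) \<in> U" if t: "\<bar>t\<bar> \<le> 1" for t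
    proof -
      have "norm (X + t *\<^sub>R e) \<le> norm X + \<bar>t\<bar> * d" using norm_triangle_ineq[of X "t *\<^sub>R e"] ne by simp
      also have "\<dots> \<le> norm X + d + 1" using mult_right_mono[OF t less_imp_le[OF d]] by simp
      finally have "s * norm (X + t *\<^sub>R e) \<le> s * (norm X + d + 1)" using elim by (intro mult_left_mono) auto
      also have "\<dots> < s0 * (norm X + d + 1)" using elim d by (intro mult_strict_right_mono) (auto simp: add_nonneg_pos)
      also have "\<dots> = r"
      proof -
        have "norm X + d + 1 \<noteq> 0" using d norm_ge_zero[of X] by linarith
        then show ?thesis by (simp add: s0_def)
      qed
      finally show ?thesis using elim by (intro subsetD[OF r(2)]) (simp add: dist_norm)
    qed
    define f where "f = (\<lambda>t. \<rho> (p + s *\<^sub>R (X + t *\<^sub>R e)))"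
    have "continuous_on {-1..1} f"
      unfolding f_def
    proof (rule continuous_on_compose2[of U \<rho>])
      show "continuous_on U \<rho>"
        by (intro continuous_at_imp_continuous_on ballI has_derivative_continuous[OF L(6)])
    qed (use inU in \<open>auto intro!: continuous_intros\<close>)
    moreover have "f (-1) \<le> 0" "0 \<le> f 1" using elim by (auto simp: f_def)
    ultimately obtain t where t: "-1 \<le> t" "t \<le> 1" "f t = 0" using IVT'[of f "-1" 0 1] by auto
    define z where "z = p + s *\<^sub>R (X + t *\<^sub>R e)"
    have "z \<in> frontier \<Omega>" using L(5)[of z] inU[of t] t by (simp add: z_def f_def)
    moreover have "norm (z - p - s *\<^sub>R X) \<le> d * s"
    proof -
      have "z - p - s *\<^sub>R X = (s * t) *\<^sub>R e" by (simp add: z_def scaleR_add_right)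
      then have "norm (z - p - s *\<^sub>R X) = s * \<bar>t\<bar> * d" using ne elim by (simp add: abs_mult)
      also have "\<dots> \<le> s * 1 * d" using t elim d by (intro mult_right_mono mult_left_mono) auto
      finally show ?thesis by (simp add: mult.commute)
    qed
    ultimately show ?case by blast
  qed
qed

text \<open>The difference E of the derivatives is a derivative of zero, hence small of higher order
  on secants. These differ from s X by at most d s, so linearity and boundedness of E give |E X|
  \<le> t for every t > 0.\<close>

lemma derivative_within_boundary_unique:
  fixes f :: "real^'n \<Rightarrow> real^'n"
  assumes p: "p \<in> frontier \<Omega>" and L: "local_defining_fun \<Omega> p U \<rho>" and X: "gradient \<rho> p \<bullet> X = 0"
    and D: "(f has_derivative D) (at p within frontier \<Omega>)" "(f has_derivative D') (at p within frontier \<Omega>)"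
  shows "D X = D' X"
proof -
  define E where "E = (\<lambda>h. D h - D' h)"
  have E: "((\<lambda>x. f x - f x) has_derivative E) (at p within frontier \<Omega>)"
    unfolding E_def by (intro has_derivative_diff D)
  then have bl: "bounded_linear E" by (rule has_derivative_bounded_linear)
  then have lin: "linear E" by (rule bounded_linear.linear)
  obtain K where K: "K > 0" "\<And>h. norm (E h) \<le> norm h * K"
    using bounded_linear.pos_bounded[OF bl] by blast
  have "norm (E X) \<le> 0 + t" if t: "t > 0" for t
  proof -
    define d where "d = min 1 (t / (2 * K))"
    have d: "d > 0" "d \<le> 1" "d * K \<le> t / 2"
      using t K by (auto simp: d_def min_def field_simps)
    define \<epsilon> where "\<epsilon> = t / (2 * (norm X + 1))"
    have nX: "norm X + 1 > 0" by (simp add: add_nonneg_pos)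
    have \<epsilon>: "\<epsilon> > 0" "\<epsilon> * (norm X + 1) = t / 2" using t nX by (auto simp: \<epsilon>_def field_simps)
    obtain r where r: "r > 0" "\<And>z. z \<in> frontier \<Omega> \<Longrightarrow> norm (z - p) < r \<Longrightarrow> norm (E (z - p)) \<le> \<epsilon> * norm (z - p)"
      using E \<epsilon>(1) unfolding has_derivative_within_alt by auto
    have s0: "r / (norm X + 1) > 0" using r nX by simp
    have "eventually (\<lambda>s. s < r / (norm X + 1)) (at_right 0)"
      using eventually_at_right_real[OF s0] by (auto elim!: eventually_mono)
    then have "eventually (\<lambda>s. norm (E X) \<le> 0 + t) (at_right (0::real))"
      using boundary_secants[OF p L X d(1)] eventually_at_right_less[of 0]
    proof eventually_elim
      case (elim s)
      then obtain z where z: "z \<in> frontier \<Omega>" "norm (z - p - s *\<^sub>R X) \<le> d * s" by blast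
      have sp: "s > 0" using elim by simp
      have "norm (z - p) \<le> norm (z - p - s *\<^sub>R X) + norm (s *\<^sub>R X)"
        by (metis diff_add_cancel norm_triangle_ineq)
      also have "\<dots> \<le> 1 * s + s * norm X"
      proof (rule add_mono)
        show "norm (z - p - s *\<^sub>R X) \<le> 1 * s"
          using z(2) mult_right_mono[OF d(2) less_imp_le[OF sp]] by linarith
      qed (use sp in simp)
      finally have zp: "norm (z - p) \<le> s * (norm X + 1)" by (simp add: distrib_left)
      also have "\<dots> < r" using elim nX by (simp add: pos_less_divide_eq)
      finally have "norm (E (z - p)) \<le> \<epsilon> * norm (z - p)" by (rule r(2)[OF z(1)])
      also have "\<dots> \<le> \<epsilon> * (s * (norm X + 1))" using zp \<epsilon> by (intro mult_left_mono) auto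
      also have "\<dots> = s * (t / 2)" unfolding \<epsilon>(2)[symmetric] by simp
      finally have 1: "norm (E (z - p)) \<le> s * (t / 2)" .
      have "norm (E (z - p - s *\<^sub>R X)) \<le> norm (z - p - s *\<^sub>R X) * K" by (rule K)
      also have "\<dots> \<le> (d * s) * K" using z(2) K by (intro mult_right_mono) auto
      also have "\<dots> = s * (d * K)" by simp
      also have "\<dots> \<le> s * (t / 2)" using d(3) sp by (intro mult_left_mono) auto
      finally have 2: "norm (E (z - p - s *\<^sub>R X)) \<le> s * (t / 2)" .
      have "s *\<^sub>R E X = E (z - p) - E (z - p - s *\<^sub>R X)"
        unfolding linear_diff[OF lin, of "z - p" "s *\<^sub>R X"] linear_scale[OF lin] by simp
      then have "norm (s *\<^sub>R E X) \<le> s * (t / 2) + s * (t / 2)"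
        using 1 2 norm_triangle_ineq4[of "E (z - p)" "E (z - p - s *\<^sub>R X)"] by simp
      also have "\<dots> = s * t" by simp
      finally have "s * norm (E X) \<le> s * t" using sp by simp
      then show ?case using sp by simp
    qed
    then show ?thesis by simp
  qed
  then have "norm (E X) \<le> 0" by (rule field_le_epsilon)
  then show ?thesis by (simp add: E_def)
qed

text \<open>On the frontier the inner normal is the restriction of the normalised gradient of
  \<rho>. Its derivative along a tangent vector is A divided by the gradient length, up to a normal
  component that disappears in the second fundamental form. The sum is the same for every
  orthonormal basis that \<open>trace_on\<close> may select.\<close>

lemma euclidean_mean_curvature_eq:
  fixes \<rho> :: "real^'n \<Rightarrow> real"
  assumes p: "p \<in> frontier \<Omega>" and L: "local_defining_fun \<Omega> p U \<rho>"
    and A: "(gradient \<rho> has_derivative (\<lambda>h. A *v h)) (at p)"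
  shows "euclidean_mean_curvature (frontier \<Omega>) (inner_normal \<Omega>) p
     = - (tangential_trace (inner_normal \<Omega> p) A / norm (gradient \<rho> p))"
proof -
  note LD = local_defining_funD[OF L]
  define N where "N = gradient \<rho>"
  define \<nu> where "\<nu> = inner_normal \<Omega> p"
  have N0: "norm (N p) > 0" using LD(3)[OF LD(2)] by (simp add: N_def)
  have \<nu>: "\<nu> = N p /\<^sub>R norm (N p)" unfolding \<nu>_def N_def by (rule inner_normal_eq[OF p L])
  then have n\<nu>: "norm \<nu> = 1" using N0 by simp
  have perp: "X \<bullet> \<nu> = 0 \<longleftrightarrow> N p \<bullet> X = 0" for X using N0 by (simp add: \<nu> inner_commute)
  have Nd: "(N has_derivative (\<lambda>h. A *v h)) (at p)" using A by (simp add: N_def)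
  obtain j where j: "((\<lambda>z. inverse (norm (N z))) has_derivative j) (at p)"
  proof -
    have "((\<lambda>z. norm (N z)) has_derivative (\<lambda>h. (A *v h) \<bullet> sgn (N p))) (at p)"
      by (rule has_derivative_compose[OF Nd has_derivative_norm]) (use N0 in auto)
    from Deriv.has_derivative_inverse[OF _ this] N0 show ?thesis by (intro that) auto
  qed
  have dn: "((\<lambda>z. N z /\<^sub>R norm (N z)) has_derivative (\<lambda>h. (A *v h) /\<^sub>R norm (N p) + j h *\<^sub>R N p)) (at p)"
    using has_derivative_scaleR[OF j Nd] by simp
  define D' where "D' = (\<lambda>h. (A *v h) /\<^sub>R norm (N p) + j h *\<^sub>R N p)"
  obtain r where r: "r > 0" "ball p r \<subseteq> U" using LD(1,2) openE by blast
  have D': "(inner_normal \<Omega> has_derivative D') (at p within frontier \<Omega>)"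
  proof (rule has_derivative_transform_within[OF has_derivative_at_withinI[OF dn[folded D'_def]] r(1) p])
    fix z assume "z \<in> frontier \<Omega>" "dist z p < r"
    then have "z \<in> U" "z \<in> frontier \<Omega>" using r by (auto simp: dist_commute)
    then show "N z /\<^sub>R norm (N z) = inner_normal \<Omega> z"
      using inner_normal_eq[OF _ local_defining_fun_move[OF L]] by (simp add: N_def)
  qed
  then have "inner_normal \<Omega> differentiable (at p within frontier \<Omega>)" by (rule differentiableI)
  then have D: "(inner_normal \<Omega> has_derivative frechet_derivative (inner_normal \<Omega>) (at p within frontier \<Omega>)) (at p within frontier \<Omega>)"
    by (simp add: frechet_derivative_works)
  have sff: "second_fundamental_form (frontier \<Omega>) (inner_normal \<Omega>) p b b = - ((b \<bullet> (A *v b)) / norm (N p))"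
    if b: "b \<bullet> \<nu> = 0" for b
  proof -
    have Nb: "N p \<bullet> b = 0" using b perp by simp
    have "frechet_derivative (inner_normal \<Omega>) (at p within frontier \<Omega>) b = D' b"
      by (rule derivative_within_boundary_unique[OF p L _ D D']) (use Nb in \<open>simp add: N_def\<close>)
    then show ?thesis using Nb
      by (simp add: second_fundamental_form_def D'_def inner_add_left inner_add_right inner_commute inverse_eq_divide)
  qed
  define T where "T = {X. X \<bullet> \<nu> = 0}"
  define P where "P = (\<lambda>B. B \<subseteq> T \<and> pairwise orthogonal B \<and> (\<forall>b\<in>B. norm b = 1) \<and> span B = T)"
  define B where "B = (SOME B. P B)"
  have "\<exists>B. P B"
  proof -
    obtain B where "B \<subseteq> T" "pairwise orthogonal B" "\<And>x. x \<in> B \<Longrightarrow> norm x = 1" "span B = T"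
      using orthonormal_basis_subspace[OF subspace_hyperplane2[of \<nu>]] unfolding T_def by metis
    then show ?thesis unfolding P_def by blast
  qed
  then have PB: "P B" unfolding B_def by (rule someI_ex)
  then interpret hyperplane_basis \<nu> B
    using n\<nu> by unfold_locales (auto simp: P_def T_def)
  have "euclidean_mean_curvature (frontier \<Omega>) (inner_normal \<Omega>) p
     = (\<Sum>b\<in>B. second_fundamental_form (frontier \<Omega>) (inner_normal \<Omega>) p b b)"
    unfolding euclidean_mean_curvature_def trace_on_def B_def P_def T_def \<nu>_def ..
  also have "\<dots> = (\<Sum>b\<in>B. - ((b \<bullet> (A *v b)) / norm (N p)))"
    by (intro sum.cong refl sff) (rule B_perp)
  also have "\<dots> = - ((\<Sum>b\<in>B. b \<bullet> (A *v b)) / norm (N p))"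
    by (simp add: sum_negf sum_divide_distrib)
  finally show ?thesis by (simp add: sum_basis_eq_tangential_trace \<nu>_def N_def)
qed

text \<open>The frontier is shifted by y - p = d e. For z near y outside the shifted domain, the
  segment from z to z - d e leaves \<Omega> and meets the frontier at distance less than d from z,
  whence \<psi> z < c. So the shifted frontier touches the superlevel set at y, and its curvature at
  p enters through \<open>touching_sublevel_set\<close>.\<close>

lemma boundary_closest_pair:
  fixes \<psi> :: "real^'n \<Rightarrow> real"
  assumes op: "open \<Omega>" and vb: "viscosity_bound \<Omega> F \<psi>"
    and der: "\<And>x. x \<in> \<Omega> \<Longrightarrow> (\<psi> has_derivative (\<lambda>h. D x \<bullet> h)) (at x)" and cD: "continuous_on \<Omega> D"
    and F: "\<And>x p \<nu>. isCont (\<lambda>t. F (fst t) (fst (snd t)) (snd (snd t))) (x, p, \<nu>)"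
    and p: "p \<in> frontier \<Omega>" and L: "local_defining_fun \<Omega> p U \<rho>"
    and y: "y \<in> \<Omega>" and d: "d > 0" "dist p y = d" and c: "c \<le> \<psi> y"
    and sep: "\<And>z q. z \<in> \<Omega> \<Longrightarrow> dist z y < d \<Longrightarrow> q \<in> frontier \<Omega> \<Longrightarrow> dist q z < d \<Longrightarrow> \<psi> z < c"
  obtains \<beta> where "\<beta> \<ge> 0" "D y = \<beta> *\<^sub>R inner_normal \<Omega> p"
    "F y (D y) (inner_normal \<Omega> p) \<le> - (\<beta> * euclidean_mean_curvature (frontier \<Omega>) (inner_normal \<Omega>) p)"
    "norm (inner_normal \<Omega> p) = 1"
proof -
  note LD = local_defining_funD[OF L]
  define N where "N = gradient \<rho> p"
  obtain A where A: "(gradient \<rho> has_derivative (\<lambda>h. A *v h)) (at p)" using LD(7)[OF LD(2)] by blast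
  define e where "e = (y - p) /\<^sub>R d"
  have e: "norm e = 1" using d by (simp add: e_def dist_norm norm_minus_commute)
  have ee: "e \<bullet> e = 1" using e by (simp add: norm_eq_1)
  have yp: "y = p + d *\<^sub>R e" using d by (simp add: e_def)
  have \<rho>p: "\<rho> p = 0" using LD(5)[OF LD(2)] p by simp
  \<comment> \<open>A frontier point at distance less than d from y would force \<psi> y < c. This
    ball touches the frontier at p, which identifies the inner normal there with
    \<open>e\<close>.\<close>
  have ball: "ball y d \<subseteq> \<Omega>"
  proof (rule ccontr)
    assume "\<not> ball y d \<subseteq> \<Omega>"
    moreover have "y \<in> ball y d \<inter> \<Omega>" using y d(1) by simp
    ultimately have "ball y d \<inter> frontier \<Omega> \<noteq> {}"
      using connected_Int_frontier[of "ball y d" \<Omega>] connected_ball[of y d] by blast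
    then obtain q where "q \<in> frontier \<Omega>" "dist q y < d" by (auto simp: dist_commute)
    then show False using sep[OF y _ \<open>q \<in> frontier \<Omega>\<close>] d c by simp
  qed
  have half: "N \<bullet> v \<ge> 0" if v: "e \<bullet> v > 0" for v
  proof (rule ccontr)
    assume "\<not> N \<bullet> v \<ge> 0"
    then have neg: "(- N) \<bullet> v > 0" by simp
    have "((\<lambda>x. - \<rho> x) has_derivative (\<lambda>h. (- N) \<bullet> h)) (at p)"
      using has_derivative_minus[OF LD(6)[OF LD(2)]] by (simp add: N_def)
    then have 1: "eventually (\<lambda>s. - \<rho> (p + s *\<^sub>R v) > 0) (at_right 0)"
      by (rule directional_sign) (use neg \<rho>p in simp_all)
    have "((\<lambda>s. p + s *\<^sub>R v) \<longlongrightarrow> p + 0 *\<^sub>R v) (at_right 0)" by (intro tendsto_intros)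
    then have 2: "eventually (\<lambda>s. p + s *\<^sub>R v \<in> U) (at_right 0)"
      using LD(1,2) by (intro topological_tendstoD) auto
    have "((\<lambda>s. 2 * d * (e \<bullet> v) - s * (v \<bullet> v)) \<longlongrightarrow> 2 * d * (e \<bullet> v) - 0 * (v \<bullet> v)) (at_right 0)"
      by (intro tendsto_intros)
    then have 3: "eventually (\<lambda>s. 2 * d * (e \<bullet> v) - s * (v \<bullet> v) > 0) (at_right 0)"
      by (rule order_tendstoD(1)) (use d v in simp)
    have "eventually (\<lambda>s. False) (at_right (0::real))"
      using 1 2 3 eventually_at_right_less[of 0]
    proof eventually_elim
      case (elim s)
      have eq: "p + s *\<^sub>R v - y = s *\<^sub>R v + (- d) *\<^sub>R e" by (simp add: yp)
      have "(norm (p + s *\<^sub>R v - y))^2 = d^2 - s * (2 * d * (e \<bullet> v) - s * (v \<bullet> v))"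
        unfolding eq power2_norm_eq_inner
        by (simp add: inner_diff_left inner_diff_right ee inner_commute power2_eq_square algebra_simps)
      also have "\<dots> < d^2" using elim by simp
      finally have "norm (p + s *\<^sub>R v - y) < d" using d by (simp add: power2_less_imp_less)
      then have "p + s *\<^sub>R v \<in> \<Omega>" by (intro subsetD[OF ball]) (simp add: dist_norm norm_minus_commute)
      then show ?case using elim LD(4) by force
    qed
    then show False by simp
  qed
  define k where "k = N \<bullet> e"
  have Nk: "N = k *\<^sub>R e" and k0: "k \<ge> 0" using half_space_inner_nonneg[OF e half] unfolding k_def by blast+
  have "N \<noteq> 0" using LD(3)[OF LD(2)] by (simp add: N_def)
  then have k: "k > 0" using Nk k0 by (metis less_eq_real_def scaleR_zero_left)
  have nN: "norm N = k" using Nk e k by simp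
  have \<nu>: "inner_normal \<Omega> p = e" using inner_normal_eq[OF p L] Nk nN k by (simp add: N_def[symmetric])
  \<comment> \<open>The symmetric part of A, with the same quadratic form and the same tangential
    trace.\<close>
  define Q where "Q = (1 / 2) *\<^sub>R (A + transpose A)"
  have Qh: "h \<bullet> (Q *v h) = h \<bullet> (A *v h)" for h
    by (simp add: Q_def scaleR_matrix_vector_assoc[symmetric] matrix_vector_mult_add_rdistrib inner_add_right)
      (metis dot_lmul_matrix inner_commute transpose_matrix_vector)
  have Qtr: "tangential_trace e Q = tangential_trace e A"
    unfolding tangential_trace_def Qh by (simp add: Q_def trace_def transpose_def)
  have Qsym: "transpose (Q + (2 * t) *\<^sub>R mat 1) = Q + (2 * t) *\<^sub>R mat 1" for t
    by (simp add: Q_def transpose_add transpose_scaleR transpose_mat add.commute)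
  define \<beta> where "\<beta> = D y \<bullet> e"
  \<comment> \<open>The term t |h|^2 added to the Taylor polynomial absorbs the remainder, so a
    negative value implies \<rho> (p + h) < 0. The bound is then let t tend to 0.\<close>
  have main: "\<beta> \<ge> 0 \<and> D y = \<beta> *\<^sub>R e \<and> F y (D y) e \<le> \<beta> / k * (tangential_trace e A + 2 * t * (real CARD('n) - 1))"
    if t: "t > 0" for t
  proof -
    obtain r1 where r1: "r1 > 0" "\<And>h. norm h < r1 \<Longrightarrow> \<bar>\<rho> (p + h) - \<rho> p - N \<bullet> h - (h \<bullet> (A *v h)) / 2\<bar> \<le> t * (norm h)^2"
      using second_order_expansion[OF LD(1,2,6) A t] unfolding N_def by blast
    obtain r2 where r2: "r2 > 0" "ball p r2 \<subseteq> U" using LD(1,2) openE by blast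
    obtain r3 where r3: "r3 > 0" "ball y r3 \<subseteq> \<Omega>" using op y openE by blast
    define r where "r = min (min r1 r2) (min r3 d)"
    have r: "r > 0" "r \<le> r1" "r \<le> r2" "r \<le> r3" "r \<le> d" using r1 r2 r3 d by (auto simp: r_def)
    have le: "\<psi> z \<le> \<psi> y" if z: "z \<in> ball y r"
      and s: "k * (e \<bullet> (z - y)) + ((z - y) \<bullet> ((Q + (2 * t) *\<^sub>R mat 1) *v (z - y))) / 2 < 0" for z
    proof -
      define h where "h = z - y"
      have h: "norm h < r" using z by (simp add: h_def dist_norm norm_minus_commute)
      have "k * (e \<bullet> h) + (h \<bullet> (A *v h)) / 2 + t * (norm h)^2 < 0"
        using s unfolding h_def[symmetric] matrix_vector_mult_add_rdistrib inner_add_right Qh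
        by (simp add: scaleR_matrix_vector_assoc[symmetric] power2_norm_eq_inner add_divide_distrib)
      moreover have "N \<bullet> h = k * (e \<bullet> h)" by (simp add: Nk)
      ultimately have neg: "\<rho> (p + h) < 0" using r1(2)[of h] h r \<rho>p by (auto simp: abs_le_iff)
      have "p + h \<in> U" using h r by (intro subsetD[OF r2(2)]) (simp add: dist_norm)
      then have out: "p + h \<notin> \<Omega>" "p + h \<notin> frontier \<Omega>" using LD(4,5) neg by auto
      have zO: "z \<in> \<Omega>" using z r by (intro subsetD[OF r3(2)]) auto
      have "closed_segment z (p + h) \<inter> frontier \<Omega> \<noteq> {}"
        using connected_Int_frontier[of "closed_segment z (p + h)" \<Omega>] zO out by auto
      then obtain q where q: "q \<in> closed_segment z (p + h)" "q \<in> frontier \<Omega>" by blast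
      then obtain w where w: "0 \<le> w" "w \<le> 1" "q = (1 - w) *\<^sub>R z + w *\<^sub>R (p + h)"
        by (auto simp: closed_segment_def)
      have "w \<noteq> 1" using w q out by auto
      then have w1: "w < 1" using w by simp
      have "q - z = w *\<^sub>R (p + h - z)" unfolding w(3) by (simp add: algebra_simps)
      also have "p + h - z = - (d *\<^sub>R e)" by (simp add: h_def yp)
      finally have "q - z = (- (w * d)) *\<^sub>R e" by simp
      then have "dist q z = w * d" using e w d by (simp add: dist_norm abs_mult)
      also have "\<dots> < 1 * d" using w1 d by (intro mult_strict_right_mono) auto
      finally have "\<psi> z < c" using z r by (intro sep[OF zO _ q(2)]) (auto simp: dist_commute)
      then show ?thesis using c by simp
    qed
    obtain \<beta>' where \<beta>': "\<beta>' \<ge> 0" "D y = \<beta>' *\<^sub>R e" "F y (D y) e \<le> \<beta>' / k * tangential_trace e (Q + (2 * t) *\<^sub>R mat 1)"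
      by (rule touching_sublevel_set[OF op vb der cD y F e k Qsym refl r(1) le]) (use that in auto)
    have "\<beta>' = \<beta>" unfolding \<beta>_def \<beta>'(2) using ee by simp
    then show ?thesis using \<beta>' by (simp add: tangential_trace_simps Qtr ee)
  qed
  have \<beta>: "\<beta> \<ge> 0" "D y = \<beta> *\<^sub>R e" using main[of 1] by auto
  have "F y (D y) e \<le> \<beta> / k * tangential_trace e A"
  proof (rule tendsto_lowerbound)
    have "((\<lambda>t. \<beta> / k * (tangential_trace e A + 2 * t * (real CARD('n) - 1))) \<longlongrightarrow>
        \<beta> / k * (tangential_trace e A + 2 * 0 * (real CARD('n) - 1))) (at_right 0)"
      by (intro tendsto_intros)
    then show "((\<lambda>t. \<beta> / k * (tangential_trace e A + 2 * t * (real CARD('n) - 1))) \<longlongrightarrow>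
        \<beta> / k * tangential_trace e A) (at_right 0)" by simp
    show "eventually (\<lambda>t. F y (D y) e \<le> \<beta> / k * (tangential_trace e A + 2 * t * (real CARD('n) - 1))) (at_right 0)"
      using eventually_at_right_less[of 0] by eventually_elim (use main in blast)
  qed simp
  then have "F y (D y) e \<le> - (\<beta> * euclidean_mean_curvature (frontier \<Omega>) (inner_normal \<Omega>) p)"
    unfolding euclidean_mean_curvature_eq[OF p L A] \<nu> N_def[symmetric] nN by simp
  then show ?thesis using that[of \<beta>] \<beta> e by (simp add: \<nu>)
qed

section \<open>The mountain pass\<close>

lemma uniformly_separated_connected:
  fixes X :: "'a::metric_space set"
  assumes "connected X" "X = A \<union> B" "d > 0" "\<And>a b. a \<in> A \<Longrightarrow> b \<in> B \<Longrightarrow> d \<le> dist a b"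
  shows "A = {} \<or> B = {}"
proof (rule ccontr)
  assume ne: "\<not> (A = {} \<or> B = {})"
  define U where "U = (\<Union>a\<in>A. ball a (d / 2))"
  define V where "V = (\<Union>b\<in>B. ball b (d / 2))"
  have sub: "A \<subseteq> U" "B \<subseteq> V" using assms(3) by (force simp: U_def V_def)+
  have "dist a b \<ge> d" if "a \<in> A" "b \<in> B" for a b using assms(4) that by blast
  then have "x \<notin> V" if "x \<in> A" for x using that assms(3) by (force simp: V_def dist_commute)
  moreover have "x \<notin> U" if "x \<in> B" for x using that assms(3,4) by (force simp: U_def)
  ultimately have "U \<inter> V \<inter> X = {}" using assms(2) by blast
  moreover have "open U" "open V" by (auto simp: U_def V_def)
  ultimately show False
    using connectedD[OF assms(1), of U V] sub ne assms(2) by blast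
qed

locale pass =
  fixes \<Omega> K K' :: "'a::euclidean_space set" and \<psi> :: "'a \<Rightarrow> real" and d :: real
  assumes connected_\<Omega>: "connected \<Omega>" and bounded_\<Omega>: "bounded \<Omega>" and open_\<Omega>: "open \<Omega>"
    and frontier_\<Omega>: "frontier \<Omega> = K \<union> K'" and nonempty: "K \<noteq> {}" "K' \<noteq> {}"
    and d_pos: "d > 0" and far: "\<And>a b. a \<in> K \<Longrightarrow> b \<in> K' \<Longrightarrow> d \<le> dist a b"
    and cont: "continuous_on (closure \<Omega>) \<psi>"
    and no_local_max: "\<And>x r. x \<in> \<Omega> \<Longrightarrow> r > 0 \<Longrightarrow> \<exists>x'\<in>\<Omega>. dist x' x < r \<and> \<psi> x < \<psi> x'"
begin

text \<open>The frontier belongs to the set at every level, whatever the values of \<psi> on it.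
  Chains may therefore pass through the frontier, and its points stay fixed when the level is
  raised.\<close>

definition X :: "real \<Rightarrow> 'a set" where
  "X c = frontier \<Omega> \<union> {x \<in> \<Omega>. c \<le> \<psi> x}"

definition reach :: "real \<Rightarrow> 'a set" where
  "reach c = {(x, y). x \<in> X c \<and> y \<in> X c \<and> dist x y < d}\<^sup>* `` K"

lemma closure_eq: "closure \<Omega> = \<Omega> \<union> frontier \<Omega>"
  using open_\<Omega> by (simp add: closure_Un_frontier)

lemma compact_closure_\<Omega>: "compact (closure \<Omega>)"
  using bounded_\<Omega> by simp

lemma X_eq: "X c = frontier \<Omega> \<union> {x \<in> closure \<Omega>. c \<le> \<psi> x}"
  by (auto simp: X_def closure_eq)

lemma compact_X: "compact (X c)"
proof -
  have "compact (frontier \<Omega>)" by (simp add: bounded_\<Omega> compact_frontier_bounded)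
  moreover have "compact {x \<in> closure \<Omega>. c \<le> \<psi> x}"
  proof -
    have "closed {x \<in> closure \<Omega>. c \<le> \<psi> x}"
      by (intro continuous_on_closed_Collect_le cont continuous_intros closed_closure)
    then have "compact (closure \<Omega> \<inter> {x \<in> closure \<Omega>. c \<le> \<psi> x})"
      by (intro compact_Int_closed compact_closure_\<Omega>)
    moreover have "closure \<Omega> \<inter> {x \<in> closure \<Omega>. c \<le> \<psi> x} = {x \<in> closure \<Omega>. c \<le> \<psi> x}" by blast
    ultimately show ?thesis by simp
  qed
  ultimately show ?thesis unfolding X_eq by (rule compact_Un)
qed

lemma X_antimono: "c \<le> c' \<Longrightarrow> X c' \<subseteq> X c"
  by (auto simp: X_def)

lemma reach_antimono: "c \<le> c' \<Longrightarrow> reach c' \<subseteq> reach c"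
  unfolding reach_def using X_antimono[of c c'] by (intro Image_mono rtrancl_mono) auto

lemma K_reach: "K \<subseteq> reach c"
  by (auto simp: reach_def)

lemma reach_subset: "reach c \<subseteq> X c"
proof
  fix y assume "y \<in> reach c"
  then obtain x where "x \<in> K" and r: "(x, y) \<in> {(x, y). x \<in> X c \<and> y \<in> X c \<and> dist x y < d}\<^sup>*"
    by (auto simp: reach_def)
  from r this(1) show "y \<in> X c"
    by (induction rule: rtrancl_induct) (auto simp: X_def frontier_\<Omega>)
qed

lemma reach_step: "x \<in> reach c \<Longrightarrow> y \<in> X c \<Longrightarrow> dist x y < d \<Longrightarrow> y \<in> reach c"
proof -
  assume "x \<in> reach c" "y \<in> X c" "dist x y < d"
  then have "x \<in> X c" using reach_subset by blast
  obtain k where "k \<in> K" "(k, x) \<in> {(x, y). x \<in> X c \<and> y \<in> X c \<and> dist x y < d}\<^sup>*"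
    using \<open>x \<in> reach c\<close> by (auto simp: reach_def)
  moreover have "(x, y) \<in> {(x, y). x \<in> X c \<and> y \<in> X c \<and> dist x y < d}"
    using \<open>x \<in> X c\<close> \<open>y \<in> X c\<close> \<open>dist x y < d\<close> by simp
  ultimately show "y \<in> reach c" unfolding reach_def by (meson Image_iff rtrancl_into_rtrancl)
qed

lemma reach_induct [consumes 1, case_names base step]:
  assumes "y \<in> reach c" and "\<And>x. x \<in> K \<Longrightarrow> P x"
    and "\<And>x y. x \<in> reach c \<Longrightarrow> P x \<Longrightarrow> y \<in> X c \<Longrightarrow> dist x y < d \<Longrightarrow> P y"
  shows "P y"
proof -
  obtain x where x: "x \<in> K" and r: "(x, y) \<in> {(x, y). x \<in> X c \<and> y \<in> X c \<and> dist x y < d}\<^sup>*"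
    using assms(1) by (auto simp: reach_def)
  from r have "y \<in> reach c \<and> P y"
  proof (induction rule: rtrancl_induct)
    case base
    then show ?case using K_reach x assms(2) by auto
  next
    case (step y z)
    then show ?case using reach_step[of y c z] assms(3)[of y z] by auto
  qed
  then show ?thesis by simp
qed

lemma reach_separated: "a \<in> reach c \<Longrightarrow> b \<in> X c - reach c \<Longrightarrow> d \<le> dist a b"
  using reach_step by force

text \<open>Steps are strictly shorter than d, and interior points are no local maxima. Hence the
  points of a finite chain can be moved a little to raise the level, frontier points excepted. This
  shows that no level joining K to K' is the largest.\<close>

lemma raise_chain:
  assumes "y \<in> reach c" "t > 0"
  shows "\<exists>c'>c. \<exists>y'\<in>reach c'. dist y' y < t \<and> (y \<in> frontier \<Omega> \<longrightarrow> y' = y)"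
  using assms
proof (induction arbitrary: t rule: reach_induct)
  case (base x)
  then show ?case using K_reach[of "c + 1"] by (intro exI[of _ "c + 1"]) (intro conjI bexI[of _ x], auto)
next
  case (step y z)
  \<comment> \<open>Half of the slack of the last step, so that both its ends may move by less than
    s.\<close>
  define s where "s = min t ((d - dist y z) / 2)"
  have s: "s > 0" "s \<le> t" using step by (auto simp: s_def)
  have "s \<le> (d - dist y z) / 2" unfolding s_def by (rule min.cobounded2)
  then have s': "2 * s \<le> d - dist y z" by (simp add: field_simps)
  note s = s s'
  obtain c1 y' where y': "c1 > c" "y' \<in> reach c1" "dist y' y < s" using step.IH[OF s(1)] by blast
  show ?case
  proof (cases "z \<in> frontier \<Omega>")
    case True
    have "dist y' z < d" using dist_triangle[of y' z y] y'(3) s by linarith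
    then have "z \<in> reach c1" using True by (intro reach_step[OF y'(2)]) (auto simp: X_def)
    then show ?thesis using y'(1) step.prems by (intro exI[of _ c1]) (auto intro!: bexI[of _ z])
  next
    case False
    then have z: "z \<in> \<Omega>" "c \<le> \<psi> z" using step by (auto simp: X_def)
    obtain z' where z': "z' \<in> \<Omega>" "dist z' z < s" "\<psi> z < \<psi> z'" using no_local_max[OF z(1) s(1)] by blast
    define c2 where "c2 = min c1 (\<psi> z')"
    have c2: "c2 > c" "c2 \<le> c1" "c2 \<le> \<psi> z'" using y'(1) z z' by (auto simp: c2_def)
    have "dist y' z' \<le> dist y' y + dist y z + dist z z'"
      using dist_triangle[of y' z' y] dist_triangle[of y z' z] by linarith
    then have "dist y' z' < d" using y'(3) z'(2) s by (simp add: dist_commute)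
    moreover have "y' \<in> reach c2" using y'(2) reach_antimono[OF c2(2)] by blast
    ultimately have "z' \<in> reach c2" using z' c2 reach_step[of y' c2 z'] by (auto simp: X_def)
    then show ?thesis using c2(1) z'(2) s False by (intro exI[of _ c2]) (auto intro!: bexI[of _ z'])
  qed
qed

text \<open>c is the supremum of the levels at which chains join K to K'. By
  \<open>raise_chain\<close> it is not attained, so A = \<open>reach c\<close> and the rest B of
  \<open>X c\<close> are at least d apart. A larger gap would persist at slightly lower levels by
  compactness, contrary to the supremum.\<close>

lemma closest_pair:
  obtains c A B where "A \<union> B = X c" "A \<inter> B = {}" "K \<subseteq> A" "K' \<subseteq> B"
    "\<And>a b. a \<in> A \<Longrightarrow> b \<in> B \<Longrightarrow> d \<le> dist a b" "\<exists>a\<in>A. \<exists>b\<in>B. dist a b = d"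
proof -
  define joined where "joined = {c. reach c \<inter> K' \<noteq> {}}"
  have disj: "K \<inter> K' = {}" using far d_pos by force
  have clne: "closure \<Omega> \<noteq> {}" using nonempty unfolding closure_eq frontier_\<Omega> by blast
  obtain xm where xm: "xm \<in> closure \<Omega>" "\<And>x. x \<in> closure \<Omega> \<Longrightarrow> \<psi> xm \<le> \<psi> x"
    using continuous_attains_inf[OF compact_closure_\<Omega> clne cont] by blast
  obtain xM where xM: "xM \<in> closure \<Omega>" "\<And>x. x \<in> closure \<Omega> \<Longrightarrow> \<psi> x \<le> \<psi> xM"
    using continuous_attains_sup[OF compact_closure_\<Omega> clne cont] by blast
  have K'X: "K' \<subseteq> X c" for c by (auto simp: X_def frontier_\<Omega>)
  \<comment> \<open>At the minimum of \<psi> the set \<open>X\<close> is the connected closure of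
    \<Omega>, which cannot split into nonempty parts at distance at least d.\<close>
  have "\<psi> xm \<in> joined"
  proof (rule ccontr)
    assume no: "\<psi> xm \<notin> joined"
    have Xc: "X (\<psi> xm) = closure \<Omega>" using xm by (auto simp: X_eq closure_eq)
    have "reach (\<psi> xm) = {} \<or> X (\<psi> xm) - reach (\<psi> xm) = {}"
    proof (rule uniformly_separated_connected[OF _ _ d_pos])
      show "connected (closure \<Omega>)" using connected_\<Omega> by (rule connected_imp_connected_closure)
      show "closure \<Omega> = reach (\<psi> xm) \<union> (X (\<psi> xm) - reach (\<psi> xm))" using reach_subset Xc by blast
    qed (rule reach_separated)
    then show False using no K_reach K'X nonempty unfolding joined_def by blast
  qed
  then have ne: "joined \<noteq> {}" by blast
  \<comment> \<open>Above the maximum of \<psi> only the frontier remains, and no step shorter than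
    d leads from K to K'.\<close>
  have bound: "c \<le> \<psi> xM" if "c \<in> joined" for c
  proof (rule ccontr)
    assume "\<not> c \<le> \<psi> xM"
    then have Xc: "X c = K \<union> K'" using xM(2) by (force simp: X_def frontier_\<Omega> closure_eq)
    have "y \<in> K" if "y \<in> reach c" for y
      using that
    proof (induction rule: reach_induct)
      case (step x y)
      then show ?case using Xc far[of x y] by auto
    qed
    then show False using that disj unfolding joined_def by blast
  qed
  then have bdd: "bdd_above joined" by (auto simp: bdd_above_def)
  define c where "c = Sup joined"
  have "c \<notin> joined"
  proof
    assume "c \<in> joined"
    then obtain y where y: "y \<in> reach c" "y \<in> K'" by (auto simp: joined_def)
    then obtain c' y' where "c' > c" "y' \<in> reach c'" "y \<in> frontier \<Omega> \<longrightarrow> y' = y"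
      using raise_chain[OF y(1) zero_less_one] by blast
    then have "c' \<in> joined" using y frontier_\<Omega> by (auto simp: joined_def)
    then have "c' \<le> c" unfolding c_def by (rule cSup_upper[OF _ bdd])
    then show False using \<open>c' > c\<close> by simp
  qed
  define A where "A = reach c"
  define B where "B = X c - reach c"
  have AB: "A \<union> B = X c" "A \<inter> B = {}" using reach_subset by (auto simp: A_def B_def)
  have KA: "K \<subseteq> A" using K_reach by (simp add: A_def)
  have KB: "K' \<subseteq> B" using \<open>c \<notin> joined\<close> K'X by (auto simp: B_def joined_def)
  have sep: "d \<le> dist a b" if "a \<in> A" "b \<in> B" for a b using that reach_separated by (auto simp: A_def B_def)
  have "\<exists>a\<in>A. \<exists>b\<in>B. dist a b = d"
  proof (rule ccontr)
    assume no: "\<not> ?thesis"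
    \<comment> \<open>Each piece is the compact set \<open>X c\<close> without the open
      d-neighbourhood of the other piece.\<close>
    have piece: "compact P" if "P \<union> P' = X c" "P \<inter> P' = {}" "\<And>x y. x \<in> P \<Longrightarrow> y \<in> P' \<Longrightarrow> d \<le> dist x y" for P P'
    proof -
      have "x \<notin> (\<Union>y\<in>P'. ball y d)" if "x \<in> P" for x
        using \<open>\<And>x y. x \<in> P \<Longrightarrow> y \<in> P' \<Longrightarrow> d \<le> dist x y\<close>[OF that] by (force simp: dist_commute)
      moreover have "x \<in> (\<Union>y\<in>P'. ball y d)" if "x \<in> P'" for x using that d_pos by force
      ultimately have "P = X c - (\<Union>y\<in>P'. ball y d)" using that(1,2) by blast
      moreover have "compact (X c - (\<Union>y\<in>P'. ball y d))" by (intro compact_diff compact_X) auto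
      ultimately show ?thesis by simp
    qed
    have cA: "compact A" by (rule piece[OF AB sep])
    have cB: "compact B"
    proof (rule piece[of B A])
      show "d \<le> dist x y" if "x \<in> B" "y \<in> A" for x y using sep[OF that(2,1)] by (simp add: dist_commute)
    qed (use AB in auto)
    have "A \<times> B \<noteq> {}" using KA KB nonempty by blast
    from continuous_attains_inf[OF compact_Times[OF cA cB] this, of "\<lambda>z. dist (fst z) (snd z)"]
    obtain a0 b0 where ab0: "a0 \<in> A" "b0 \<in> B" "\<And>a b. a \<in> A \<Longrightarrow> b \<in> B \<Longrightarrow> dist a0 b0 \<le> dist a b"
      by (force intro: continuous_intros)
    \<comment> \<open>If every point used by a chain is within s of \<open>X c\<close>, a step
      shorter than d corresponds to one shorter than d + 2 s = dist a0 b0, which cannot lead from A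
      to B.\<close>
    define s where "s = (dist a0 b0 - d) / 2"
    have s: "s > 0" "dist a0 b0 = d + 2 * s" using sep[OF ab0(1,2)] no ab0(1,2) by (auto simp: s_def less_le field_simps)
    \<comment> \<open>On this compact set \<psi> stays below some c1 < c, so all of
      \<open>X c1\<close> lies within s of \<open>X c\<close>.\<close>
    define W where "W = closure \<Omega> - (\<Union>x\<in>X c. ball x s)"
    have cW: "compact W" unfolding W_def by (intro compact_diff compact_closure_\<Omega>) auto
    have "\<exists>c1<c. \<forall>x\<in>W. \<psi> x < c1"
    proof (cases "W = {}")
      case True
      then show ?thesis by (intro exI[of _ "c - 1"]) auto
    next
      case False
      have "W \<subseteq> closure \<Omega>" by (auto simp: W_def)
      then obtain w where w: "w \<in> W" "\<And>x. x \<in> W \<Longrightarrow> \<psi> x \<le> \<psi> w"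
        using continuous_attains_sup[OF cW False continuous_on_subset[OF cont]] by blast
      have "w \<notin> X c" using w(1) s(1) by (auto simp: W_def)
      then have "\<psi> w < c" using w(1) by (auto simp: W_def X_eq)
      then show ?thesis using w(2) by (intro exI[of _ "(\<psi> w + c) / 2"]) force
    qed
    then obtain c1 where c1: "c1 < c" "\<And>x. x \<in> W \<Longrightarrow> \<psi> x < c1" by blast
    have near: "\<exists>x'\<in>X c. dist x x' < s" if x: "x \<in> X c1" for x
    proof (cases "x \<in> frontier \<Omega>")
      case True
      then show ?thesis using s by (intro bexI[of _ x]) (auto simp: X_def)
    next
      case False
      then have "x \<notin> W" using x c1(2)[of x] by (auto simp: X_def)
      then show ?thesis using x False by (auto simp: W_def X_def closure_eq dist_commute)
    qed
    obtain c2 where c2: "c2 \<in> joined" "c1 < c2" using c1(1) less_cSup_iff[OF ne bdd] unfolding c_def by blast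
    then obtain y where y: "y \<in> reach c1" "y \<in> K'" using reach_antimono[of c1 c2] by (auto simp: joined_def)
    from y(1) have "\<exists>a\<in>A. dist y a < s"
    proof (induction rule: reach_induct)
      case (base x)
      then show ?case using KA s by (intro bexI[of _ x]) auto
    next
      case (step x y)
      then obtain a where a: "a \<in> A" "dist x a < s" by blast
      obtain y' where y': "y' \<in> X c" "dist y y' < s" using near[OF step.hyps(2)] by blast
      have "dist a y' \<le> dist a x + dist x y + dist y y'"
        using dist_triangle[of a y' x] dist_triangle[of x y' y] by linarith
      then have "dist a y' < dist a0 b0" using a(2) y'(2) step.hyps(3) s(2) by (simp add: dist_commute)
      then have "y' \<notin> B" using ab0(3)[OF a(1), of y'] by auto
      then have "y' \<in> A" using y'(1) AB by blast
      then show ?case using y'(2) by blast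
    qed
    then obtain a where "a \<in> A" "dist y a < s" by blast
    moreover have "dist a0 b0 \<le> dist a y" using ab0(3) \<open>a \<in> A\<close> y(2) KB by blast
    ultimately show False using s d_pos by (simp add: dist_commute)
  qed
  then show ?thesis using that[OF AB KA KB sep] by blast
qed

end

section \<open>Nonexistence\<close>

text \<open>Here q and p - \<epsilon> y stand for the gradient of 2/(n-2) ln u at the frontier point
  and at the interior point. The curvature term \<beta> H compensates the squares of the normal
  component t up to a complete square in \<beta>. What remains is at most 3/4 \<epsilon>, against
  the gain \<epsilon> per tangential direction.\<close>

lemma boundary_pair_contradiction:
  fixes y :: "real^'n"
  assumes n: "n \<ge> 3" and \<nu>: "norm \<nu> = 1" and p: "p = \<beta> *\<^sub>R \<nu>"
    and le: "(n - 1) * \<epsilon> - (n - 3) / 2 * (norm (p - \<epsilon> *\<^sub>R y))^2 - ((p - \<epsilon> *\<^sub>R y) \<bullet> \<nu>)^2 \<le> - (\<beta> * H)"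
    and \<beta>: "\<beta> \<ge> 0" and H: "(n - 1) * (q \<bullet> \<nu>) \<le> H" and q: "norm (q - (p - \<epsilon> *\<^sub>R y)) \<le> \<omega>"
    and y: "norm y \<le> R" and \<epsilon>: "\<epsilon> > 0" "\<epsilon> * R^2 \<le> 1 / 4" and \<omega>: "\<omega>^2 < \<epsilon>"
  shows False
proof -
  define s where "s = \<epsilon> * (y \<bullet> \<nu>)"
  define t where "t = \<beta> - s"
  have \<nu>\<nu>: "\<nu> \<bullet> \<nu> = 1" using \<nu> by (simp add: norm_eq_1)
  have inner: "(p - \<epsilon> *\<^sub>R y) \<bullet> \<nu> = t" by (simp add: p t_def s_def inner_diff_left \<nu>\<nu>)
  have "(norm (p - \<epsilon> *\<^sub>R y))^2 = \<beta>^2 - 2 * \<beta> * s + \<epsilon>^2 * (norm y)^2"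
    unfolding power2_norm_eq_inner
    by (simp add: p s_def inner_diff_left inner_diff_right \<nu>\<nu> inner_commute power2_eq_square algebra_simps)
  moreover have "\<epsilon>^2 * (norm y)^2 \<le> \<epsilon> / 4"
  proof -
    have "\<epsilon>^2 * (norm y)^2 \<le> \<epsilon>^2 * R^2" using y by (intro mult_left_mono power_mono) auto
    also have "\<dots> = \<epsilon> * (\<epsilon> * R^2)" by (simp add: power2_eq_square)
    also have "\<dots> \<le> \<epsilon> * (1 / 4)" using \<epsilon> by (intro mult_left_mono) auto
    finally show ?thesis by simp
  qed
  moreover have "\<beta>^2 - 2 * \<beta> * s = t^2 - s^2" by (simp add: t_def power2_eq_square algebra_simps)
  ultimately have nrm: "(norm (p - \<epsilon> *\<^sub>R y))^2 \<le> t^2 - s^2 + \<epsilon> / 4" by linarith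
  \<comment> \<open>Cauchy-Schwarz bounds t^2 by the left side of \<open>nrm\<close>; comparison
    with its right side leaves s^2 \<le> \<epsilon>/4.\<close>
  have s2: "s^2 \<le> \<epsilon> / 4"
  proof -
    have "(norm (p - \<epsilon> *\<^sub>R y))^2 \<ge> t^2"
      using Cauchy_Schwarz_ineq2[of "p - \<epsilon> *\<^sub>R y" \<nu>] unfolding inner \<nu> by (simp add: abs_le_square_iff[symmetric])
    then show ?thesis using nrm by linarith
  qed
  have "\<bar>(q - (p - \<epsilon> *\<^sub>R y)) \<bullet> \<nu>\<bar> \<le> \<omega>" using Cauchy_Schwarz_ineq2[of "q - (p - \<epsilon> *\<^sub>R y)" \<nu>] q \<nu> by simp
  then have "q \<bullet> \<nu> \<ge> t - \<omega>" using inner by (simp add: inner_diff_left abs_le_iff)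
  then have "(n - 1) * (t - \<omega>) \<le> H" using H n mult_left_mono[of "t - \<omega>" "q \<bullet> \<nu>" "n - 1"] by linarith
  then have "\<beta> * ((n - 1) * (t - \<omega>)) \<le> \<beta> * H" using \<beta> by (rule mult_left_mono)
  moreover have "(n - 3) / 2 * (norm (p - \<epsilon> *\<^sub>R y))^2 \<le> (n - 3) / 2 * (t^2 + \<epsilon> / 4)"
    using nrm n by (intro mult_left_mono) (auto intro: order_trans[OF nrm])
  ultimately have "(n - 1) * \<epsilon> \<le> (n - 3) / 2 * (t^2 + \<epsilon> / 4) + t^2 - \<beta> * ((n - 1) * (t - \<omega>))"
    using le unfolding inner by linarith
  also have "\<dots> \<le> (n - 1) * (t^2 / 2 + \<epsilon> / 8 - \<beta> * (t - \<omega>))"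
  proof -
    have "(n - 3) / 2 * (t^2 + \<epsilon> / 4) + t^2 - \<beta> * ((n - 1) * (t - \<omega>))
      = (n - 1) * (t^2 / 2 + \<epsilon> / 8 - \<beta> * (t - \<omega>)) - \<epsilon> / 4"
      by (simp add: field_simps)
    then show ?thesis using \<epsilon> by simp
  qed
  finally have "\<epsilon> \<le> t^2 / 2 + \<epsilon> / 8 - \<beta> * (t - \<omega>)" using n by simp
  \<comment> \<open>Completing the square; s^2/2 \<le> \<epsilon>/8 and \<omega>^2/2 < \<epsilon>/2
    then contradict the previous inequality.\<close>
  moreover have "t^2 / 2 - \<beta> * (t - \<omega>) = s^2 / 2 + \<omega>^2 / 2 - (\<beta> - \<omega>)^2 / 2"
    by (simp add: t_def power2_eq_square field_simps)
  moreover have "(\<beta> - \<omega>)^2 \<ge> 0" by simp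
  ultimately show False using s2 \<omega> \<epsilon> by linarith
qed

theorem theorem1p2:
  fixes \<Omega> :: "(real^'n) set"
  assumes "CARD('n) \<ge> 3"
    and "open \<Omega>" and "connected \<Omega>" and "\<Omega> \<noteq> {}" and "bounded \<Omega>"
    and "smooth_boundary \<Omega>"
    and "\<not> connected (frontier \<Omega>)"
  shows "\<not> (\<exists>u :: real^'n \<Rightarrow> real.
            C1_closure \<Omega> u \<and> (\<forall>x\<in>closure \<Omega>. u x > 0) \<and>
            viscosity_subsol \<Omega> u \<and>
            (\<forall>p\<in>frontier \<Omega>. boundary_mean_curvature \<Omega> u p \<ge> 0))"
proof
  assume "\<exists>u :: real^'n \<Rightarrow> real.
            C1_closure \<Omega> u \<and> (\<forall>x\<in>closure \<Omega>. u x > 0) \<and>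
            viscosity_subsol \<Omega> u \<and>
            (\<forall>p\<in>frontier \<Omega>. boundary_mean_curvature \<Omega> u p \<ge> 0)"
  then obtain u :: "real^'n \<Rightarrow> real" where C1: "C1_closure \<Omega> u" and pos: "\<And>x. x \<in> closure \<Omega> \<Longrightarrow> u x > 0"
    and sub: "viscosity_subsol \<Omega> u" and mean: "\<And>p. p \<in> frontier \<Omega> \<Longrightarrow> boundary_mean_curvature \<Omega> u p \<ge> 0"
    by blast
  note op = \<open>open \<Omega>\<close>
  define n where "n = real CARD('n)"
  have n: "n \<ge> 3" using assms(1) by (simp add: n_def)
  have clcomp: "compact (closure \<Omega>)" using \<open>bounded \<Omega>\<close> by simp
  have incl: "\<Omega> \<subseteq> closure \<Omega>" by (rule closure_subset)
  obtain G where G: "continuous_on (closure \<Omega>) G" "\<And>x. x \<in> \<Omega> \<Longrightarrow> G x = gradient u x"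
    and contu: "continuous_on (closure \<Omega>) u" and du: "\<And>x. x \<in> \<Omega> \<Longrightarrow> u differentiable (at x)"
    using C1 by (auto simp: C1_closure_def)
  define a where "a = 2 / (n - 2)"
  have a: "a > 0" using n by (simp add: a_def)
  \<comment> \<open>The gradient of 2/(n-2) ln u, extended continuously to the closure.\<close>
  define P where "P = (\<lambda>x. (a / u x) *\<^sub>R G x)"
  have contP: "continuous_on (closure \<Omega>) P"
    unfolding P_def using pos by (intro continuous_intros G(1) contu) (auto simp: less_imp_neq[symmetric] dest: pos)
  obtain R where R: "R > 0" "\<And>x. x \<in> closure \<Omega> \<Longrightarrow> norm x \<le> R"
    using bounded_pos[THEN iffD1, OF compact_imp_bounded[OF clcomp]] by blast
  define \<epsilon> where "\<epsilon> = 1 / (4 * R^2)"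
  have \<epsilon>: "\<epsilon> > 0" "\<epsilon> * R^2 = 1 / 4" using R by (auto simp: \<epsilon>_def)
  define \<psi> where "\<psi> = (\<lambda>x. a * ln (u x) + \<epsilon> / 2 * (norm x)^2)"
  define D where "D = (\<lambda>x. P x + \<epsilon> *\<^sub>R x)"
  define F :: "real^'n \<Rightarrow> real^'n \<Rightarrow> real^'n \<Rightarrow> real" where
    "F = (\<lambda>x p \<nu>. (n - 1) * \<epsilon> - (n - 3) / 2 * (norm (p - \<epsilon> *\<^sub>R x))^2 - ((p - \<epsilon> *\<^sub>R x) \<bullet> \<nu>)^2)"
  have vb: "viscosity_bound \<Omega> F \<psi>"
    using viscosity_bound_of_subsol[OF assms(1) sub, of \<epsilon>] pos incl unfolding F_def \<psi>_def a_def n_def by blast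
  have derln: "((\<lambda>x. ln (u x)) has_derivative (\<lambda>h. ((1 / u x) *\<^sub>R G x) \<bullet> h)) (at x)" if x: "x \<in> \<Omega>" for x
  proof -
    have "(u has_derivative (\<lambda>h. G x \<bullet> h)) (at x)" using has_derivative_gradient[OF du[OF x]] G(2)[OF x] by simp
    from DERIV_compose_FDERIV[OF DERIV_ln_divide this] pos[of x] incl x
    show ?thesis by (auto simp: mult.commute)
  qed
  have der: "(\<psi> has_derivative (\<lambda>h. D x \<bullet> h)) (at x)" if x: "x \<in> \<Omega>" for x
  proof -
    have "((\<lambda>x. a * ln (u x) + \<epsilon> / 2 * (x \<bullet> x)) has_derivative
        (\<lambda>h. a * (((1 / u x) *\<^sub>R G x) \<bullet> h) + \<epsilon> / 2 * (x \<bullet> h + h \<bullet> x))) (at x)"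
      by (intro has_derivative_add has_derivative_mult_right derln x has_derivative_inner has_derivative_ident)
    moreover have "a * (((1 / u x) *\<^sub>R G x) \<bullet> h) + \<epsilon> / 2 * (x \<bullet> h + h \<bullet> x) = D x \<bullet> h" for h
      by (simp add: D_def P_def inner_add_left inner_add_right inner_commute)
    ultimately show ?thesis by (simp add: \<psi>_def power2_norm_eq_inner)
  qed
  have contD: "continuous_on (closure \<Omega>) D" unfolding D_def by (intro continuous_intros contP)
  have cD: "continuous_on \<Omega> D" by (rule continuous_on_subset[OF contD incl])
  have cont\<psi>: "continuous_on (closure \<Omega>) \<psi>"
    unfolding \<psi>_def using pos by (intro continuous_intros contu) (auto simp: less_imp_neq[symmetric] dest: pos)
  have contF: "isCont (\<lambda>t. F (fst t) (fst (snd t)) (snd (snd t))) (x, p, \<nu>)" for x p \<nu>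
    unfolding F_def by (intro continuous_intros)
  \<comment> \<open>For |p| \<le> \<epsilon> R the vector p - \<epsilon> x has length at most 2
    \<epsilon> R, whose square is \<epsilon>; this leaves F \<ge> (n-1) \<epsilon>/2.\<close>
  define \<gamma> where "\<gamma> = \<epsilon> * R"
  define \<kappa> where "\<kappa> = (n - 1) * \<epsilon> / 2"
  have \<gamma>: "\<gamma> > 0" and \<kappa>: "\<kappa> > 0" using \<epsilon> R n by (auto simp: \<gamma>_def \<kappa>_def)
  have crit: "\<kappa> \<le> F x p \<nu>" if x: "x \<in> \<Omega>" and p: "norm p \<le> \<gamma>" and \<nu>: "norm \<nu> = 1" for x p \<nu>
  proof -
    define w where "w = p - \<epsilon> *\<^sub>R x"
    have "\<epsilon> * norm x \<le> \<epsilon> * R" using R(2)[of x] x incl \<epsilon> by (intro mult_left_mono) auto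
    moreover have "norm (\<epsilon> *\<^sub>R x) = \<epsilon> * norm x" using \<epsilon> by simp
    ultimately have "norm w \<le> 2 * (\<epsilon> * R)"
      using norm_triangle_ineq4[of p "\<epsilon> *\<^sub>R x"] p unfolding w_def \<gamma>_def by linarith
    then have "(norm w)^2 \<le> (2 * (\<epsilon> * R))^2" by (intro power_mono) auto
    also have "\<dots> = 4 * \<epsilon> * (\<epsilon> * R^2)" by (simp add: power2_eq_square)
    finally have w: "(norm w)^2 \<le> \<epsilon>" using \<epsilon> by simp
    have "\<bar>w \<bullet> \<nu>\<bar> \<le> norm w" using Cauchy_Schwarz_ineq2[of w \<nu>] \<nu> by simp
    then have "(w \<bullet> \<nu>)^2 \<le> (norm w)^2" by (simp add: abs_le_square_iff[symmetric])
    moreover have "(n - 3) / 2 * (norm w)^2 \<le> (n - 3) / 2 * \<epsilon>" using w n by (intro mult_left_mono) auto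
    ultimately have "F x p \<nu> \<ge> (n - 1) * \<epsilon> - (n - 3) / 2 * \<epsilon> - \<epsilon>"
      using w unfolding F_def w_def[symmetric] by linarith
    moreover have "(n - 1) * \<epsilon> - (n - 3) / 2 * \<epsilon> - \<epsilon> = \<kappa>" by (simp add: \<kappa>_def field_simps)
    ultimately show ?thesis by simp
  qed
  have H_bound: "(n - 1) * (P p \<bullet> inner_normal \<Omega> p) \<le> euclidean_mean_curvature (frontier \<Omega>) (inner_normal \<Omega>) p"
    if p: "p \<in> frontier \<Omega>" for p
  proof -
    have pc: "p \<in> closure \<Omega>" using p by (simp add: frontier_def)
    have pn: "p \<notin> \<Omega>" using p op by (simp add: frontier_def interior_open)
    \<comment> \<open>This makes the filter nontrivial, so that \<open>Lim\<close> in the definition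
      of the normal derivative is the limit found from G.\<close>
    have "p islimpt \<Omega>" using pc pn by (simp add: closure_def)
    then have nt: "at p within \<Omega> \<noteq> bot" by (simp add: trivial_limit_within)
    have "continuous_on (closure \<Omega>) (\<lambda>x. (1 / u x) *\<^sub>R G x)"
      using pos by (intro continuous_intros G(1) contu) (auto simp: less_imp_neq[symmetric] dest: pos)
    then have "((\<lambda>x. (1 / u x) *\<^sub>R G x) \<longlongrightarrow> (1 / u p) *\<^sub>R G p) (at p within closure \<Omega>)"
      using pc by (simp add: continuous_on_def)
    then have "((\<lambda>x. (1 / u x) *\<^sub>R G x) \<longlongrightarrow> (1 / u p) *\<^sub>R G p) (at p within \<Omega>)"
      by (rule tendsto_within_subset[OF _ incl])
    then have "(gradient (\<lambda>x. ln (u x)) \<longlongrightarrow> (1 / u p) *\<^sub>R G p) (at p within \<Omega>)"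
    proof (rule Lim_transform_eventually)
      show "eventually (\<lambda>x. (1 / u x) *\<^sub>R G x = gradient (\<lambda>x. ln (u x)) x) (at p within \<Omega>)"
        using gradient_eqI[OF derln] by (auto simp: eventually_at_filter intro!: always_eventually)
    qed
    then have lim: "Lim (at p within \<Omega>) (gradient (\<lambda>x. ln (u x))) = (1 / u p) *\<^sub>R G p"
      using nt by (rule tendsto_Lim[rotated])
    have "u p powr (- (2 / (n - 2))) > 0" using pos[OF pc] by simp
    then have "- (2 * (n - 1) / (n - 2)) * (((1 / u p) *\<^sub>R G p) \<bullet> inner_normal \<Omega> p)
        + euclidean_mean_curvature (frontier \<Omega>) (inner_normal \<Omega>) p \<ge> 0"
      using mean[OF p] unfolding boundary_mean_curvature_def boundary_normal_deriv_def lim n_def[symmetric] Let_def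
      by (simp add: zero_le_mult_iff)
    moreover have "2 * (n - 1) / (n - 2) * (((1 / u p) *\<^sub>R G p) \<bullet> inner_normal \<Omega> p) = (n - 1) * (P p \<bullet> inner_normal \<Omega> p)"
      by (simp add: P_def a_def)
    ultimately show ?thesis by simp
  qed
  obtain C1 C2 where C: "closed C1" "closed C2" "frontier \<Omega> \<subseteq> C1 \<union> C2" "C1 \<inter> C2 \<inter> frontier \<Omega> = {}"
      "C1 \<inter> frontier \<Omega> \<noteq> {}" "C2 \<inter> frontier \<Omega> \<noteq> {}"
    using assms(7) unfolding connected_closed by blast
  define K where "K = C1 \<inter> frontier \<Omega>"
  define K' where "K' = C2 \<inter> frontier \<Omega>"
  have fr: "frontier \<Omega> = K \<union> K'" "K \<inter> K' = {}" "K \<noteq> {}" "K' \<noteq> {}" using C by (auto simp: K_def K'_def)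
  have cfr: "compact (frontier \<Omega>)" using \<open>bounded \<Omega>\<close> by (simp add: compact_frontier_bounded)
  have cK: "compact K" "closed K'"
    using C cfr by (auto simp: K_def K'_def closed_Int_compact intro!: closed_Int)
  obtain d0 where d0: "d0 > 0" "\<And>x y. x \<in> K \<Longrightarrow> y \<in> K' \<Longrightarrow> d0 \<le> dist x y"
    using separate_compact_closed[OF cK fr(2)] by blast
  \<comment> \<open>The first entry serves the pairs with a frontier point (\<omega>^2 <
    \<epsilon>), the second the interior pairs (gradients differing by less than \<gamma>).\<close>
  define \<omega> where "\<omega> = min (sqrt \<epsilon> / 2) (\<gamma> / 2)"
  have \<omega>: "\<omega> > 0" "\<omega> \<le> \<gamma> / 2" using \<epsilon> \<gamma> by (auto simp: \<omega>_def)
  have "\<omega>^2 \<le> (sqrt \<epsilon> / 2)^2" using \<omega>(1) by (intro power_mono) (auto simp: \<omega>_def)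
  then have \<omega>2: "\<omega>^2 < \<epsilon>" using \<epsilon> by (simp add: power_divide)
  obtain d1 where d1: "d1 > 0" "\<And>x y. x \<in> closure \<Omega> \<Longrightarrow> y \<in> closure \<Omega> \<Longrightarrow> dist y x < d1 \<Longrightarrow> dist (P y) (P x) < \<omega>"
    using compact_uniformly_continuous[OF contP clcomp] \<omega>(1) unfolding uniformly_continuous_on_def by metis
  \<comment> \<open>d0/4 keeps frontier points less than 3 d apart in the same part, d1/2 controls P
    over distance d, and R/4 gives \<epsilon> d \<le> \<gamma>/4.\<close>
  define d where "d = min (d0 / 4) (min (d1 / 2) (R / 4))"
  have d: "d > 0" "3 * d < d0" "d < d1" "d \<le> R / 4" using d0 d1 R by (auto simp: d_def)
  have Pd: "norm (P y - P x) \<le> \<omega>" if "x \<in> closure \<Omega>" "y \<in> closure \<Omega>" "dist x y = d" for x y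
    using d1(2)[OF that(1,2)] d(3) that(3) by (simp add: dist_norm norm_minus_commute)
  have "pass \<Omega> K K' \<psi> d"
  proof
    \<comment> \<open>At a local maximum of \<psi> a constant touches from above, giving \<kappa>
      \<le> F \<le> 0.\<close>
    show "\<exists>x'\<in>\<Omega>. dist x' x < r \<and> \<psi> x < \<psi> x'" if x: "x \<in> \<Omega>" and r: "r > 0" for x r
    proof (rule ccontr)
      assume no: "\<not> ?thesis"
      define U where "U = \<Omega> \<inter> ball x r"
      obtain \<nu> :: "real^'n" where \<nu>: "norm \<nu> = 1" using vector_choose_size[of 1] by auto
      have "F x 0 \<nu> \<le> tangential_trace \<nu> 0"
        by (rule viscosity_boundD[OF vb _ C2_jet_const[of U 0], of x]) (use op x r no \<nu> in \<open>auto simp: U_def dist_commute not_less\<close>)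
      moreover have "\<kappa> \<le> F x 0 \<nu>" using \<gamma> by (intro crit x \<nu>) simp
      ultimately show False using \<kappa> by (simp add: tangential_trace_zero)
    qed
    show "d \<le> dist a b" if "a \<in> K" "b \<in> K'" for a b using d0(2)[OF that] d by linarith
  qed (use assms fr d cont\<psi> in auto)
  then interpret pass \<Omega> K K' \<psi> d .
  obtain c A B where AB: "A \<union> B = X c" "A \<inter> B = {}" "K \<subseteq> A" "K' \<subseteq> B"
    "\<And>a b. a \<in> A \<Longrightarrow> b \<in> B \<Longrightarrow> d \<le> dist a b" and "\<exists>a\<in>A. \<exists>b\<in>B. dist a b = d"
    by (rule closest_pair) (rule that)
  then obtain x y where xy: "x \<in> A" "y \<in> B" "dist x y = d" by blast
  have in_X: "z \<in> \<Omega> \<Longrightarrow> c \<le> \<psi> z \<Longrightarrow> z \<in> A \<or> z \<in> B" for z using AB(1) by (auto simp: X_def)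
  have of_X: "z \<in> A \<or> z \<in> B \<Longrightarrow> z \<in> frontier \<Omega> \<or> z \<in> \<Omega> \<and> c \<le> \<psi> z" for z using AB(1) by (auto simp: X_def)
  have boundary: False
    if p: "p \<in> frontier \<Omega>" and q: "q \<in> \<Omega>" "c \<le> \<psi> q" and pq: "dist p q = d"
      and sep: "\<And>z w. z \<in> \<Omega> \<Longrightarrow> dist z q < d \<Longrightarrow> w \<in> frontier \<Omega> \<Longrightarrow> dist w z < d \<Longrightarrow> \<psi> z < c" for p q
  proof -
    obtain U \<rho> where L: "local_defining_fun \<Omega> p U \<rho>"
      using \<open>smooth_boundary \<Omega>\<close> p unfolding smooth_boundary_def by blast
    obtain \<beta> where \<beta>: "\<beta> \<ge> 0" "D q = \<beta> *\<^sub>R inner_normal \<Omega> p"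
      "F q (D q) (inner_normal \<Omega> p) \<le> - (\<beta> * euclidean_mean_curvature (frontier \<Omega>) (inner_normal \<Omega>) p)"
      "norm (inner_normal \<Omega> p) = 1"
      by (rule boundary_closest_pair[OF op vb _ cD contF p L q(1) d(1) pq q(2)]) (erule der, erule (3) sep, rule that)
    have pc: "p \<in> closure \<Omega>" "q \<in> closure \<Omega>" using p q incl by (auto simp: frontier_def)
    show False
    proof (rule boundary_pair_contradiction[OF n \<beta>(4,2) _ \<beta>(1) H_bound[OF p] _ R(2)[OF pc(2)] \<epsilon>(1) eq_refl[OF \<epsilon>(2)] \<omega>2])
      show "(n - 1) * \<epsilon> - (n - 3) / 2 * (norm (D q - \<epsilon> *\<^sub>R q))\<^sup>2 - ((D q - \<epsilon> *\<^sub>R q) \<bullet> inner_normal \<Omega> p)\<^sup>2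
          \<le> - (\<beta> * euclidean_mean_curvature (frontier \<Omega>) (inner_normal \<Omega>) p)"
        using \<beta>(3) unfolding F_def .
      show "norm (P p - (D q - \<epsilon> *\<^sub>R q)) \<le> \<omega>" using Pd[OF pc(2,1)] pq by (simp add: D_def dist_commute)
    qed
  qed
  have triangle3: "dist w p < 3 * d" if "dist w z < d" "dist z q < d" "dist p q = d" for w z p q :: "real^'n"
    using dist_triangle[of w p z] dist_triangle[of z p q] that by (simp add: dist_commute)
  show False
  proof (cases "x \<in> frontier \<Omega>")
    case True
    have xK: "x \<in> K" using True xy(1) AB fr(1) by blast
    have "y \<notin> frontier \<Omega>"
    proof
      assume "y \<in> frontier \<Omega>"
      then have "y \<in> K'" using xy(2) AB fr(1) by blast
      then show False using d0(2)[OF xK, of y] xy(3) d(1,2) by linarith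
    qed
    then have y: "y \<in> \<Omega>" "c \<le> \<psi> y" using of_X xy(2) by blast+
    show False
    proof (rule boundary[OF True y xy(3)], rule ccontr)
      \<comment> \<open>Were \<psi> z \<ge> c, then z would lie in B, being closer than d to y. As w
        is within 3 d of x in K, it lies in K and so in A; but A and B are at least d apart.\<close>
      fix z w assume z: "z \<in> \<Omega>" "dist z y < d" "w \<in> frontier \<Omega>" "dist w z < d" "\<not> \<psi> z < c"
      then have "z \<in> B" using in_X[of z] AB(5)[of z y] xy(2) by auto
      have "w \<notin> K'" using d0(2)[OF xK, of w] triangle3[OF z(4,2) xy(3)] d by (auto simp: dist_commute)
      then have "w \<in> A" using z(3) fr(1) AB(3) by blast
      then show False using AB(5)[OF _ \<open>z \<in> B\<close>] z(4) by force
    qed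
  next
    case False
    then have x: "x \<in> \<Omega>" "c \<le> \<psi> x" using of_X xy(1) by blast+
    show False
    proof (cases "y \<in> frontier \<Omega>")
      case True
      have yK: "y \<in> K'" using True xy(2) AB fr(1) by blast
      have yx: "dist y x = d" using xy(3) by (simp add: dist_commute)
      show False
      proof (rule boundary[OF True x yx], rule ccontr)
        fix z w assume z: "z \<in> \<Omega>" "dist z x < d" "w \<in> frontier \<Omega>" "dist w z < d" "\<not> \<psi> z < c"
        then have "z \<in> A" using in_X[of z] AB(5)[of x z] xy(1) by (auto simp: dist_commute)
        have "w \<notin> K" using d0(2)[OF _ yK, of w] triangle3[OF z(4,2) yx] d by auto
        then have "w \<in> B" using z(3) fr(1) AB(4) by blast
        then show False using AB(5)[OF \<open>z \<in> A\<close>] z(4) by (force simp: dist_commute)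
      qed
    next
      case False
      then have y: "y \<in> \<Omega>" "c \<le> \<psi> y" using of_X xy(2) by blast+
      show False
      proof (rule no_interior_closest_pair[OF op vb _ cD contF \<kappa> _ x(1) y(1) d(1) xy(3) x(2) y(2)])
        fix z z' assume z: "z \<in> \<Omega>" "z' \<in> \<Omega>" "dist z x < d" "dist z' y < d" "c \<le> \<psi> z" "c \<le> \<psi> z'"
        have "z \<in> A" using in_X[of z] z AB(5)[of x z] xy(1) by (auto simp: dist_commute)
        moreover have "z' \<in> B" using in_X[of z'] z AB(5)[of z' y] xy(2) by auto
        ultimately show "d \<le> dist z z'" by (rule AB(5))
      next
        \<comment> \<open>The oscillation of P costs at most \<gamma>/2, and the added quadratic at
          most \<epsilon> d \<le> \<gamma>/4.\<close>
        have "D x - D y = (P x - P y) + \<epsilon> *\<^sub>R (x - y)" by (simp add: D_def scaleR_diff_right)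
        then have "norm (D x - D y) \<le> norm (P x - P y) + norm (\<epsilon> *\<^sub>R (x - y))" by (metis norm_triangle_ineq)
        moreover have "norm (\<epsilon> *\<^sub>R (x - y)) = \<epsilon> * d" using \<epsilon> xy(3) by (simp add: dist_norm)
        moreover have "\<epsilon> * d \<le> \<epsilon> * (R / 4)" using d \<epsilon> by (intro mult_left_mono) auto
        moreover have "norm (P x - P y) \<le> \<omega>" using Pd[of y x] x y incl xy(3) by (auto simp: dist_commute)
        moreover have "\<epsilon> * (R / 4) = \<gamma> / 4" by (simp add: \<gamma>_def)
        ultimately have "norm (D x - D y) \<le> \<omega> + \<gamma> / 4" by linarith
        then show "norm (D x - D y) < \<gamma>" using \<omega>(2) \<gamma> by linarith
      qed (erule der, erule (2) crit)
    qed
  qed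
qed

end
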